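(* Let $H$ be a braided vector space, $V$ a vector space and $W\subset V'$ a non-degenerate subspace. (1) Let $V$ be a right $H$-braided vector space via $\Psi_{VH}:V\otimes H\to H\otimes V$. Define $\Psi_{HW}:H\otimes W\to(V\otimes H')'$ by $\Psi_{HW}(a\otimes e)(v\otimes f):=\langle\langle e\otimes f,\Psi_{VH}(v\otimes a)\rangle\rangle$ ($f\in H'$). If $\Psi_{HW}$ is a bijection $H\otimes W\to W\otimes H\subset(V\otimes H')'$, then $\Psi_{HW}$ turns $W$ into a left $H$-braided vector space. If $H$ is a braided coalgebra and $\Psi_{VH}$ is compatible with the comultiplication of $H$, then so is $\Psi_{HW}$. If $H$ is a braided (unital) algebra and $\Psi_{VH}$ is compatible with the multiplication of $H$, then so is $\Psi_{HW}$. (2) Let $V$ be a left $H$-braided vector space via $\Psi_{HV}:H\otimes V\to V\otimes H$. Define $\Psi_{WH}:W\otimes H\to(H'\otimes V)'$ by $\Psi_{WH}(e\otimes a)(f\otimes v):=\langle\langle f\otimes e,\Psi_{HV}(a\otimes v)\rangle\rangle$. If $\Psi_{WH}$ is a bijection $W\otimes H\to H\otimes W\subset(H'\otimes V)'$, then $\Psi_{WH}$ turns $W$ into a right $H$-braided vector space, and it is compatible with the comultiplication (resp. multiplication) of $H$ if $H$ is a braided coalgebra (resp. braided (unital) algebra) and $\Psi_{HV}$ is compatible with it. (3) Let $V$ be a right $H$-braided vector space via $\Psi_{VH}$. Define $\Psi_{WH}^\circ:W\otimes H\to(H'\otimes V)'$ by $\Psi_{WH}^\circ(e\otimes a)(f\otimes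 v):=\langle\langle f\otimes e,\Psi_{VH}^{-1}(a\otimes v)\rangle\rangle$. If it is a bijection $W\otimes H\to H\otimes W$, then it turns $W$ into a right $H$-braided vector space, and it is compatible with the comultiplication (resp. multiplication) of $H$ if $H$ is a braided coalgebra (resp. braided (unital) algebra) and $\Psi_{VH}$ is compatible with it. (4) Let $V$ be a left $H$-braided vector space via $\Psi_{HV}$. Define $\Psi_{HW}^\circ:H\otimes W\to(V\otimes H')'$ by $\Psi_{HW}^\circ(a\otimes e)(v\otimes f):=\langle\langle e\otimes f,\Psi_{HV}^{-1}(v\otimes a)\rangle\rangle$. If it is a bijection $H\otimes W\to W\otimes H$, then it turns $W$ into a left $H$-braided vector space, and it is compatible with the comultiplication (resp. multiplication) of $H$ if $H$ is a braided coalgebra (resp. braided (unital) algebra) and $\Psi_{HV}$ is compatible with it.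
   Context: All vector spaces are over a fixed field $\mathbb K$, $\otimes$ is the algebraic tensor product, $X'$ is the full linear dual of $X$, and composition of maps is written by juxtaposition. A braiding on $V$ is a bijective linear map $\Psi_{VV}:V\otimes V\to V\otimes V$ with $(\Psi_{VV}\otimes\mathrm{id})(\mathrm{id}\otimes\Psi_{VV})(\Psi_{VV}\otimes\mathrm{id})=(\mathrm{id}\otimes\Psi_{VV})(\Psi_{VV}\otimes\mathrm{id})(\mathrm{id}\otimes\Psi_{VV})$; $V$ is then a braided vector space. Let $\Psi_{VW}:V\otimes W\to W\otimes V$ be bijective and linear. If $V$ is braided, $W$ is a left $V$-braided vector space if $(\Psi_{VW}\otimes\mathrm{id})(\mathrm{id}\otimes\Psi_{VW})(\Psi_{VV}\otimes\mathrm{id})=(\mathrm{id}\otimes\Psi_{VV})(\Psi_{VW}\otimes\mathrm{id})(\mathrm{id}\otimes\Psi_{VW})$. If $W$ is braided, $V$ is a right $W$-braided vector space if $(\mathrm{id}\otimes\Psi_{VW})(\Psi_{VW}\otimes\mathrm{id})(\mathrm{id}\otimes\Psi_{WW})=(\Psi_{WW}\otimes\mathrm{id})(\mathrm{id}\otimes\Psi_{VW})(\Psi_{VW}\otimes\mathrm{id})$. Compatibility of $\Psi=\Psi_{VW}$: with the multiplication of an algebra $V$: $\Psi(m_V\otimes\mathrm{id})=(\mathrm{id}\otimes m_V)(\Psi\otimes\mathrm{id})(\mathrm{id}\otimes\Psi)$ and $\Psi(1\otimes w)=w\otimes1$ if $1\in V$; with the multiplication of an algebra $W$: $\Psi(\mathrm{id}\otimes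 m_W)=(m_W\otimes\mathrm{id})(\mathrm{id}\otimes\Psi)(\Psi\otimes\mathrm{id})$ and $\Psi(v\otimes1)=1\otimes v$ if $1\in W$; with the comultiplication of a coalgebra $V$: $(\mathrm{id}\otimes\Delta)\Psi=(\Psi\otimes\mathrm{id})(\mathrm{id}\otimes\Psi)(\Delta\otimes\mathrm{id})$ and $(\mathrm{id}\otimes\varepsilon)\Psi=\varepsilon\otimes\mathrm{id}$; with the comultiplication of a coalgebra $W$: $(\Delta\otimes\mathrm{id})\Psi=(\mathrm{id}\otimes\Psi)(\Psi\otimes\mathrm{id})(\mathrm{id}\otimes\Delta)$ and $(\varepsilon\otimes\mathrm{id})\Psi=\mathrm{id}\otimes\varepsilon$. A braided (co)algebra is a (co)algebra with a braiding satisfying both compatibility conditions with its (co)multiplication. Duality notation: $\langle f,a\rangle=\langle a,f\rangle=f(a)$. $W\subset V'$ is non-degenerate if it separates the points of $V$. $\langle\langle\xi\otimes\eta,x\otimes y\rangle\rangle:=\langle\xi,y\rangle\langle\eta,x\rangle$. Tensor products are embedded into duals by $(\xi\otimes\eta)(x\otimes y)=\langle\xi,x\rangle\langle\eta,y\rangle$, e.g. $W\otimes H\subset(V\otimes H')'$ and $H\otimes W\subset(H'\otimes V)'$. *)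

theory Defs
  imports Complex_Main "HOL-Library.Function_Algebras"
begin

section \<open>Vector spaces, duals and the algebraic tensor product\<close>

text \<open>
  A vector space is a linear subspace \<open>space\<close> of a type carrying a vector space structure in
  the sense of \<^locale>\<open>vector_space\<close>; spaces of functions carry the pointwise structure
  (addition from \<^theory>\<open>HOL-Library.Function_Algebras\<close>, scalar multiplication \<open>fscale\<close>).
  The choice \<open>space = UNIV\<close> gives every vector space; the carrier is needed because duals,
  tensor products and subspaces of duals are proper subsets of function types.
\<close>

record ('k, 'a) vs =
  "space" :: "'a set"
  scale :: "'k \<Rightarrow> 'a \<Rightarrow> 'a"

definition vspace :: "('k::field, 'a::ab_group_add) vs \<Rightarrow> bool" where
  "vspace A \<longleftrightarrow> vector_space (scale A) \<and> module.subspace (scale A) (space A)"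

definition vsubspace :: "('k::field, 'a::ab_group_add) vs \<Rightarrow> ('k, 'a) vs \<Rightarrow> bool" where
  "vsubspace W A \<longleftrightarrow> vspace W \<and> space W \<subseteq> space A \<and> scale W = scale A"

definition linear_on ::
  "('k::field, 'a::ab_group_add) vs \<Rightarrow> ('k, 'b::ab_group_add) vs \<Rightarrow> ('a \<Rightarrow> 'b) \<Rightarrow> bool" where
  "linear_on A B f \<longleftrightarrow>
     (\<forall>x\<in>space A. f x \<in> space B) \<and>
     (\<forall>x\<in>space A. \<forall>y\<in>space A. f (x + y) = f x + f y) \<and>
     (\<forall>c. \<forall>x\<in>space A. f (scale A c x) = scale B c (f x))"

definition bilinear_on ::
  "('k::field, 'a::ab_group_add) vs \<Rightarrow> ('k, 'b::ab_group_add) vs \<Rightarrow> ('k, 'c::ab_group_add) vs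
     \<Rightarrow> ('a \<Rightarrow> 'b \<Rightarrow> 'c) \<Rightarrow> bool" where
  "bilinear_on A B C \<beta> \<longleftrightarrow>
     (\<forall>a\<in>space A. linear_on B C (\<beta> a)) \<and> (\<forall>b\<in>space B. linear_on A C (\<lambda>a. \<beta> a b))"

definition scalars :: "('k::field, 'k) vs" where
  "scalars = \<lparr>space = UNIV, scale = (*)\<rparr>"

definition fscale :: "'k::field \<Rightarrow> ('a \<Rightarrow> 'k) \<Rightarrow> 'a \<Rightarrow> 'k" where
  "fscale c f = (\<lambda>x. c * f x)"

text \<open>Functionals are normalised to vanish outside the carrier, so that equality of functionals
  on the carrier is equality in HOL.\<close>

definition dual :: "('k::field, 'a::ab_group_add) vs \<Rightarrow> ('k, 'a \<Rightarrow> 'k) vs" where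
  "dual A = \<lparr>space = {f. linear_on A scalars f \<and> (\<forall>x. x \<notin> space A \<longrightarrow> f x = 0)},
             scale = fscale\<rparr>"

definition nondegenerate :: "('k::field, 'a::ab_group_add) vs \<Rightarrow> ('k, 'a \<Rightarrow> 'k) vs \<Rightarrow> bool" where
  "nondegenerate V W \<longleftrightarrow>
     (\<forall>x\<in>space V. \<forall>y\<in>space V. x \<noteq> y \<longrightarrow> (\<exists>w\<in>space W. w x \<noteq> w y))"

text \<open>
  \<open>a \<otimes> b\<close> is realised as evaluation at \<open>(a, b)\<close> on the bilinear forms on \<open>A \<times> B\<close>, and the
  algebraic tensor product as the span of these evaluations.  This is a model of the tensor
  product: the universal property, for bilinear maps into arbitrary vector spaces, is proved
  below (\<open>tensor_universal\<close>), and all maps out of tensor products are defined through it.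
\<close>

definition tens ::
  "('k::field, 'a::ab_group_add) vs \<Rightarrow> ('k, 'b::ab_group_add) vs \<Rightarrow> 'a \<Rightarrow> 'b
     \<Rightarrow> ('a \<Rightarrow> 'b \<Rightarrow> 'k) \<Rightarrow> 'k" where
  "tens A B a b = (\<lambda>\<beta>. if bilinear_on A B scalars \<beta> then \<beta> a b else 0)"

definition tensor ::
  "('k::field, 'a::ab_group_add) vs \<Rightarrow> ('k, 'b::ab_group_add) vs
     \<Rightarrow> ('k, ('a \<Rightarrow> 'b \<Rightarrow> 'k) \<Rightarrow> 'k) vs" (infixl "\<otimes>" 70) where
  "A \<otimes> B = \<lparr>space = module.span fscale {tens A B a b | a b. a \<in> space A \<and> b \<in> space B},
             scale = fscale\<rparr>"

text \<open>The linear map \<open>A \<otimes> B \<rightarrow> C\<close> induced by a bilinear map \<open>\<beta>\<close>.\<close>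

definition tlift ::
  "('k::field, 'a::ab_group_add) vs \<Rightarrow> ('k, 'b::ab_group_add) vs \<Rightarrow> ('k, 'c::ab_group_add) vs
     \<Rightarrow> ('a \<Rightarrow> 'b \<Rightarrow> 'c) \<Rightarrow> (('a \<Rightarrow> 'b \<Rightarrow> 'k) \<Rightarrow> 'k) \<Rightarrow> 'c" where
  "tlift A B C \<beta> = (THE L. linear_on (A \<otimes> B) C L \<and>
     (\<forall>a\<in>space A. \<forall>b\<in>space B. L (tens A B a b) = \<beta> a b) \<and>
     (\<forall>t. t \<notin> space (A \<otimes> B) \<longrightarrow> L t = 0))"


subsection \<open>The universal property\<close>

lemma vector_space_fscale: "vector_space (fscale :: 'k::field \<Rightarrow> ('a \<Rightarrow> 'k) \<Rightarrow> 'a \<Rightarrow> 'k)"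
  by unfold_locales (auto simp: fscale_def fun_eq_iff algebra_simps)

lemma vspaceD:
  assumes "vspace A"
  shows "0 \<in> space A"
    and "x \<in> space A \<Longrightarrow> y \<in> space A \<Longrightarrow> x + y \<in> space A"
    and "x \<in> space A \<Longrightarrow> scale A c x \<in> space A"
    and "vector_space (scale A)"
proof -
  interpret vector_space "scale A" using assms by (simp add: vspace_def)
  have S: "subspace (space A)" using assms by (simp add: vspace_def)
  show "0 \<in> space A" using S by (rule subspace_0)
  show "x \<in> space A \<Longrightarrow> y \<in> space A \<Longrightarrow> x + y \<in> space A" using S by (rule subspace_add)
  show "x \<in> space A \<Longrightarrow> scale A c x \<in> space A" using S by (rule subspace_scale)
  show "vector_space (scale A)" by unfold_locales
qed

lemma vspace_scalars: "vspace (scalars :: ('k::field, 'k) vs)"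
proof -
  interpret vector_space "(*) :: 'k \<Rightarrow> 'k \<Rightarrow> 'k"
    by unfold_locales (simp_all add: algebra_simps)
  show ?thesis
    unfolding vspace_def scalars_def using vector_space_axioms subspace_UNIV by simp
qed

lemma vspace_dual:
  fixes A :: "('k::field, 'a::ab_group_add) vs"
  assumes "vspace A"
  shows "vspace (dual A)"
proof -
  interpret vector_space "fscale :: 'k \<Rightarrow> ('a \<Rightarrow> 'k) \<Rightarrow> 'a \<Rightarrow> 'k" by (rule vector_space_fscale)
  have "subspace (space (dual A))"
    unfolding subspace_def
    by (auto simp: dual_def linear_on_def scalars_def fscale_def algebra_simps)
  then show ?thesis
    unfolding vspace_def using vector_space_axioms by (simp add: dual_def)
qed

lemma vspace_tensor:
  fixes A :: "('k::field, 'a::ab_group_add) vs" and B :: "('k, 'b::ab_group_add) vs"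
  shows "vspace (A \<otimes> B)"
proof -
  interpret vector_space "fscale :: 'k \<Rightarrow> (('a \<Rightarrow> 'b \<Rightarrow> 'k) \<Rightarrow> 'k) \<Rightarrow> ('a \<Rightarrow> 'b \<Rightarrow> 'k) \<Rightarrow> 'k"
    by (rule vector_space_fscale)
  show ?thesis
    unfolding vspace_def tensor_def using vector_space_axioms subspace_span by simp
qed

lemma tens_in_tensor:
  fixes A :: "('k::field, 'a::ab_group_add) vs" and B :: "('k, 'b::ab_group_add) vs"
  assumes "a \<in> space A" and "b \<in> space B"
  shows "tens A B a b \<in> space (A \<otimes> B)"
proof -
  interpret vector_space "fscale :: 'k \<Rightarrow> (('a \<Rightarrow> 'b \<Rightarrow> 'k) \<Rightarrow> 'k) \<Rightarrow> ('a \<Rightarrow> 'b \<Rightarrow> 'k) \<Rightarrow> 'k"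
    by (rule vector_space_fscale)
  show ?thesis
    unfolding tensor_def using assms by (auto intro!: span_base)
qed

lemma bilinear_on_tens: "bilinear_on A B (A \<otimes> B) (tens A B)"
  unfolding bilinear_on_def linear_on_def
  by (auto intro: tens_in_tensor)
     (auto simp: tens_def fun_eq_iff tensor_def fscale_def bilinear_on_def linear_on_def scalars_def)

lemma tensor_induct [consumes 1, case_names tens zero add scale]:
  fixes A :: "('k::field, 'a::ab_group_add) vs" and B :: "('k, 'b::ab_group_add) vs"
  assumes t: "t \<in> space (A \<otimes> B)"
    and T: "\<And>a b. a \<in> space A \<Longrightarrow> b \<in> space B \<Longrightarrow> P (tens A B a b)"
    and Z: "P 0"
    and S: "\<And>s t. s \<in> space (A \<otimes> B) \<Longrightarrow> t \<in> space (A \<otimes> B) \<Longrightarrow> P s \<Longrightarrow> P t \<Longrightarrow> P (s + t)"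
    and C: "\<And>c t. t \<in> space (A \<otimes> B) \<Longrightarrow> P t \<Longrightarrow> P (scale (A \<otimes> B) c t)"
  shows "P t"
proof -
  interpret vector_space "fscale :: 'k \<Rightarrow> (('a \<Rightarrow> 'b \<Rightarrow> 'k) \<Rightarrow> 'k) \<Rightarrow> ('a \<Rightarrow> 'b \<Rightarrow> 'k) \<Rightarrow> 'k"
    by (rule vector_space_fscale)
  let ?G = "{tens A B a b | a b. a \<in> space A \<and> b \<in> space B}"
  have sp: "space (A \<otimes> B) = span ?G" and sc: "scale (A \<otimes> B) = fscale"
    by (simp_all add: tensor_def)
  have "t \<in> span ?G" using t sp by simp
  then have "t \<in> space (A \<otimes> B) \<and> P t"
  proof (induction rule: span_induct_alt)
    case base
    show ?case using Z vspaceD(1)[OF vspace_tensor] by blast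
  next
    case (step c x y)
    then obtain a b where x: "x = tens A B a b" and ab: "a \<in> space A" "b \<in> space B" by blast
    have xS: "x \<in> space (A \<otimes> B)" using ab x tens_in_tensor by blast
    have cS: "fscale c x \<in> space (A \<otimes> B)" using vspaceD(3)[OF vspace_tensor xS] sc by metis
    have "P (fscale c x)" using C[OF xS] T[OF ab] x sc by metis
    then show ?case using S cS step vspaceD(2)[OF vspace_tensor] by blast
  qed
  then show ?thesis by blast
qed

lemma dual_separates:
  assumes A: "vspace A" and x: "x \<in> space A" and y: "y \<in> space A" and ne: "x \<noteq> y"
  shows "\<exists>l\<in>space (dual A). l x \<noteq> l y"
proof -
  interpret vector_space "scale A" using A by (rule vspaceD(4))
  let ?z = "x - y"
  have ind: "independent {?z}" using ne by simp
  let ?B = "extend_basis {?z}"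
  define g where "g = (\<lambda>v. representation ?B v ?z)"
  interpret g: Vector_Spaces.linear "scale A" "(*)" g
    unfolding g_def using ind by (intro linear_representation independent_extend_basis span_extend_basis)
  have zB: "?z \<in> ?B" using extend_basis_superset[OF ind] by blast
  have "g ?z = 1"
    unfolding g_def using representation_basis[OF independent_extend_basis[OF ind] zB] by simp
  then have gxy: "g x \<noteq> g y" by (auto simp: g.diff)
  let ?l = "\<lambda>v. if v \<in> space A then g v else 0"
  have "?l \<in> space (dual A)"
    using A by (auto simp: dual_def linear_on_def scalars_def g.add g.scale vspaceD)
  then show ?thesis using gxy x y by (intro bexI[of _ ?l]) auto
qed

theorem tensor_universal:
  assumes C: "vspace C" and \<beta>: "bilinear_on A B C \<beta>"
  shows "\<exists>!L. linear_on (A \<otimes> B) C L \<and>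
     (\<forall>a\<in>space A. \<forall>b\<in>space B. L (tens A B a b) = \<beta> a b) \<and>
     (\<forall>t. t \<notin> space (A \<otimes> B) \<longrightarrow> L t = 0)" (is "\<exists>!L. ?P L")
proof -
  interpret C: vector_space "scale C" using C by (rule vspaceD(4))
  define Q where "Q t c \<longleftrightarrow> c \<in> space C \<and> (\<forall>l\<in>space (dual C). l c = t (\<lambda>a b. l (\<beta> a b)))" for t c
  have lin: "l (u + v) = l u + l v" "l (scale C k u) = k * l u"
    if "l \<in> space (dual C)" "u \<in> space C" "v \<in> space C" for l u v k
    using that by (auto simp: dual_def linear_on_def scalars_def)
  have \<beta>C: "\<beta> a b \<in> space C" if "a \<in> space A" "b \<in> space B" for a b
    using \<beta> that by (auto simp: bilinear_on_def linear_on_def)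
  have l\<beta>: "bilinear_on A B scalars (\<lambda>a b. l (\<beta> a b))" if "l \<in> space (dual C)" for l
    using that \<beta> by (auto simp: bilinear_on_def dual_def linear_on_def scalars_def)
  have Q_tens: "Q (tens A B a b) (\<beta> a b)" if "a \<in> space A" "b \<in> space B" for a b
    using that \<beta>C l\<beta> by (auto simp: Q_def tens_def)
  have Q_add: "Q (s + t) (c + d)" if "Q s c" "Q t d" for s t c d
    using that by (auto simp: Q_def lin vspaceD(2)[OF C])
  have Q_scale: "Q (scale (A \<otimes> B) k t) (scale C k c)" if "Q t c" for t c k
    using that by (auto simp: Q_def lin vspaceD(3)[OF C] tensor_def fscale_def)
  have Q_zero: "Q 0 0"
  proof -
    have "l 0 = 0" if "l \<in> space (dual C)" for l
      using lin(2)[OF that vspaceD(1)[OF C] vspaceD(1)[OF C], of 0] by simp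
    then show ?thesis by (auto simp: Q_def vspaceD(1)[OF C])
  qed
  have Q_ex: "\<exists>c. Q t c" if "t \<in> space (A \<otimes> B)" for t
    using that by (induction rule: tensor_induct) (use Q_tens Q_add Q_scale Q_zero in blast)+
  have Q_uniq: "c = d" if "Q t c" "Q t d" for t c d
  proof (rule ccontr)
    assume ne: "c \<noteq> d"
    have "c \<in> space C" "d \<in> space C" using that by (simp_all add: Q_def)
    then obtain l where l: "l \<in> space (dual C)" "l c \<noteq> l d"
      using dual_separates[OF C _ _ ne] by blast
    have "l c = l d" using that l(1) unfolding Q_def by metis
    then show False using l(2) by simp
  qed
  define L where "L t = (if t \<in> space (A \<otimes> B) then THE c. Q t c else 0)" for t
  have QL: "Q t (L t)" if "t \<in> space (A \<otimes> B)" for t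
    using theI'[of "Q t"] Q_ex[OF that] Q_uniq that unfolding L_def by metis
  have L_eq: "L t = c" if "t \<in> space (A \<otimes> B)" "Q t c" for t c
    using QL Q_uniq that by blast
  note AB = vspaceD[OF vspace_tensor[of A B]]
  have PL: "?P L"
  proof (intro conjI ballI allI impI)
    show "linear_on (A \<otimes> B) C L"
      unfolding linear_on_def
    proof (intro conjI ballI allI)
      show "L t \<in> space C" if "t \<in> space (A \<otimes> B)" for t using QL[OF that] by (simp add: Q_def)
      show "L (s + t) = L s + L t" if "s \<in> space (A \<otimes> B)" "t \<in> space (A \<otimes> B)" for s t
        using that by (intro L_eq Q_add QL AB)
      show "L (scale (A \<otimes> B) k t) = scale C k (L t)" if "t \<in> space (A \<otimes> B)" for k t
        using that by (intro L_eq Q_scale QL AB)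
    qed
    show "L (tens A B a b) = \<beta> a b" if "a \<in> space A" "b \<in> space B" for a b
      using that by (intro L_eq Q_tens tens_in_tensor)
    show "L t = 0" if "t \<notin> space (A \<otimes> B)" for t using that by (simp add: L_def)
  qed
  have "M = L" if M: "?P M" for M
  proof
    fix t
    show "M t = L t"
    proof (cases "t \<in> space (A \<otimes> B)")
      case True
      have "M t = L t \<and> M t \<in> space C"
        using True
      proof (induction rule: tensor_induct)
        case (tens a b)
        then show ?case using M PL \<beta>C by simp
      next
        case zero
        have "N 0 = 0" if "linear_on (A \<otimes> B) C N" for N
        proof -
          have "N (scale (A \<otimes> B) 0 0) = scale C 0 (N 0)"
            using that AB(1) by (simp add: linear_on_def)
          then show ?thesis by (simp add: tensor_def fscale_def zero_fun_def)
        qed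
        then have "M 0 = 0" "L 0 = 0" using M PL by blast+
        then show ?case using vspaceD(1)[OF C] by metis
      next
        case (add s t)
        have "N (s + t) = N s + N t" if "linear_on (A \<otimes> B) C N" for N
          using that add(1,2) unfolding linear_on_def by blast
        then have "M (s + t) = M s + M t" "L (s + t) = L s + L t" using M PL by blast+
        then show ?case using add(3,4) vspaceD(2)[OF C] by metis
      next
        case (scale c t)
        then show ?case using M PL vspaceD(3)[OF C] by (simp add: linear_on_def)
      qed
      then show ?thesis by blast
    next
      case False
      then show ?thesis using M PL by simp
    qed
  qed
  with PL show ?thesis by (rule ex1I)
qed

lemma tlift:
  assumes "vspace C" and "bilinear_on A B C \<beta>"
  shows "linear_on (A \<otimes> B) C (tlift A B C \<beta>)"
    and "a \<in> space A \<Longrightarrow> b \<in> space B \<Longrightarrow> tlift A B C \<beta> (tens A B a b) = \<beta> a b"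
    and "t \<notin> space (A \<otimes> B) \<Longrightarrow> tlift A B C \<beta> t = 0"
  using theI'[OF tensor_universal[OF assms]] unfolding tlift_def[symmetric] by blast+

lemma linear_on_0:
  assumes "vspace A" "vspace B" "linear_on A B f"
  shows "f 0 = 0"
proof -
  interpret A: vector_space "scale A" using assms(1) by (rule vspaceD(4))
  interpret B: vector_space "scale B" using assms(2) by (rule vspaceD(4))
  have "f (scale A 0 0) = scale B 0 (f 0)"
    using assms vspaceD(1)[of A] unfolding linear_on_def by blast
  then show ?thesis by simp
qed

lemma linear_on_cong:
  assumes "vspace A" and "\<And>x. x \<in> space A \<Longrightarrow> f x = g x"
  shows "linear_on A B f \<longleftrightarrow> linear_on A B g"
  using assms by (simp add: linear_on_def vspaceD)

lemma linear_on_pointwise: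
  assumes B: "vspace B"
  shows "linear_on A B (\<lambda>x. 0)"
    and "linear_on A B f \<Longrightarrow> linear_on A B g \<Longrightarrow> linear_on A B (\<lambda>x. f x + g x)"
    and "linear_on A B f \<Longrightarrow> linear_on A B (\<lambda>x. scale B c (f x))"
proof -
  interpret B: vector_space "scale B" using B by (rule vspaceD(4))
  show "linear_on A B (\<lambda>x. 0)"
    "linear_on A B f \<Longrightarrow> linear_on A B g \<Longrightarrow> linear_on A B (\<lambda>x. f x + g x)"
    "linear_on A B f \<Longrightarrow> linear_on A B (\<lambda>x. scale B c (f x))"
    by (auto simp: linear_on_def vspaceD[OF B] B.scale_right_distrib B.scale_left_commute)
qed

lemma bilinear_on_tlift:
  assumes C: "vspace C" and D: "vspace D"
    and bil: "\<And>c. c \<in> space C \<Longrightarrow> bilinear_on A B D (\<lambda>a b. \<beta> a b c)"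
    and lin: "\<And>a b. a \<in> space A \<Longrightarrow> b \<in> space B \<Longrightarrow> linear_on C D (\<beta> a b)"
  shows "bilinear_on (A \<otimes> B) C D (\<lambda>t c. tlift A B D (\<lambda>a b. \<beta> a b c) t)"
    and "bilinear_on C (A \<otimes> B) D (\<lambda>c t. tlift A B D (\<lambda>a b. \<beta> a b c) t)"
proof -
  let ?L = "\<lambda>c. tlift A B D (\<lambda>a b. \<beta> a b c)"
  have L: "linear_on (A \<otimes> B) D (?L c)" if "c \<in> space C" for c
    using tlift(1)[OF D bil[OF that]] .
  have "linear_on C D (\<lambda>c. ?L c t)" if "t \<in> space (A \<otimes> B)" for t
    using that
  proof (induction rule: tensor_induct)
    case (tens a b)
    have "linear_on C D (\<lambda>c. ?L c (tens A B a b)) \<longleftrightarrow> linear_on C D (\<beta> a b)"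
      using tens by (intro linear_on_cong[OF C]) (simp add: tlift(2)[OF D bil])
    then show ?case using lin[OF tens] by (rule iffD2)
  next
    case zero
    have "linear_on C D (\<lambda>c. ?L c 0) \<longleftrightarrow> linear_on C D (\<lambda>c. 0)"
      by (intro linear_on_cong[OF C] linear_on_0[OF vspace_tensor D L])
    then show ?case using linear_on_pointwise(1)[OF D] by (rule iffD2)
  next
    case (add s t)
    have "linear_on C D (\<lambda>c. ?L c (s + t)) \<longleftrightarrow> linear_on C D (\<lambda>c. ?L c s + ?L c t)"
      using L add(1,2) by (intro linear_on_cong[OF C]) (simp add: linear_on_def)
    then show ?case using linear_on_pointwise(2)[OF D add(3,4)] by (rule iffD2)
  next
    case (scale k t)
    have "linear_on C D (\<lambda>c. ?L c (vs.scale (A \<otimes> B) k t)) \<longleftrightarrow> linear_on C D (\<lambda>c. vs.scale D k (?L c t))"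
      using L scale(1) by (intro linear_on_cong[OF C]) (simp add: linear_on_def)
    then show ?case using linear_on_pointwise(3)[OF D scale(2)] by (rule iffD2)
  qed
  then show "bilinear_on (A \<otimes> B) C D (\<lambda>t c. ?L c t)" "bilinear_on C (A \<otimes> B) D ?L"
    using L by (auto simp: bilinear_on_def)
qed

lemma bilinear_on_comp:
  assumes "bilinear_on C D E \<beta>" and "linear_on A C f" and "linear_on B D g"
  shows "bilinear_on A B E (\<lambda>a b. \<beta> (f a) (g b))"
  using assms by (simp add: bilinear_on_def linear_on_def)

lemma linear_on_id: "linear_on A A id"
  by (simp add: linear_on_def)


section \<open>Canonical maps\<close>

text \<open>\<open>f \<otimes> g : A \<otimes> B \<rightarrow> C \<otimes> D\<close> for \<open>f : A \<rightarrow> C\<close> and \<open>g : B \<rightarrow> D\<close>.\<close>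

definition tmap ::
  "('k::field, 'a::ab_group_add) vs \<Rightarrow> ('k, 'b::ab_group_add) vs
     \<Rightarrow> ('k, 'c::ab_group_add) vs \<Rightarrow> ('k, 'd::ab_group_add) vs \<Rightarrow> ('a \<Rightarrow> 'c) \<Rightarrow> ('b \<Rightarrow> 'd)
     \<Rightarrow> (('a \<Rightarrow> 'b \<Rightarrow> 'k) \<Rightarrow> 'k) \<Rightarrow> ('c \<Rightarrow> 'd \<Rightarrow> 'k) \<Rightarrow> 'k" where
  "tmap A B C D f g = tlift A B (C \<otimes> D) (\<lambda>a b. tens C D (f a) (g b))"

text \<open>\<open>(a \<otimes> b) \<otimes> c \<mapsto> a \<otimes> (b \<otimes> c)\<close> and back.\<close>

definition assoc ::
  "('k::field, 'a::ab_group_add) vs \<Rightarrow> ('k, 'b::ab_group_add) vs \<Rightarrow> ('k, 'c::ab_group_add) vs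
     \<Rightarrow> (((('a \<Rightarrow> 'b \<Rightarrow> 'k) \<Rightarrow> 'k) \<Rightarrow> 'c \<Rightarrow> 'k) \<Rightarrow> 'k)
     \<Rightarrow> ('a \<Rightarrow> (('b \<Rightarrow> 'c \<Rightarrow> 'k) \<Rightarrow> 'k) \<Rightarrow> 'k) \<Rightarrow> 'k" where
  "assoc A B C = tlift (A \<otimes> B) C (A \<otimes> (B \<otimes> C))
     (\<lambda>t c. tlift A B (A \<otimes> (B \<otimes> C)) (\<lambda>a b. tens A (B \<otimes> C) a (tens B C b c)) t)"

definition assoc_inv ::
  "('k::field, 'a::ab_group_add) vs \<Rightarrow> ('k, 'b::ab_group_add) vs \<Rightarrow> ('k, 'c::ab_group_add) vs
     \<Rightarrow> (('a \<Rightarrow> (('b \<Rightarrow> 'c \<Rightarrow> 'k) \<Rightarrow> 'k) \<Rightarrow> 'k) \<Rightarrow> 'k)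
     \<Rightarrow> ((('a \<Rightarrow> 'b \<Rightarrow> 'k) \<Rightarrow> 'k) \<Rightarrow> 'c \<Rightarrow> 'k) \<Rightarrow> 'k" where
  "assoc_inv A B C = tlift A (B \<otimes> C) ((A \<otimes> B) \<otimes> C)
     (\<lambda>a t. tlift B C ((A \<otimes> B) \<otimes> C) (\<lambda>b c. tens (A \<otimes> B) C (tens A B a b) c) t)"

text \<open>\<open>\<K> \<otimes> A \<rightarrow> A\<close> and \<open>A \<otimes> \<K> \<rightarrow> A\<close>.\<close>

definition lunit ::
  "('k::field, 'a::ab_group_add) vs \<Rightarrow> (('k \<Rightarrow> 'a \<Rightarrow> 'k) \<Rightarrow> 'k) \<Rightarrow> 'a" where
  "lunit A = tlift scalars A A (\<lambda>c a. scale A c a)"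

definition runit ::
  "('k::field, 'a::ab_group_add) vs \<Rightarrow> (('a \<Rightarrow> 'k \<Rightarrow> 'k) \<Rightarrow> 'k) \<Rightarrow> 'a" where
  "runit A = tlift A scalars A (\<lambda>a c. scale A c a)"

lemma tmap:
  assumes "linear_on A C f" and "linear_on B D g"
  shows "linear_on (A \<otimes> B) (C \<otimes> D) (tmap A B C D f g)"
    and "a \<in> space A \<Longrightarrow> b \<in> space B \<Longrightarrow>
           tmap A B C D f g (tens A B a b) = tens C D (f a) (g b)"
  unfolding tmap_def using tlift[OF vspace_tensor bilinear_on_comp[OF bilinear_on_tens assms]]
  by blast+

lemma assoc:
  assumes A: "vspace A" and C: "vspace C"
  shows "linear_on ((A \<otimes> B) \<otimes> C) (A \<otimes> (B \<otimes> C)) (assoc A B C)"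
    and "a \<in> space A \<Longrightarrow> b \<in> space B \<Longrightarrow> c \<in> space C \<Longrightarrow>
           assoc A B C (tens (A \<otimes> B) C (tens A B a b) c) = tens A (B \<otimes> C) a (tens B C b c)"
proof -
  have 1: "bilinear_on A B (A \<otimes> (B \<otimes> C)) (\<lambda>a b. tens A (B \<otimes> C) a (tens B C b c))"
    if "c \<in> space C" for c
    using that bilinear_on_comp[OF bilinear_on_tens linear_on_id, of B "B \<otimes> C" "\<lambda>b. tens B C b c" A]
      bilinear_on_tens[of B C] by (simp add: bilinear_on_def)
  have 2: "linear_on C (A \<otimes> (B \<otimes> C)) (\<lambda>c. tens A (B \<otimes> C) a (tens B C b c))"
    if "a \<in> space A" "b \<in> space B" for a b
    using that bilinear_on_comp[OF bilinear_on_tens linear_on_id, of C "B \<otimes> C" "tens B C b" A]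
      bilinear_on_tens[of B C] by (simp add: bilinear_on_def)
  note bil = bilinear_on_tlift(1)[OF C vspace_tensor 1 2]
  show "linear_on ((A \<otimes> B) \<otimes> C) (A \<otimes> (B \<otimes> C)) (assoc A B C)"
    unfolding assoc_def by (rule tlift(1)[OF vspace_tensor bil])
  show "assoc A B C (tens (A \<otimes> B) C (tens A B a b) c) = tens A (B \<otimes> C) a (tens B C b c)"
    if "a \<in> space A" "b \<in> space B" "c \<in> space C"
    unfolding assoc_def using that
    by (simp add: tlift(2)[OF vspace_tensor bil] tlift(2)[OF vspace_tensor 1] tens_in_tensor)
qed

lemma assoc_inv:
  assumes A: "vspace A" and C: "vspace C"
  shows "linear_on (A \<otimes> (B \<otimes> C)) ((A \<otimes> B) \<otimes> C) (assoc_inv A B C)"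
    and "a \<in> space A \<Longrightarrow> b \<in> space B \<Longrightarrow> c \<in> space C \<Longrightarrow>
           assoc_inv A B C (tens A (B \<otimes> C) a (tens B C b c)) = tens (A \<otimes> B) C (tens A B a b) c"
proof -
  have 1: "bilinear_on B C ((A \<otimes> B) \<otimes> C) (\<lambda>b c. tens (A \<otimes> B) C (tens A B a b) c)"
    if "a \<in> space A" for a
    using that bilinear_on_comp[OF bilinear_on_tens _ linear_on_id, of B "A \<otimes> B" "tens A B a" C]
      bilinear_on_tens[of A B] by (simp add: bilinear_on_def)
  have 2: "linear_on A ((A \<otimes> B) \<otimes> C) (\<lambda>a. tens (A \<otimes> B) C (tens A B a b) c)"
    if "b \<in> space B" "c \<in> space C" for b c
    using that bilinear_on_comp[OF bilinear_on_tens _ linear_on_id, of A "A \<otimes> B" "\<lambda>a. tens A B a b" C]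
      bilinear_on_tens[of A B] by (simp add: bilinear_on_def)
  note bil = bilinear_on_tlift(2)[OF A vspace_tensor 1 2]
  show "linear_on (A \<otimes> (B \<otimes> C)) ((A \<otimes> B) \<otimes> C) (assoc_inv A B C)"
    unfolding assoc_inv_def by (rule tlift(1)[OF vspace_tensor bil])
  show "assoc_inv A B C (tens A (B \<otimes> C) a (tens B C b c)) = tens (A \<otimes> B) C (tens A B a b) c"
    if "a \<in> space A" "b \<in> space B" "c \<in> space C"
    unfolding assoc_inv_def using that
    by (simp add: tlift(2)[OF vspace_tensor bil] tlift(2)[OF vspace_tensor 1] tens_in_tensor)
qed

lemma bilinear_on_scale:
  assumes A: "vspace A"
  shows "bilinear_on scalars A A (\<lambda>c a. scale A c a)" and "bilinear_on A scalars A (\<lambda>a c. scale A c a)"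
proof -
  interpret A: vector_space "scale A" using A by (rule vspaceD(4))
  show "bilinear_on scalars A A (\<lambda>c a. scale A c a)" "bilinear_on A scalars A (\<lambda>a c. scale A c a)"
    by (auto simp: bilinear_on_def linear_on_def scalars_def vspaceD[OF A]
        A.scale_left_distrib A.scale_right_distrib mult.commute)
qed

lemma lunit_runit_tens:
  assumes "vspace A" and "a \<in> space A"
  shows "lunit A (tens scalars A c a) = scale A c a" and "runit A (tens A scalars a c) = scale A c a"
proof -
  have c: "c \<in> space scalars" by (simp add: scalars_def)
  show "lunit A (tens scalars A c a) = scale A c a" "runit A (tens A scalars a c) = scale A c a"
    unfolding lunit_def runit_def
    using tlift(2)[OF assms(1) bilinear_on_scale(1)[OF assms(1)] c assms(2)]
      tlift(2)[OF assms(1) bilinear_on_scale(2)[OF assms(1)] assms(2) c] by simp_all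
qed

text \<open>
  All threefold tensor products are bracketed to the left.  For \<open>\<Psi> : A \<otimes> B \<rightarrow> B \<otimes> A\<close>,
  \<open>leg12\<close> is \<open>\<Psi> \<otimes> id : A \<otimes> B \<otimes> C \<rightarrow> B \<otimes> A \<otimes> C\<close>; for \<open>\<Psi> : B \<otimes> C \<rightarrow> C \<otimes> B\<close>,
  \<open>leg23\<close> is \<open>id \<otimes> \<Psi> : A \<otimes> B \<otimes> C \<rightarrow> A \<otimes> C \<otimes> B\<close>.
\<close>

definition leg12 ::
  "('k::field, 'a::ab_group_add) vs \<Rightarrow> ('k, 'b::ab_group_add) vs \<Rightarrow> ('k, 'c::ab_group_add) vs
     \<Rightarrow> ((('a \<Rightarrow> 'b \<Rightarrow> 'k) \<Rightarrow> 'k) \<Rightarrow> ('b \<Rightarrow> 'a \<Rightarrow> 'k) \<Rightarrow> 'k)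
     \<Rightarrow> (((('a \<Rightarrow> 'b \<Rightarrow> 'k) \<Rightarrow> 'k) \<Rightarrow> 'c \<Rightarrow> 'k) \<Rightarrow> 'k)
     \<Rightarrow> ((('b \<Rightarrow> 'a \<Rightarrow> 'k) \<Rightarrow> 'k) \<Rightarrow> 'c \<Rightarrow> 'k) \<Rightarrow> 'k" where
  "leg12 A B C \<Psi> = tmap (A \<otimes> B) C (B \<otimes> A) C \<Psi> id"

definition leg23 ::
  "('k::field, 'a::ab_group_add) vs \<Rightarrow> ('k, 'b::ab_group_add) vs \<Rightarrow> ('k, 'c::ab_group_add) vs
     \<Rightarrow> ((('b \<Rightarrow> 'c \<Rightarrow> 'k) \<Rightarrow> 'k) \<Rightarrow> ('c \<Rightarrow> 'b \<Rightarrow> 'k) \<Rightarrow> 'k)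
     \<Rightarrow> (((('a \<Rightarrow> 'b \<Rightarrow> 'k) \<Rightarrow> 'k) \<Rightarrow> 'c \<Rightarrow> 'k) \<Rightarrow> 'k)
     \<Rightarrow> ((('a \<Rightarrow> 'c \<Rightarrow> 'k) \<Rightarrow> 'k) \<Rightarrow> 'b \<Rightarrow> 'k) \<Rightarrow> 'k" where
  "leg23 A B C \<Psi> = assoc_inv A C B \<circ> tmap A (B \<otimes> C) A (C \<otimes> B) id \<Psi> \<circ> assoc A B C"


section \<open>Braidings\<close>

definition bij_linear ::
  "('k::field, 'a::ab_group_add) vs \<Rightarrow> ('k, 'b::ab_group_add) vs \<Rightarrow> ('a \<Rightarrow> 'b) \<Rightarrow> bool" where
  "bij_linear A B f \<longleftrightarrow> linear_on A B f \<and> bij_betw f (space A) (space B)"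

definition braiding ::
  "('k::field, 'v::ab_group_add) vs
     \<Rightarrow> ((('v \<Rightarrow> 'v \<Rightarrow> 'k) \<Rightarrow> 'k) \<Rightarrow> ('v \<Rightarrow> 'v \<Rightarrow> 'k) \<Rightarrow> 'k) \<Rightarrow> bool" where
  "braiding V \<Psi> \<longleftrightarrow> bij_linear (V \<otimes> V) (V \<otimes> V) \<Psi> \<and>
     (\<forall>t\<in>space (V \<otimes> V \<otimes> V).
        leg12 V V V \<Psi> (leg23 V V V \<Psi> (leg12 V V V \<Psi> t)) =
        leg23 V V V \<Psi> (leg12 V V V \<Psi> (leg23 V V V \<Psi> t)))"

text \<open>\<open>left_braided V \<Psi>\<^sub>V\<^sub>V W \<Psi>\<close>: \<open>W\<close> is left \<open>V\<close>-braided via \<open>\<Psi> : V \<otimes> W \<rightarrow> W \<otimes> V\<close>;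
  \<open>right_braided V W \<Psi>\<^sub>W\<^sub>W \<Psi>\<close>: \<open>V\<close> is right \<open>W\<close>-braided via \<open>\<Psi> : V \<otimes> W \<rightarrow> W \<otimes> V\<close>.\<close>

definition left_braided ::
  "('k::field, 'v::ab_group_add) vs
     \<Rightarrow> ((('v \<Rightarrow> 'v \<Rightarrow> 'k) \<Rightarrow> 'k) \<Rightarrow> ('v \<Rightarrow> 'v \<Rightarrow> 'k) \<Rightarrow> 'k)
     \<Rightarrow> ('k, 'w::ab_group_add) vs
     \<Rightarrow> ((('v \<Rightarrow> 'w \<Rightarrow> 'k) \<Rightarrow> 'k) \<Rightarrow> ('w \<Rightarrow> 'v \<Rightarrow> 'k) \<Rightarrow> 'k) \<Rightarrow> bool" where
  "left_braided V \<Psi>VV W \<Psi> \<longleftrightarrow> bij_linear (V \<otimes> W) (W \<otimes> V) \<Psi> \<and>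
     (\<forall>t\<in>space (V \<otimes> V \<otimes> W).
        leg12 V W V \<Psi> (leg23 V V W \<Psi> (leg12 V V W \<Psi>VV t)) =
        leg23 W V V \<Psi>VV (leg12 V W V \<Psi> (leg23 V V W \<Psi> t)))"

definition right_braided ::
  "('k::field, 'v::ab_group_add) vs \<Rightarrow> ('k, 'w::ab_group_add) vs
     \<Rightarrow> ((('w \<Rightarrow> 'w \<Rightarrow> 'k) \<Rightarrow> 'k) \<Rightarrow> ('w \<Rightarrow> 'w \<Rightarrow> 'k) \<Rightarrow> 'k)
     \<Rightarrow> ((('v \<Rightarrow> 'w \<Rightarrow> 'k) \<Rightarrow> 'k) \<Rightarrow> ('w \<Rightarrow> 'v \<Rightarrow> 'k) \<Rightarrow> 'k) \<Rightarrow> bool" where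
  "right_braided V W \<Psi>WW \<Psi> \<longleftrightarrow> bij_linear (V \<otimes> W) (W \<otimes> V) \<Psi> \<and>
     (\<forall>t\<in>space (V \<otimes> W \<otimes> W).
        leg23 W V W \<Psi> (leg12 V W W \<Psi> (leg23 V W W \<Psi>WW t)) =
        leg12 W W V \<Psi>WW (leg23 W V W \<Psi> (leg12 V W W \<Psi> t)))"


definition braid_inv ::
  "('k::field, 'v::ab_group_add) vs \<Rightarrow> ('k, 'w::ab_group_add) vs
     \<Rightarrow> ((('v \<Rightarrow> 'w \<Rightarrow> 'k) \<Rightarrow> 'k) \<Rightarrow> ('w \<Rightarrow> 'v \<Rightarrow> 'k) \<Rightarrow> 'k)
     \<Rightarrow> (('w \<Rightarrow> 'v \<Rightarrow> 'k) \<Rightarrow> 'k) \<Rightarrow> ('v \<Rightarrow> 'w \<Rightarrow> 'k) \<Rightarrow> 'k" where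
  "braid_inv V W \<Psi> = inv_into (space (V \<otimes> W)) \<Psi>"


section \<open>Braided algebras and coalgebras\<close>

text \<open>The unit is optional: \<open>algebra A m None\<close> is an associative algebra without a
  distinguished unit, \<open>algebra A m (Some e)\<close> a unital one with unit \<open>e\<close>.\<close>

definition algebra ::
  "('k::field, 'a::ab_group_add) vs \<Rightarrow> ((('a \<Rightarrow> 'a \<Rightarrow> 'k) \<Rightarrow> 'k) \<Rightarrow> 'a) \<Rightarrow> 'a option \<Rightarrow> bool" where
  "algebra A m u \<longleftrightarrow> linear_on (A \<otimes> A) A m \<and>
     (\<forall>t\<in>space (A \<otimes> A \<otimes> A).
        m (tmap (A \<otimes> A) A A A m id t) = m (tmap A (A \<otimes> A) A A id m (assoc A A A t))) \<and>
     (\<forall>e. u = Some e \<longrightarrow> e \<in> space A \<and>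
        (\<forall>a\<in>space A. m (tens A A e a) = a \<and> m (tens A A a e) = a))"

definition coalgebra ::
  "('k::field, 'a::ab_group_add) vs \<Rightarrow> ('a \<Rightarrow> ('a \<Rightarrow> 'a \<Rightarrow> 'k) \<Rightarrow> 'k) \<Rightarrow> ('a \<Rightarrow> 'k) \<Rightarrow> bool" where
  "coalgebra A \<Delta> \<epsilon> \<longleftrightarrow> linear_on A (A \<otimes> A) \<Delta> \<and> linear_on A scalars \<epsilon> \<and>
     (\<forall>a\<in>space A.
        tmap A A (A \<otimes> A) A \<Delta> id (\<Delta> a) = assoc_inv A A A (tmap A A A (A \<otimes> A) id \<Delta> (\<Delta> a))) \<and>
     (\<forall>a\<in>space A. lunit A (tmap A A scalars A \<epsilon> id (\<Delta> a)) = a \<and>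
                  runit A (tmap A A A scalars id \<epsilon> (\<Delta> a)) = a)"

text \<open>Compatibility of \<open>\<Psi> : V \<otimes> W \<rightarrow> W \<otimes> V\<close> with the structure of the left factor \<open>V\<close>
  (\<open>_left\<close>) or of the right factor \<open>W\<close> (\<open>_right\<close>).\<close>

definition mult_compat_left ::
  "('k::field, 'v::ab_group_add) vs \<Rightarrow> ('k, 'w::ab_group_add) vs
     \<Rightarrow> ((('v \<Rightarrow> 'w \<Rightarrow> 'k) \<Rightarrow> 'k) \<Rightarrow> ('w \<Rightarrow> 'v \<Rightarrow> 'k) \<Rightarrow> 'k)
     \<Rightarrow> ((('v \<Rightarrow> 'v \<Rightarrow> 'k) \<Rightarrow> 'k) \<Rightarrow> 'v) \<Rightarrow> 'v option \<Rightarrow> bool" where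
  "mult_compat_left V W \<Psi> m u \<longleftrightarrow>
     (\<forall>t\<in>space (V \<otimes> V \<otimes> W).
        \<Psi> (tmap (V \<otimes> V) W V W m id t) =
        tmap W (V \<otimes> V) W V id m (assoc W V V (leg12 V W V \<Psi> (leg23 V V W \<Psi> t)))) \<and>
     (\<forall>e. u = Some e \<longrightarrow> (\<forall>w\<in>space W. \<Psi> (tens V W e w) = tens W V w e))"

definition mult_compat_right ::
  "('k::field, 'v::ab_group_add) vs \<Rightarrow> ('k, 'w::ab_group_add) vs
     \<Rightarrow> ((('v \<Rightarrow> 'w \<Rightarrow> 'k) \<Rightarrow> 'k) \<Rightarrow> ('w \<Rightarrow> 'v \<Rightarrow> 'k) \<Rightarrow> 'k)
     \<Rightarrow> ((('w \<Rightarrow> 'w \<Rightarrow> 'k) \<Rightarrow> 'k) \<Rightarrow> 'w) \<Rightarrow> 'w option \<Rightarrow> bool" where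
  "mult_compat_right V W \<Psi> m u \<longleftrightarrow>
     (\<forall>t\<in>space (V \<otimes> W \<otimes> W).
        \<Psi> (tmap V (W \<otimes> W) V W id m (assoc V W W t)) =
        tmap (W \<otimes> W) V W V m id (leg23 W V W \<Psi> (leg12 V W W \<Psi> t))) \<and>
     (\<forall>e. u = Some e \<longrightarrow> (\<forall>v\<in>space V. \<Psi> (tens V W v e) = tens W V e v))"

definition comult_compat_left ::
  "('k::field, 'v::ab_group_add) vs \<Rightarrow> ('k, 'w::ab_group_add) vs
     \<Rightarrow> ((('v \<Rightarrow> 'w \<Rightarrow> 'k) \<Rightarrow> 'k) \<Rightarrow> ('w \<Rightarrow> 'v \<Rightarrow> 'k) \<Rightarrow> 'k)
     \<Rightarrow> ('v \<Rightarrow> ('v \<Rightarrow> 'v \<Rightarrow> 'k) \<Rightarrow> 'k) \<Rightarrow> ('v \<Rightarrow> 'k) \<Rightarrow> bool" where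
  "comult_compat_left V W \<Psi> \<Delta> \<epsilon> \<longleftrightarrow>
     (\<forall>t\<in>space (V \<otimes> W).
        assoc_inv W V V (tmap W V W (V \<otimes> V) id \<Delta> (\<Psi> t)) =
        leg12 V W V \<Psi> (leg23 V V W \<Psi> (tmap V W (V \<otimes> V) W \<Delta> id t))) \<and>
     (\<forall>t\<in>space (V \<otimes> W).
        runit W (tmap W V W scalars id \<epsilon> (\<Psi> t)) = lunit W (tmap V W scalars W \<epsilon> id t))"

definition comult_compat_right ::
  "('k::field, 'v::ab_group_add) vs \<Rightarrow> ('k, 'w::ab_group_add) vs
     \<Rightarrow> ((('v \<Rightarrow> 'w \<Rightarrow> 'k) \<Rightarrow> 'k) \<Rightarrow> ('w \<Rightarrow> 'v \<Rightarrow> 'k) \<Rightarrow> 'k)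
     \<Rightarrow> ('w \<Rightarrow> ('w \<Rightarrow> 'w \<Rightarrow> 'k) \<Rightarrow> 'k) \<Rightarrow> ('w \<Rightarrow> 'k) \<Rightarrow> bool" where
  "comult_compat_right V W \<Psi> \<Delta> \<epsilon> \<longleftrightarrow>
     (\<forall>t\<in>space (V \<otimes> W).
        tmap W V (W \<otimes> W) V \<Delta> id (\<Psi> t) =
        leg23 W V W \<Psi> (leg12 V W W \<Psi> (assoc_inv V W W (tmap V W V (W \<otimes> W) id \<Delta> t)))) \<and>
     (\<forall>t\<in>space (V \<otimes> W).
        lunit V (tmap W V scalars V \<epsilon> id (\<Psi> t)) = runit V (tmap V W V scalars id \<epsilon> t))"

definition braided_algebra ::
  "('k::field, 'v::ab_group_add) vs
     \<Rightarrow> ((('v \<Rightarrow> 'v \<Rightarrow> 'k) \<Rightarrow> 'k) \<Rightarrow> ('v \<Rightarrow> 'v \<Rightarrow> 'k) \<Rightarrow> 'k)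
     \<Rightarrow> ((('v \<Rightarrow> 'v \<Rightarrow> 'k) \<Rightarrow> 'k) \<Rightarrow> 'v) \<Rightarrow> 'v option \<Rightarrow> bool" where
  "braided_algebra V \<Psi> m u \<longleftrightarrow> algebra V m u \<and> braiding V \<Psi> \<and>
     mult_compat_left V V \<Psi> m u \<and> mult_compat_right V V \<Psi> m u"

definition braided_coalgebra ::
  "('k::field, 'v::ab_group_add) vs
     \<Rightarrow> ((('v \<Rightarrow> 'v \<Rightarrow> 'k) \<Rightarrow> 'k) \<Rightarrow> ('v \<Rightarrow> 'v \<Rightarrow> 'k) \<Rightarrow> 'k)
     \<Rightarrow> ('v \<Rightarrow> ('v \<Rightarrow> 'v \<Rightarrow> 'k) \<Rightarrow> 'k) \<Rightarrow> ('v \<Rightarrow> 'k) \<Rightarrow> bool" where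
  "braided_coalgebra V \<Psi> \<Delta> \<epsilon> \<longleftrightarrow> coalgebra V \<Delta> \<epsilon> \<and> braiding V \<Psi> \<and>
     comult_compat_left V V \<Psi> \<Delta> \<epsilon> \<and> comult_compat_right V V \<Psi> \<Delta> \<epsilon>"


section \<open>Dual braidings\<close>

text \<open>\<open>\<langle>\<langle>\<xi> \<otimes> \<eta>, x \<otimes> y\<rangle>\<rangle> = \<langle>\<xi>, y\<rangle> \<langle>\<eta>, x\<rangle>\<close> for \<open>\<xi> \<otimes> \<eta> \<in> A \<otimes> B\<close> and \<open>x \<otimes> y \<in> X \<otimes> Y\<close>,
  where \<open>A \<subseteq> Y'\<close> and \<open>B \<subseteq> X'\<close>.\<close>

definition dpair ::
  "('k::field, 'y \<Rightarrow> 'k) vs \<Rightarrow> ('k, 'x \<Rightarrow> 'k) vs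
     \<Rightarrow> ('k, 'x::ab_group_add) vs \<Rightarrow> ('k, 'y::ab_group_add) vs
     \<Rightarrow> ((('y \<Rightarrow> 'k) \<Rightarrow> ('x \<Rightarrow> 'k) \<Rightarrow> 'k) \<Rightarrow> 'k) \<Rightarrow> (('x \<Rightarrow> 'y \<Rightarrow> 'k) \<Rightarrow> 'k) \<Rightarrow> 'k" where
  "dpair A B X Y s t =
     tlift A B scalars (\<lambda>\<xi> \<eta>. tlift X Y scalars (\<lambda>x y. \<xi> y * \<eta> x) t) s"

lemma bilinear_on_mult:
  assumes "linear_on A scalars f" and "linear_on B scalars g"
  shows "bilinear_on A B scalars (\<lambda>a b. f a * g b)"
  using assms by (simp add: bilinear_on_def linear_on_def scalars_def algebra_simps)

lemma dpair:
  assumes X: "vspace X" and Y: "vspace Y"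
    and A: "vsubspace A (dual Y)" and B: "vsubspace B (dual X)"
  shows "t \<in> space (X \<otimes> Y) \<Longrightarrow> linear_on (A \<otimes> B) scalars (\<lambda>s. dpair A B X Y s t)"
    and "s \<in> space (A \<otimes> B) \<Longrightarrow> linear_on (X \<otimes> Y) scalars (dpair A B X Y s)"
    and "\<xi> \<in> space A \<Longrightarrow> \<eta> \<in> space B \<Longrightarrow> x \<in> space X \<Longrightarrow> y \<in> space Y \<Longrightarrow>
           dpair A B X Y (tens A B \<xi> \<eta>) (tens X Y x y) = \<xi> y * \<eta> x"
proof -
  have fA: "linear_on Y scalars \<xi>" if "\<xi> \<in> space A" for \<xi>
    using that A by (auto simp: vsubspace_def dual_def)
  have fB: "linear_on X scalars \<eta>" if "\<eta> \<in> space B" for \<eta>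
    using that B by (auto simp: vsubspace_def dual_def)
  have sc: "scale A = fscale" "scale B = fscale"
    using A B by (simp_all add: vsubspace_def dual_def)
  have 1: "bilinear_on X Y scalars (\<lambda>x y. \<xi> y * \<eta> x)" if "\<xi> \<in> space A" "\<eta> \<in> space B" for \<xi> \<eta>
    using bilinear_on_mult[OF fB[OF that(2)] fA[OF that(1)]] by (simp add: mult.commute)
  have lin: "linear_on A scalars (\<lambda>\<xi>. \<xi> y * k)" "linear_on B scalars (\<lambda>\<eta>. k * \<eta> x)" for x y k
    by (simp_all add: linear_on_def scalars_def sc fscale_def algebra_simps)
  have 2: "bilinear_on A B scalars (\<lambda>\<xi> \<eta>. tlift X Y scalars (\<lambda>x y. \<xi> y * \<eta> x) t)"
    if t: "t \<in> space (X \<otimes> Y)" for t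
  proof -
    have "linear_on B scalars (\<lambda>\<eta>. tlift X Y scalars (\<lambda>x y. \<xi> y * \<eta> x) t)" if \<xi>: "\<xi> \<in> space A" for \<xi>
    proof -
      have "vspace B" using B by (simp add: vsubspace_def)
      from bilinear_on_tlift(1)[OF this vspace_scalars, of X Y "\<lambda>x y \<eta>. \<xi> y * \<eta> x", OF 1[OF \<xi>] lin(2)]
      show ?thesis using t unfolding bilinear_on_def by blast
    qed
    moreover have "linear_on A scalars (\<lambda>\<xi>. tlift X Y scalars (\<lambda>x y. \<xi> y * \<eta> x) t)"
      if \<eta>: "\<eta> \<in> space B" for \<eta>
    proof -
      have "vspace A" using A by (simp add: vsubspace_def)
      from bilinear_on_tlift(1)[OF this vspace_scalars, of X Y "\<lambda>x y \<xi>. \<xi> y * \<eta> x", OF 1[OF _ \<eta>] lin(1)]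
      show ?thesis using t unfolding bilinear_on_def by blast
    qed
    ultimately show ?thesis by (simp add: bilinear_on_def)
  qed
  show "linear_on (A \<otimes> B) scalars (\<lambda>s. dpair A B X Y s t)" if "t \<in> space (X \<otimes> Y)"
    unfolding dpair_def using tlift(1)[OF vspace_scalars 2[OF that]] .
  have "bilinear_on (A \<otimes> B) (X \<otimes> Y) scalars (dpair A B X Y)"
    unfolding dpair_def
    by (rule bilinear_on_tlift(1)[OF vspace_tensor vspace_scalars 2 tlift(1)[OF vspace_scalars 1]])
  then show "linear_on (X \<otimes> Y) scalars (dpair A B X Y s)" if "s \<in> space (A \<otimes> B)"
    using that by (simp add: bilinear_on_def)
  show "dpair A B X Y (tens A B \<xi> \<eta>) (tens X Y x y) = \<xi> y * \<eta> x"
    if "\<xi> \<in> space A" "\<eta> \<in> space B" "x \<in> space X" "y \<in> space Y"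
    unfolding dpair_def using that
    by (simp add: tlift(2)[OF vspace_scalars 2] tlift(2)[OF vspace_scalars 1] tens_in_tensor)
qed

text \<open>A map into a dual given by a fourfold linear form.\<close>

lemma tlift_dual:
  assumes A: "vspace A" and B: "vspace B" and X: "vspace X" and Y: "vspace Y"
    and 1: "\<And>a b. a \<in> space A \<Longrightarrow> b \<in> space B \<Longrightarrow> bilinear_on X Y scalars (\<gamma> a b)"
    and 2: "\<And>x y. x \<in> space X \<Longrightarrow> y \<in> space Y \<Longrightarrow> bilinear_on A B scalars (\<lambda>a b. \<gamma> a b x y)"
  shows "linear_on (A \<otimes> B) (dual (X \<otimes> Y))
           (tlift A B (dual (X \<otimes> Y)) (\<lambda>a b. tlift X Y scalars (\<gamma> a b)))"
    and "a \<in> space A \<Longrightarrow> b \<in> space B \<Longrightarrow> x \<in> space X \<Longrightarrow> y \<in> space Y \<Longrightarrow>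
           tlift A B (dual (X \<otimes> Y)) (\<lambda>a b. tlift X Y scalars (\<gamma> a b)) (tens A B a b) (tens X Y x y)
             = \<gamma> a b x y"
proof -
  let ?D = "dual (X \<otimes> Y)" and ?\<beta> = "\<lambda>a b. tlift X Y scalars (\<gamma> a b)"
  note tl = tlift[OF vspace_scalars 1]
  have in_dual: "?\<beta> a b \<in> space ?D" if "a \<in> space A" "b \<in> space B" for a b
    using tl[OF that] by (simp add: dual_def)
  have lin_dual: "linear_on Z ?D g"
    if g: "\<And>z. z \<in> space Z \<Longrightarrow> g z \<in> space ?D" and Z: "vspace Z"
      and lin: "\<And>t. t \<in> space (X \<otimes> Y) \<Longrightarrow> linear_on Z scalars (\<lambda>z. g z t)" for Z :: "('a, 'z::ab_group_add) vs" and g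
    unfolding linear_on_def
  proof (intro conjI ballI allI)
    have off: "g z t = 0" if "z \<in> space Z" "t \<notin> space (X \<otimes> Y)" for z t
      using g[OF that(1)] that(2) by (simp add: dual_def)
    show "g z \<in> space ?D" if "z \<in> space Z" for z
      by (rule g[OF that])
    show "g (y + z) = g y + g z" if "y \<in> space Z" "z \<in> space Z" for y z
    proof
      fix t
      have "y + z \<in> space Z" using that Z vspaceD(2) by blast
      then show "g (y + z) t = (g y + g z) t"
        using off that lin[of t]
        by (cases "t \<in> space (X \<otimes> Y)") (simp_all add: linear_on_def)
    qed
    show "g (scale Z c z) = scale ?D c (g z)" if "z \<in> space Z" for c z
    proof
      fix t
      have "scale Z c z \<in> space Z" using that Z vspaceD(3) by blast
      then show "g (scale Z c z) t = scale ?D c (g z) t"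
        using off that lin[of t]
        by (cases "t \<in> space (X \<otimes> Y)") (simp_all add: linear_on_def dual_def fscale_def scalars_def)
    qed
  qed
  have "linear_on B ?D (?\<beta> a)" if a: "a \<in> space A" for a
  proof (rule lin_dual[OF in_dual[OF a] B])
    fix t assume t: "t \<in> space (X \<otimes> Y)"
    have "bilinear_on (X \<otimes> Y) B scalars (\<lambda>t b. ?\<beta> a b t)"
    proof (rule bilinear_on_tlift(1)[OF B vspace_scalars, of X Y "\<lambda>x y b. \<gamma> a b x y"])
      show "bilinear_on X Y scalars (\<lambda>x y. \<gamma> a b x y)" if "b \<in> space B" for b by (rule 1[OF a that])
      show "linear_on B scalars (\<lambda>b. \<gamma> a b x y)" if "x \<in> space X" "y \<in> space Y" for x y
        using 2[OF that] a by (simp add: bilinear_on_def)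
    qed
    then show "linear_on B scalars (\<lambda>b. ?\<beta> a b t)" using t unfolding bilinear_on_def by blast
  qed
  moreover have "linear_on A ?D (\<lambda>a. ?\<beta> a b)" if b: "b \<in> space B" for b
  proof (rule lin_dual[OF in_dual[OF _ b] A])
    fix t assume t: "t \<in> space (X \<otimes> Y)"
    have "bilinear_on (X \<otimes> Y) A scalars (\<lambda>t a. ?\<beta> a b t)"
    proof (rule bilinear_on_tlift(1)[OF A vspace_scalars, of X Y "\<lambda>x y a. \<gamma> a b x y"])
      show "bilinear_on X Y scalars (\<lambda>x y. \<gamma> a b x y)" if "a \<in> space A" for a by (rule 1[OF that b])
      show "linear_on A scalars (\<lambda>a. \<gamma> a b x y)" if "x \<in> space X" "y \<in> space Y" for x y
        using 2[OF that] b by (simp add: bilinear_on_def)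
    qed
    then show "linear_on A scalars (\<lambda>a. ?\<beta> a b t)" using t unfolding bilinear_on_def by blast
  qed
  ultimately have bil: "bilinear_on A B ?D ?\<beta>" by (simp add: bilinear_on_def)
  note tl' = tlift[OF vspace_dual[OF vspace_tensor] bil]
  show "linear_on (A \<otimes> B) ?D (tlift A B ?D ?\<beta>)" by (rule tl'(1))
  show "tlift A B ?D ?\<beta> (tens A B a b) (tens X Y x y) = \<gamma> a b x y"
    if "a \<in> space A" "b \<in> space B" "x \<in> space X" "y \<in> space Y"
    using tl'(2)[OF that(1,2)] tl(2)[OF that] by simp
qed

text \<open>The embeddings \<open>W \<otimes> H \<rightarrow> (V \<otimes> H')'\<close> and \<open>H \<otimes> W \<rightarrow> (H' \<otimes> V)'\<close>.\<close>

definition emb_WH ::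
  "('k::field, 'h::ab_group_add) vs \<Rightarrow> ('k, 'v::ab_group_add) vs \<Rightarrow> ('k, 'v \<Rightarrow> 'k) vs
     \<Rightarrow> ((('v \<Rightarrow> 'k) \<Rightarrow> 'h \<Rightarrow> 'k) \<Rightarrow> 'k) \<Rightarrow> (('v \<Rightarrow> ('h \<Rightarrow> 'k) \<Rightarrow> 'k) \<Rightarrow> 'k) \<Rightarrow> 'k" where
  "emb_WH H V W = tlift W H (dual (V \<otimes> dual H))
     (\<lambda>e a. tlift V (dual H) scalars (\<lambda>v f. e v * f a))"

definition emb_HW ::
  "('k::field, 'h::ab_group_add) vs \<Rightarrow> ('k, 'v::ab_group_add) vs \<Rightarrow> ('k, 'v \<Rightarrow> 'k) vs
     \<Rightarrow> (('h \<Rightarrow> ('v \<Rightarrow> 'k) \<Rightarrow> 'k) \<Rightarrow> 'k) \<Rightarrow> ((('h \<Rightarrow> 'k) \<Rightarrow> 'v \<Rightarrow> 'k) \<Rightarrow> 'k) \<Rightarrow> 'k" where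
  "emb_HW H V W = tlift H W (dual (dual H \<otimes> V))
     (\<lambda>a e. tlift (dual H) V scalars (\<lambda>f v. f a * e v))"

text \<open>For \<open>P : V \<otimes> H \<rightarrow> H \<otimes> V\<close>, the map \<open>H \<otimes> W \<rightarrow> (V \<otimes> H')'\<close> sending \<open>a \<otimes> e\<close> to
  \<open>v \<otimes> f \<mapsto> \<langle>\<langle>e \<otimes> f, P (v \<otimes> a)\<rangle>\<rangle>\<close>; for \<open>P : H \<otimes> V \<rightarrow> V \<otimes> H\<close>, the map
  \<open>W \<otimes> H \<rightarrow> (H' \<otimes> V)'\<close> sending \<open>e \<otimes> a\<close> to \<open>f \<otimes> v \<mapsto> \<langle>\<langle>f \<otimes> e, P (a \<otimes> v)\<rangle>\<rangle>\<close>.\<close>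

definition dual_HW ::
  "('k::field, 'h::ab_group_add) vs \<Rightarrow> ('k, 'v::ab_group_add) vs \<Rightarrow> ('k, 'v \<Rightarrow> 'k) vs
     \<Rightarrow> ((('v \<Rightarrow> 'h \<Rightarrow> 'k) \<Rightarrow> 'k) \<Rightarrow> ('h \<Rightarrow> 'v \<Rightarrow> 'k) \<Rightarrow> 'k)
     \<Rightarrow> (('h \<Rightarrow> ('v \<Rightarrow> 'k) \<Rightarrow> 'k) \<Rightarrow> 'k) \<Rightarrow> (('v \<Rightarrow> ('h \<Rightarrow> 'k) \<Rightarrow> 'k) \<Rightarrow> 'k) \<Rightarrow> 'k" where
  "dual_HW H V W P = tlift H W (dual (V \<otimes> dual H))
     (\<lambda>a e. tlift V (dual H) scalars
        (\<lambda>v f. dpair W (dual H) H V (tens W (dual H) e f) (P (tens V H v a))))"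

definition dual_WH ::
  "('k::field, 'h::ab_group_add) vs \<Rightarrow> ('k, 'v::ab_group_add) vs \<Rightarrow> ('k, 'v \<Rightarrow> 'k) vs
     \<Rightarrow> ((('h \<Rightarrow> 'v \<Rightarrow> 'k) \<Rightarrow> 'k) \<Rightarrow> ('v \<Rightarrow> 'h \<Rightarrow> 'k) \<Rightarrow> 'k)
     \<Rightarrow> ((('v \<Rightarrow> 'k) \<Rightarrow> 'h \<Rightarrow> 'k) \<Rightarrow> 'k) \<Rightarrow> ((('h \<Rightarrow> 'k) \<Rightarrow> 'v \<Rightarrow> 'k) \<Rightarrow> 'k) \<Rightarrow> 'k" where
  "dual_WH H V W P = tlift W H (dual (dual H \<otimes> V))
     (\<lambda>e a. tlift (dual H) V scalars
        (\<lambda>f v. dpair (dual H) W V H (tens (dual H) W f e) (P (tens H V a v))))"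

lemma linear_dual: "f \<in> space (dual A) \<Longrightarrow> linear_on A scalars f"
  by (simp add: dual_def)

lemma linear_eval:
  assumes "scale W = fscale"
  shows "linear_on W scalars (\<lambda>e. e x)"
  using assms by (simp add: linear_on_def scalars_def fscale_def)

lemma linear_on_compose: "linear_on A B f \<Longrightarrow> linear_on B C g \<Longrightarrow> linear_on A C (\<lambda>x. g (f x))"
  by (simp add: linear_on_def)

lemma emb_WH_tens:
  assumes H: "vspace H" and V: "vspace V" and W: "vsubspace W (dual V)"
  shows "linear_on (W \<otimes> H) (dual (V \<otimes> dual H)) (emb_WH H V W)"
    and "e \<in> space W \<Longrightarrow> a \<in> space H \<Longrightarrow> v \<in> space V \<Longrightarrow> f \<in> space (dual H) \<Longrightarrow>
           emb_WH H V W (tens W H e a) (tens V (dual H) v f) = e v * f a"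
proof -
  have W': "vspace W" "scale W = fscale" "\<And>e. e \<in> space W \<Longrightarrow> linear_on V scalars e"
    using W by (auto simp: vsubspace_def dual_def)
  have d: "scale (dual H) = fscale" by (simp add: dual_def)
  note * = tlift_dual[OF W'(1) H V vspace_dual[OF H], of "\<lambda>e a v f. e v * f a",
      OF bilinear_on_mult[OF W'(3) linear_eval[OF d]] bilinear_on_mult[OF linear_eval[OF W'(2)] linear_dual]]
  show "linear_on (W \<otimes> H) (dual (V \<otimes> dual H)) (emb_WH H V W)"
    unfolding emb_WH_def by (rule *(1)) blast+
  show "emb_WH H V W (tens W H e a) (tens V (dual H) v f) = e v * f a"
    if "e \<in> space W" "a \<in> space H" "v \<in> space V" "f \<in> space (dual H)"
    unfolding emb_WH_def by (rule *(2)) (use that in blast)+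
qed

lemma emb_HW_tens:
  assumes H: "vspace H" and V: "vspace V" and W: "vsubspace W (dual V)"
  shows "linear_on (H \<otimes> W) (dual (dual H \<otimes> V)) (emb_HW H V W)"
    and "a \<in> space H \<Longrightarrow> e \<in> space W \<Longrightarrow> f \<in> space (dual H) \<Longrightarrow> v \<in> space V \<Longrightarrow>
           emb_HW H V W (tens H W a e) (tens (dual H) V f v) = f a * e v"
proof -
  have W': "vspace W" "scale W = fscale" "\<And>e. e \<in> space W \<Longrightarrow> linear_on V scalars e"
    using W by (auto simp: vsubspace_def dual_def)
  have d: "scale (dual H) = fscale" by (simp add: dual_def)
  note * = tlift_dual[OF H W'(1) vspace_dual[OF H] V, of "\<lambda>a e f v. f a * e v",
      OF bilinear_on_mult[OF linear_eval[OF d] W'(3)] bilinear_on_mult[OF linear_dual linear_eval[OF W'(2)]]]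
  show "linear_on (H \<otimes> W) (dual (dual H \<otimes> V)) (emb_HW H V W)"
    unfolding emb_HW_def by (rule *(1)) blast+
  show "emb_HW H V W (tens H W a e) (tens (dual H) V f v) = f a * e v"
    if "a \<in> space H" "e \<in> space W" "f \<in> space (dual H)" "v \<in> space V"
    unfolding emb_HW_def by (rule *(2)) (use that in blast)+
qed

lemma dual_HW_tens:
  assumes H: "vspace H" and V: "vspace V" and W: "vsubspace W (dual V)"
    and P: "linear_on (V \<otimes> H) (H \<otimes> V) P"
  shows "linear_on (H \<otimes> W) (dual (V \<otimes> dual H)) (dual_HW H V W P)"
    and "a \<in> space H \<Longrightarrow> e \<in> space W \<Longrightarrow> v \<in> space V \<Longrightarrow> f \<in> space (dual H) \<Longrightarrow>
           dual_HW H V W P (tens H W a e) (tens V (dual H) v f) =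
             dpair W (dual H) H V (tens W (dual H) e f) (P (tens V H v a))"
proof -
  have W': "vspace W" using W by (simp add: vsubspace_def)
  have dH: "vsubspace (dual H) (dual H)" using vspace_dual[OF H] by (simp add: vsubspace_def)
  note dp = dpair[OF H V W dH]
  let ?\<gamma> = "\<lambda>a e v f. dpair W (dual H) H V (tens W (dual H) e f) (P (tens V H v a))"
  have P': "P (tens V H v a) \<in> space (H \<otimes> V)" if "v \<in> space V" "a \<in> space H" for v a
    using P tens_in_tensor[OF that] by (simp add: linear_on_def)
  note t1 = bilinear_on_tens[of W "dual H", unfolded bilinear_on_def]
    and t2 = bilinear_on_tens[of V H, unfolded bilinear_on_def]
  have 1: "linear_on V scalars (\<lambda>v. ?\<gamma> a e v f)" "linear_on H scalars (\<lambda>a. ?\<gamma> a e v f)"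
    "linear_on W scalars (\<lambda>e. ?\<gamma> a e v f)" "linear_on (dual H) scalars (\<lambda>f. ?\<gamma> a e v f)"
    if "a \<in> space H" "e \<in> space W" "v \<in> space V" "f \<in> space (dual H)" for a e v f
  proof -
    note q = linear_on_compose[OF P dp(2)[OF tens_in_tensor[OF that(2,4)]]]
    show "linear_on V scalars (\<lambda>v. ?\<gamma> a e v f)" "linear_on H scalars (\<lambda>a. ?\<gamma> a e v f)"
      using linear_on_compose[OF _ q] t2 that by blast+
    show "linear_on W scalars (\<lambda>e. ?\<gamma> a e v f)" "linear_on (dual H) scalars (\<lambda>f. ?\<gamma> a e v f)"
      using linear_on_compose[OF _ dp(1)[OF P'[OF that(3,1)]]] t1 that by blast+
  qed
  have 2: "bilinear_on V (dual H) scalars (?\<gamma> a e)" if "a \<in> space H" "e \<in> space W" for a e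
    unfolding bilinear_on_def
    by (intro conjI ballI 1 that) (assumption | rule vspaceD(1)[OF V] vspaceD(1)[OF vspace_dual[OF H]])+
  have 3: "bilinear_on H W scalars (\<lambda>a e. ?\<gamma> a e v f)" if "v \<in> space V" "f \<in> space (dual H)" for v f
    unfolding bilinear_on_def
    by (intro conjI ballI 1 that) (assumption | rule vspaceD(1)[OF H] vspaceD(1)[OF W'])+
  note * = tlift_dual[OF H W' V vspace_dual[OF H], of ?\<gamma>, OF 2 3]
  show "linear_on (H \<otimes> W) (dual (V \<otimes> dual H)) (dual_HW H V W P)"
    unfolding dual_HW_def by (rule *(1)) blast+
  show "dual_HW H V W P (tens H W a e) (tens V (dual H) v f) = ?\<gamma> a e v f"
    if "a \<in> space H" "e \<in> space W" "v \<in> space V" "f \<in> space (dual H)"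
    unfolding dual_HW_def by (rule *(2)) (use that in blast)+
qed

lemma dual_WH_tens:
  assumes H: "vspace H" and V: "vspace V" and W: "vsubspace W (dual V)"
    and P: "linear_on (H \<otimes> V) (V \<otimes> H) P"
  shows "linear_on (W \<otimes> H) (dual (dual H \<otimes> V)) (dual_WH H V W P)"
    and "e \<in> space W \<Longrightarrow> a \<in> space H \<Longrightarrow> f \<in> space (dual H) \<Longrightarrow> v \<in> space V \<Longrightarrow>
           dual_WH H V W P (tens W H e a) (tens (dual H) V f v) =
             dpair (dual H) W V H (tens (dual H) W f e) (P (tens H V a v))"
proof -
  have W': "vspace W" using W by (simp add: vsubspace_def)
  have dH: "vsubspace (dual H) (dual H)" using vspace_dual[OF H] by (simp add: vsubspace_def)
  note dp = dpair[OF V H dH W]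
  let ?\<gamma> = "\<lambda>e a f v. dpair (dual H) W V H (tens (dual H) W f e) (P (tens H V a v))"
  have P': "P (tens H V a v) \<in> space (V \<otimes> H)" if "a \<in> space H" "v \<in> space V" for v a
    using P tens_in_tensor[OF that] by (simp add: linear_on_def)
  note t1 = bilinear_on_tens[of "dual H" W, unfolded bilinear_on_def]
    and t2 = bilinear_on_tens[of H V, unfolded bilinear_on_def]
  have 1: "linear_on V scalars (\<lambda>v. ?\<gamma> e a f v)" "linear_on H scalars (\<lambda>a. ?\<gamma> e a f v)"
    "linear_on W scalars (\<lambda>e. ?\<gamma> e a f v)" "linear_on (dual H) scalars (\<lambda>f. ?\<gamma> e a f v)"
    if "e \<in> space W" "a \<in> space H" "f \<in> space (dual H)" "v \<in> space V" for a e v f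
  proof -
    note q = linear_on_compose[OF P dp(2)[OF tens_in_tensor[OF that(3,1)]]]
    show "linear_on V scalars (\<lambda>v. ?\<gamma> e a f v)" "linear_on H scalars (\<lambda>a. ?\<gamma> e a f v)"
      using linear_on_compose[OF _ q] t2 that by blast+
    show "linear_on W scalars (\<lambda>e. ?\<gamma> e a f v)" "linear_on (dual H) scalars (\<lambda>f. ?\<gamma> e a f v)"
      using linear_on_compose[OF _ dp(1)[OF P'[OF that(2,4)]]] t1 that by blast+
  qed
  have 2: "bilinear_on (dual H) V scalars (?\<gamma> e a)" if "e \<in> space W" "a \<in> space H" for a e
    unfolding bilinear_on_def
    by (intro conjI ballI 1 that) (assumption | rule vspaceD(1)[OF V] vspaceD(1)[OF vspace_dual[OF H]])+
  have 3: "bilinear_on W H scalars (\<lambda>e a. ?\<gamma> e a f v)" if "f \<in> space (dual H)" "v \<in> space V" for v f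
    unfolding bilinear_on_def
    by (intro conjI ballI 1 that) (assumption | rule vspaceD(1)[OF H] vspaceD(1)[OF W'])+
  note * = tlift_dual[OF W' H vspace_dual[OF H] V, of ?\<gamma>, OF 2 3]
  show "linear_on (W \<otimes> H) (dual (dual H \<otimes> V)) (dual_WH H V W P)"
    unfolding dual_WH_def by (rule *(1)) blast+
  show "dual_WH H V W P (tens W H e a) (tens (dual H) V f v) = ?\<gamma> e a f v"
    if "e \<in> space W" "a \<in> space H" "f \<in> space (dual H)" "v \<in> space V"
    unfolding dual_WH_def by (rule *(2)) (use that in blast)+
qed

text \<open>\<open>dual_HW\<close> is bijective onto \<open>W \<otimes> H \<subseteq> (V \<otimes> H')'\<close>, and the resulting map
  \<open>H \<otimes> W \<rightarrow> W \<otimes> H\<close>; likewise for \<open>dual_WH\<close>.\<close>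

definition dual_HW_bij ::
  "('k::field, 'h::ab_group_add) vs \<Rightarrow> ('k, 'v::ab_group_add) vs \<Rightarrow> ('k, 'v \<Rightarrow> 'k) vs
     \<Rightarrow> ((('v \<Rightarrow> 'h \<Rightarrow> 'k) \<Rightarrow> 'k) \<Rightarrow> ('h \<Rightarrow> 'v \<Rightarrow> 'k) \<Rightarrow> 'k) \<Rightarrow> bool" where
  "dual_HW_bij H V W P \<longleftrightarrow>
     bij_betw (dual_HW H V W P) (space (H \<otimes> W)) (emb_WH H V W ` space (W \<otimes> H))"

definition braid_HW ::
  "('k::field, 'h::ab_group_add) vs \<Rightarrow> ('k, 'v::ab_group_add) vs \<Rightarrow> ('k, 'v \<Rightarrow> 'k) vs
     \<Rightarrow> ((('v \<Rightarrow> 'h \<Rightarrow> 'k) \<Rightarrow> 'k) \<Rightarrow> ('h \<Rightarrow> 'v \<Rightarrow> 'k) \<Rightarrow> 'k)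
     \<Rightarrow> (('h \<Rightarrow> ('v \<Rightarrow> 'k) \<Rightarrow> 'k) \<Rightarrow> 'k) \<Rightarrow> (('v \<Rightarrow> 'k) \<Rightarrow> 'h \<Rightarrow> 'k) \<Rightarrow> 'k" where
  "braid_HW H V W P = inv_into (space (W \<otimes> H)) (emb_WH H V W) \<circ> dual_HW H V W P"

definition dual_WH_bij ::
  "('k::field, 'h::ab_group_add) vs \<Rightarrow> ('k, 'v::ab_group_add) vs \<Rightarrow> ('k, 'v \<Rightarrow> 'k) vs
     \<Rightarrow> ((('h \<Rightarrow> 'v \<Rightarrow> 'k) \<Rightarrow> 'k) \<Rightarrow> ('v \<Rightarrow> 'h \<Rightarrow> 'k) \<Rightarrow> 'k) \<Rightarrow> bool" where
  "dual_WH_bij H V W P \<longleftrightarrow>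
     bij_betw (dual_WH H V W P) (space (W \<otimes> H)) (emb_HW H V W ` space (H \<otimes> W))"

definition braid_WH ::
  "('k::field, 'h::ab_group_add) vs \<Rightarrow> ('k, 'v::ab_group_add) vs \<Rightarrow> ('k, 'v \<Rightarrow> 'k) vs
     \<Rightarrow> ((('h \<Rightarrow> 'v \<Rightarrow> 'k) \<Rightarrow> 'k) \<Rightarrow> ('v \<Rightarrow> 'h \<Rightarrow> 'k) \<Rightarrow> 'k)
     \<Rightarrow> ((('v \<Rightarrow> 'k) \<Rightarrow> 'h \<Rightarrow> 'k) \<Rightarrow> 'k) \<Rightarrow> ('h \<Rightarrow> ('v \<Rightarrow> 'k) \<Rightarrow> 'k) \<Rightarrow> 'k" where
  "braid_WH H V W P = inv_into (space (H \<otimes> W)) (emb_HW H V W) \<circ> dual_WH H V W P"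

end

theory Submission
  imports Defs
begin

text \<open>
  A map \<open>P : V \<otimes> H \<rightarrow> H \<otimes> V\<close> is determined by its matrix coefficients along \<open>V\<close>: for \<open>v \<in> V\<close> and
  \<open>e \<in> W \<subseteq> V'\<close>, the operator \<open>p e v : H \<rightarrow> H\<close> that sends \<open>a\<close> to \<open>(id \<otimes> e) (P (v \<otimes> a))\<close>.  Unwinding
  the definition of \<open>Q = braid_HW H V W P : H \<otimes> W \<rightarrow> W \<otimes> H\<close>, the functionals on \<open>H\<close> drop out, since
  \<open>H'\<close> separates the points of \<open>H\<close>, and what remains is that \<open>Q\<close> has the same coefficients:
  \<open>(ev v \<otimes> id) (Q (a \<otimes> e)) = (id \<otimes> e) (P (v \<otimes> a))\<close>.  We say that \<open>P\<close> and \<open>Q\<close> are \<open>transposed\<close>.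

  Moving \<open>V\<close> past \<open>H \<otimes> H\<close> one factor at a time gives a map \<open>V \<otimes> (H \<otimes> H) \<rightarrow> (H \<otimes> H) \<otimes> V\<close>, and likewise
  for \<open>W\<close>; these two maps are again transposed (\<open>transposed_pass\<close>), because both
  composites contract \<open>P (v \<otimes> a) \<in> H \<otimes> V\<close> with \<open>Q (b \<otimes> e) \<in> W \<otimes> H\<close> along the pairing of \<open>V\<close> and \<open>W\<close>.
  The braid equation and the compatibilities with \<open>\<Delta>\<close> and \<open>m\<close> all say that one fixed map
  \<open>f : X \<rightarrow> Y\<close>, with \<open>X\<close> and \<open>Y\<close> among \<open>H\<close> and \<open>H \<otimes> H\<close>, commutes with moving the outer space past
  \<open>X\<close> and past \<open>Y\<close>.  Slices separate points (\<open>all_lslices_separate\<close>, \<open>rslices_separate\<close>), so this means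
  that \<open>f\<close> commutes with all coefficients, a condition which is the same for \<open>P\<close> and for \<open>Q\<close>
  (\<open>intertwines_transposed\<close>).  The axioms for the counit and the unit are compared in the same way.
  This yields equivalences (\<open>structures_transposed\<close>).

  Since \<open>V\<close> and \<open>W\<close> enter the pairing symmetrically, the first two statements are the two
  directions of one equivalence: in the second, \<open>W\<close> plays the part of \<open>V\<close>.  The last two follow,
  because \<open>P\<inverse>\<close> satisfies the mirrored axioms exactly when \<open>P\<close> satisfies the original ones
  (\<open>structures_inverse\<close>).
\<close>

section \<open>Linear maps on tensor products\<close>

lemma linear_onD:
  assumes "linear_on A B f"
  shows "x \<in> space A \<Longrightarrow> f x \<in> space B"
    and "x \<in> space A \<Longrightarrow> y \<in> space A \<Longrightarrow> f (x + y) = f x + f y"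
    and "x \<in> space A \<Longrightarrow> f (scale A c x) = scale B c (f x)"
  using assms by (simp_all add: linear_on_def)

lemma linear_on_tens:
  shows "b \<in> space B \<Longrightarrow> linear_on A (A \<otimes> B) (\<lambda>a. tens A B a b)"
    and "a \<in> space A \<Longrightarrow> linear_on B (A \<otimes> B) (tens A B a)"
  using bilinear_on_tens[of A B] by (simp_all add: bilinear_on_def)

lemma tens_balanced:
  assumes "a \<in> space A" and "b \<in> space B"
  shows "tens A B (scale A c a) b = tens A B a (scale B c b)"
  using linear_onD(3)[OF linear_on_tens(1)[OF assms(2)] assms(1)]
    linear_onD(3)[OF linear_on_tens(2)[OF assms(1)] assms(2)] by simp

lemma tensor_ext:
  assumes C: "vspace C" and f: "linear_on (A \<otimes> B) C f" and g: "linear_on (A \<otimes> B) C g"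
    and eq: "\<And>a b. a \<in> space A \<Longrightarrow> b \<in> space B \<Longrightarrow> f (tens A B a b) = g (tens A B a b)"
    and t: "t \<in> space (A \<otimes> B)"
  shows "f t = g t"
  using t
proof (induction rule: tensor_induct)
  case zero
  show ?case
    by (rule trans[OF linear_on_0[OF vspace_tensor C f] linear_on_0[OF vspace_tensor C g, symmetric]])
next
  case (add s t)
  then show ?case by (simp only: linear_onD(2)[OF f] linear_onD(2)[OF g])
qed (use eq in \<open>simp_all add: linear_onD(3)[OF f] linear_onD(3)[OF g]\<close>)

lemma tensor_ext3_left:
  assumes D: "vspace D"
    and f: "linear_on ((A \<otimes> B) \<otimes> C) D f" and g: "linear_on ((A \<otimes> B) \<otimes> C) D g"
    and eq: "\<And>a b c. a \<in> space A \<Longrightarrow> b \<in> space B \<Longrightarrow> c \<in> space C \<Longrightarrow>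
               f (tens (A \<otimes> B) C (tens A B a b) c) = g (tens (A \<otimes> B) C (tens A B a b) c)"
    and t: "t \<in> space ((A \<otimes> B) \<otimes> C)"
  shows "f t = g t"
proof (rule tensor_ext[OF D f g _ t])
  fix s c assume s: "s \<in> space (A \<otimes> B)" and c: "c \<in> space C"
  note lin = linear_on_compose[OF linear_on_tens(1)[OF c]]
  show "f (tens (A \<otimes> B) C s c) = g (tens (A \<otimes> B) C s c)"
    by (rule tensor_ext[OF D lin[OF f] lin[OF g] eq[OF _ _ c] s])
qed

lemma tensor_ext3_right:
  assumes D: "vspace D"
    and f: "linear_on (A \<otimes> (B \<otimes> C)) D f" and g: "linear_on (A \<otimes> (B \<otimes> C)) D g"
    and eq: "\<And>a b c. a \<in> space A \<Longrightarrow> b \<in> space B \<Longrightarrow> c \<in> space C \<Longrightarrow>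
               f (tens A (B \<otimes> C) a (tens B C b c)) = g (tens A (B \<otimes> C) a (tens B C b c))"
    and t: "t \<in> space (A \<otimes> (B \<otimes> C))"
  shows "f t = g t"
proof (rule tensor_ext[OF D f g _ t])
  fix a s assume a: "a \<in> space A" and s: "s \<in> space (B \<otimes> C)"
  note lin = linear_on_compose[OF linear_on_tens(2)[OF a]]
  show "f (tens A (B \<otimes> C) a s) = g (tens A (B \<otimes> C) a s)"
    by (rule tensor_ext[OF D lin[OF f] lin[OF g] eq[OF a] s])
qed

lemma assoc_inv_assoc:
  assumes "vspace A" and "vspace C" and "t \<in> space ((A \<otimes> B) \<otimes> C)"
  shows "assoc_inv A B C (assoc A B C t) = t"
  by (rule tensor_ext3_left[OF vspace_tensor linear_on_compose[OF assoc(1) assoc_inv(1)]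
        linear_on_id[unfolded id_def] _ assms(3)])
     (use assms in \<open>simp_all add: assoc(2) assoc_inv(2)\<close>)

lemma assoc_assoc_inv:
  assumes "vspace A" and "vspace C" and "t \<in> space (A \<otimes> (B \<otimes> C))"
  shows "assoc A B C (assoc_inv A B C t) = t"
  by (rule tensor_ext3_right[OF vspace_tensor linear_on_compose[OF assoc_inv(1) assoc(1)]
        linear_on_id[unfolded id_def] _ assms(3)])
     (use assms in \<open>simp_all add: assoc(2) assoc_inv(2)\<close>)

lemma linear_on_leg12:
  assumes "linear_on (A \<otimes> B) (B \<otimes> A) \<Psi>"
  shows "linear_on (A \<otimes> B \<otimes> C) (B \<otimes> A \<otimes> C) (leg12 A B C \<Psi>)"
  unfolding leg12_def by (rule tmap(1)[OF assms linear_on_id])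

lemma linear_on_leg23:
  assumes "vspace A" "vspace B" "vspace C" and "linear_on (B \<otimes> C) (C \<otimes> B) \<Psi>"
  shows "linear_on (A \<otimes> B \<otimes> C) (A \<otimes> C \<otimes> B) (leg23 A B C \<Psi>)"
  unfolding leg23_def comp_def
  using linear_on_compose[OF linear_on_compose[OF assoc(1) tmap(1)[OF linear_on_id assms(4)]] assoc_inv(1)]
    assms by blast

lemma leg12_tens:
  assumes "linear_on (A \<otimes> B) (B \<otimes> A) \<Psi>" and "s \<in> space (A \<otimes> B)" and "c \<in> space C"
  shows "leg12 A B C \<Psi> (tens (A \<otimes> B) C s c) = tens (B \<otimes> A) C (\<Psi> s) c"
  unfolding leg12_def using tmap(2)[OF assms(1) linear_on_id assms(2,3)] by simp

lemma leg23_assoc_inv: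
  assumes "vspace A" "vspace C" and "t \<in> space (A \<otimes> (B \<otimes> C))"
  shows "leg23 A B C \<Psi> (assoc_inv A B C t) = assoc_inv A C B (tmap A (B \<otimes> C) A (C \<otimes> B) id \<Psi> t)"
  unfolding leg23_def using assoc_assoc_inv[OF assms] by simp

lemma leg23_tens:
  assumes "vspace A" "vspace C" and \<Psi>: "linear_on (B \<otimes> C) (C \<otimes> B) \<Psi>"
    and "a \<in> space A" "b \<in> space B" "c \<in> space C"
  shows "leg23 A B C \<Psi> (tens (A \<otimes> B) C (tens A B a b) c) =
           assoc_inv A C B (tens A (C \<otimes> B) a (\<Psi> (tens B C b c)))"
  using assms tmap(2)[OF linear_on_id \<Psi> assms(4) tens_in_tensor[OF assms(5,6)]]
  by (simp add: leg23_def assoc(2))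

section \<open>Slices\<close>

definition lslice ::
  "('k::field, 'w::ab_group_add) vs \<Rightarrow> ('k, 'x::ab_group_add) vs \<Rightarrow> ('w \<Rightarrow> 'k)
     \<Rightarrow> (('w \<Rightarrow> 'x \<Rightarrow> 'k) \<Rightarrow> 'k) \<Rightarrow> 'x" where
  "lslice W X \<phi> = tlift W X X (\<lambda>w x. scale X (\<phi> w) x)"

definition rslice ::
  "('k::field, 'x::ab_group_add) vs \<Rightarrow> ('k, 'v::ab_group_add) vs \<Rightarrow> ('v \<Rightarrow> 'k)
     \<Rightarrow> (('x \<Rightarrow> 'v \<Rightarrow> 'k) \<Rightarrow> 'k) \<Rightarrow> 'x" where
  "rslice X V \<phi> = tlift X V X (\<lambda>x v. scale X (\<phi> v) x)"

text \<open>
  For \<open>t = \<Sum> w\<^sub>i \<otimes> x\<^sub>i\<close>, the left slice is \<open>\<Sum> \<phi> w\<^sub>i x\<^sub>i\<close>, the image of \<open>t\<close> under \<open>\<phi> \<otimes> id\<close> after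
  \<open>\<K> \<otimes> X\<close> is identified with \<open>X\<close>; right slices apply \<open>id \<otimes> \<phi>\<close>.
\<close>

lemma lslice:
  assumes X: "vspace X" and \<phi>: "linear_on W scalars \<phi>"
  shows "linear_on (W \<otimes> X) X (lslice W X \<phi>)"
    and "w \<in> space W \<Longrightarrow> x \<in> space X \<Longrightarrow> lslice W X \<phi> (tens W X w x) = scale X (\<phi> w) x"
  unfolding lslice_def
  using tlift[OF X bilinear_on_comp[OF bilinear_on_scale(1)[OF X] \<phi> linear_on_id]] by simp_all

lemma rslice:
  assumes X: "vspace X" and \<phi>: "linear_on V scalars \<phi>"
  shows "linear_on (X \<otimes> V) X (rslice X V \<phi>)"
    and "x \<in> space X \<Longrightarrow> v \<in> space V \<Longrightarrow> rslice X V \<phi> (tens X V x v) = scale X (\<phi> v) x"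
  unfolding rslice_def
  using tlift[OF X bilinear_on_comp[OF bilinear_on_scale(2)[OF X] linear_on_id \<phi>]] by simp_all

text \<open>
  Slices act on one tensor factor and \<open>f\<close> on the other, so they commute.
\<close>

lemma lslice_natural:
  assumes X: "vspace X" and Y: "vspace Y" and \<phi>: "linear_on W scalars \<phi>" and f: "linear_on X Y f"
    and t: "t \<in> space (W \<otimes> X)"
  shows "lslice W Y \<phi> (tmap W X W Y id f t) = f (lslice W X \<phi> t)"
  by (rule tensor_ext[OF Y linear_on_compose[OF tmap(1)[OF linear_on_id f] lslice(1)[OF Y \<phi>]]
        linear_on_compose[OF lslice(1)[OF X \<phi>] f] _ t])
     (use linear_onD[OF f] in \<open>simp add: tmap(2)[OF linear_on_id f] lslice(2)[OF X \<phi>] lslice(2)[OF Y \<phi>]\<close>)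

lemma rslice_natural:
  assumes X: "vspace X" and Y: "vspace Y" and \<phi>: "linear_on V scalars \<phi>" and f: "linear_on X Y f"
    and t: "t \<in> space (X \<otimes> V)"
  shows "rslice Y V \<phi> (tmap X V Y V f id t) = f (rslice X V \<phi> t)"
  by (rule tensor_ext[OF Y linear_on_compose[OF tmap(1)[OF f linear_on_id] rslice(1)[OF Y \<phi>]]
        linear_on_compose[OF rslice(1)[OF X \<phi>] f] _ t])
     (use linear_onD[OF f] in \<open>simp add: tmap(2)[OF f linear_on_id] rslice(2)[OF X \<phi>] rslice(2)[OF Y \<phi>]\<close>)

text \<open>
  Both sides are the value of \<open>\<phi> \<otimes> \<psi>\<close> at \<open>t\<close>.  This exchange of the two factors lets a
  separation property of slices on one side be deduced from one on the other.
\<close>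

lemma apply_slice_commute:
  assumes X: "vspace X" and Y: "vspace Y"
    and \<phi>: "linear_on X scalars \<phi>" and \<psi>: "linear_on Y scalars \<psi>" and t: "t \<in> space (X \<otimes> Y)"
  shows "\<psi> (lslice X Y \<phi> t) = \<phi> (rslice X Y \<psi> t)"
proof (rule tensor_ext[OF vspace_scalars linear_on_compose[OF lslice(1)[OF Y \<phi>] \<psi>]
        linear_on_compose[OF rslice(1)[OF X \<psi>] \<phi>] _ t])
  fix x y assume "x \<in> space X" "y \<in> space Y"
  then show "\<psi> (lslice X Y \<phi> (tens X Y x y)) = \<phi> (rslice X Y \<psi> (tens X Y x y))"
    using linear_onD(3)[OF \<phi>] linear_onD(3)[OF \<psi>]
    by (simp add: lslice(2)[OF Y \<phi>] rslice(2)[OF X \<psi>] scalars_def mult.commute)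
qed

lemma linear_on_sum:
  fixes f :: "'a::ab_group_add \<Rightarrow> 'b::ab_group_add"
  assumes A: "vspace A" and B: "vspace B" and f: "linear_on A B f"
    and g: "\<And>i. i \<in> I \<Longrightarrow> g i \<in> space A"
  shows "f (sum g I) = (\<Sum>i\<in>I. f (g i))"
proof (cases "finite I")
  case True
  have "f (sum g J) = (\<Sum>i\<in>J. f (g i)) \<and> sum g J \<in> space A" if "J \<subseteq> I" for J
    using finite_subset[OF that True] that
  proof (induction J)
    case empty
    show ?case using linear_on_0[OF A B f] vspaceD(1)[OF A] by simp
  next
    case (insert j J)
    then show ?case using g linear_onD(2)[OF f] vspaceD(2)[OF A] by simp
  qed
  then show ?thesis by blast
next
  case False
  then show ?thesis using linear_on_0[OF A B f] by simp
qed

text \<open>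
  Take a basis \<open>B\<close> of \<open>X\<close> with coordinate functionals \<open>c b\<close>.  Every tensor \<open>t\<close> is recovered from
  its slices along the coordinates, as \<open>t = \<Sum> b \<otimes> (c b \<otimes> id) t\<close> over any large enough finite
  subset of \<open>B\<close>.
\<close>

lemma all_lslices_separate:
  fixes X :: "('k::field, 'x::ab_group_add) vs" and Y :: "('k, 'y::ab_group_add) vs"
  assumes X: "vspace X" and Y: "vspace Y"
    and s: "s \<in> space (X \<otimes> Y)" and t: "t \<in> space (X \<otimes> Y)"
    and eq: "\<And>\<phi>. linear_on X scalars \<phi> \<Longrightarrow> lslice X Y \<phi> s = lslice X Y \<phi> t"
  shows "s = t"
proof -
  interpret X: vector_space "scale X" using X by (rule vspaceD(4))
  interpret Y: vector_space "scale Y" using Y by (rule vspaceD(4))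
  interpret XY: vector_space "scale (X \<otimes> Y)" using vspace_tensor by (rule vspaceD(4))
  have subX: "X.subspace (space X)" using X by (simp add: vspace_def)
  obtain B where B: "B \<subseteq> space X" "X.independent B" "space X \<subseteq> X.span B"
    using X.maximal_independent_subset[of "space X"] by blast
  define c where "c b x = X.representation B x b" for b x
  have c: "linear_on X scalars (c b)" for b
    using B(3) unfolding linear_on_def c_def scalars_def
    by (simp add: X.representation_add[OF B(2) subsetD[OF B(3)] subsetD[OF B(3)]]
        X.representation_scale[OF B(2) subsetD[OF B(3)]])
  let ?S = "\<lambda>G t. \<Sum>b\<in>G. tens X Y b (lslice X Y (c b) t)"
  have lin: "linear_on (X \<otimes> Y) (X \<otimes> Y) (?S G)" if "finite G" "G \<subseteq> B" for G
    using that
  proof (induction G)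
    case empty
    show ?case unfolding sum.empty by (rule linear_on_pointwise(1)[OF vspace_tensor])
  next
    case (insert b G)
    then have "b \<in> space X" using B(1) by blast
    note add = linear_on_pointwise(2)[OF vspace_tensor
        linear_on_compose[OF lslice(1)[OF Y c] linear_on_tens(2)[OF this]]]
    show ?case unfolding sum.insert[OF insert(1,2)] by (rule add) (use insert in blast)
  qed
  \<comment> \<open>Asking for the formula on all larger sets \<open>G\<close> as well lets two tensors share one finite set.\<close>
  have ex: "\<exists>F. finite F \<and> F \<subseteq> B \<and> (\<forall>G. finite G \<longrightarrow> F \<subseteq> G \<longrightarrow> G \<subseteq> B \<longrightarrow> ?S G t = t)"
    if "t \<in> space (X \<otimes> Y)" for t
    using that
  proof (induction rule: tensor_induct)
    case (tens x y)
    let ?F = "{b. c b x \<noteq> 0}"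
    have xB: "x \<in> X.span B" using tens B(3) by blast
    have "?S G (tens X Y x y) = tens X Y x y" if G: "finite G" "?F \<subseteq> G" "G \<subseteq> B" for G
    proof -
      have "?S G (tens X Y x y) = (\<Sum>b\<in>G. tens X Y (scale X (c b x) b) y)"
      proof (rule sum.cong[OF refl])
        fix b assume "b \<in> G"
        then have b: "b \<in> space X" using G B by blast
        show "tens X Y b (lslice X Y (c b) (tens X Y x y)) = tens X Y (scale X (c b x) b) y"
          using tens_balanced[OF b tens(2)] by (simp add: lslice(2)[OF Y c tens])
      qed
      also have "\<dots> = tens X Y (\<Sum>b\<in>G. scale X (c b x) b) y"
        by (rule linear_on_sum[OF X vspace_tensor linear_on_tens(1)[OF tens(2)], symmetric])
          (rule vspaceD(3)[OF X subsetD[OF order_trans[OF G(3) B(1)]]])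
      also have "(\<Sum>b\<in>G. scale X (c b x) b) = (\<Sum>b\<in>?F. scale X (c b x) b)"
        by (rule sum.mono_neutral_right) (use G in auto)
      also have "\<dots> = x"
        unfolding c_def by (rule X.sum_nonzero_representation_eq[OF B(2) xB])
      finally show ?thesis .
    qed
    moreover have "finite ?F" unfolding c_def by (rule X.finite_representation)
    moreover have "?F \<subseteq> B" unfolding c_def using X.representation_ne_zero by blast
    ultimately show ?case by blast
  next
    case zero
    show ?case using linear_on_0[OF vspace_tensor vspace_tensor lin] by blast
  next
    case (add s t)
    from add(3) obtain F where F: "finite F" "F \<subseteq> B"
      "\<And>K. finite K \<Longrightarrow> F \<subseteq> K \<Longrightarrow> K \<subseteq> B \<Longrightarrow> ?S K s = s" by blast
    from add(4) obtain G where G: "finite G" "G \<subseteq> B"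
      "\<And>K. finite K \<Longrightarrow> G \<subseteq> K \<Longrightarrow> K \<subseteq> B \<Longrightarrow> ?S K t = t" by blast
    have "?S K (s + t) = s + t" if K: "finite K" "F \<union> G \<subseteq> K" "K \<subseteq> B" for K
      using K(2) by (simp only: linear_onD(2)[OF lin[OF K(1,3)] add(1,2)] F(3) G(3) K Un_subset_iff)
    then show ?case using F(1,2) G(1,2) by (intro exI[of _ "F \<union> G"]) blast
  next
    case (scale k t)
    from scale(2) obtain F where F: "finite F" "F \<subseteq> B"
      "\<And>K. finite K \<Longrightarrow> F \<subseteq> K \<Longrightarrow> K \<subseteq> B \<Longrightarrow> ?S K t = t" by blast
    have "?S K (vs.scale (X \<otimes> Y) k t) = vs.scale (X \<otimes> Y) k t"
      if K: "finite K" "F \<subseteq> K" "K \<subseteq> B" for K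
      by (simp only: linear_onD(3)[OF lin[OF K(1,3)] scale(1)] F(3)[OF K])
    then show ?case using F(1,2) by blast
  qed
  obtain F where F: "finite F" "F \<subseteq> B"
    "\<And>K. finite K \<Longrightarrow> F \<subseteq> K \<Longrightarrow> K \<subseteq> B \<Longrightarrow> ?S K s = s"
    using ex[OF s] by blast
  obtain G where G: "finite G" "G \<subseteq> B"
    "\<And>K. finite K \<Longrightarrow> G \<subseteq> K \<Longrightarrow> K \<subseteq> B \<Longrightarrow> ?S K t = t"
    using ex[OF t] by blast
  have "s = ?S (F \<union> G) s" using F G by (intro F(3)[symmetric]) auto
  also have "\<dots> = ?S (F \<union> G) t" by (simp only: eq[OF c])
  also have "\<dots> = t" using F G by (intro G(3)) auto
  finally show ?thesis .
qed

text \<open>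
  If the slices along a separating family of functionals on \<open>V\<close> agree, then so do the slices
  along any functional \<open>\<phi>\<close> on \<open>X\<close>: these are elements of \<open>V\<close>, and \<open>apply_slice_commute\<close> shows that
  the family takes the same values on them.
\<close>

lemma rslices_separate:
  assumes X: "vspace X" and V: "vspace V"
    and \<beta>: "\<And>e. e \<in> E \<Longrightarrow> linear_on V scalars (\<beta> e)"
    and sep: "\<And>x y. x \<in> space V \<Longrightarrow> y \<in> space V \<Longrightarrow> (\<And>e. e \<in> E \<Longrightarrow> \<beta> e x = \<beta> e y) \<Longrightarrow> x = y"
    and s: "s \<in> space (X \<otimes> V)" and t: "t \<in> space (X \<otimes> V)"
    and eq: "\<And>e. e \<in> E \<Longrightarrow> rslice X V (\<beta> e) s = rslice X V (\<beta> e) t"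
  shows "s = t"
proof (rule all_lslices_separate[OF X V s t])
  fix \<phi> assume \<phi>: "linear_on X scalars \<phi>"
  show "lslice X V \<phi> s = lslice X V \<phi> t"
  proof (rule sep)
    show "lslice X V \<phi> s \<in> space V" "lslice X V \<phi> t \<in> space V"
      using linear_onD(1)[OF lslice(1)[OF V \<phi>]] s t by blast+
    show "\<beta> e (lslice X V \<phi> s) = \<beta> e (lslice X V \<phi> t)" if "e \<in> E" for e
      using apply_slice_commute[OF X V \<phi> \<beta>[OF that]] eq[OF that] s t by simp
  qed
qed
text \<open>
  The mirror image of the preceding lemma, which is applied here to \<open>X'\<close> as the family.
\<close>

lemma lslices_separate:
  assumes W: "vspace W" and X: "vspace X"
    and \<beta>: "\<And>v. v \<in> E \<Longrightarrow> linear_on W scalars (\<beta> v)"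
    and sep: "\<And>x y. x \<in> space W \<Longrightarrow> y \<in> space W \<Longrightarrow> (\<And>v. v \<in> E \<Longrightarrow> \<beta> v x = \<beta> v y) \<Longrightarrow> x = y"
    and s: "s \<in> space (W \<otimes> X)" and t: "t \<in> space (W \<otimes> X)"
    and eq: "\<And>v. v \<in> E \<Longrightarrow> lslice W X (\<beta> v) s = lslice W X (\<beta> v) t"
  shows "s = t"
proof (rule rslices_separate[OF W X, where E = "space (dual X)" and \<beta> = "\<lambda>l. l"])
  show "x = y" if "x \<in> space X" "y \<in> space X" "\<And>l. l \<in> space (dual X) \<Longrightarrow> l x = l y" for x y
    using dual_separates[OF X that(1,2)] that(3) by blast
  fix l assume "l \<in> space (dual X)"
  then show l: "linear_on X scalars l" by (rule linear_dual)
  show "rslice W X l s = rslice W X l t"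
  proof (rule sep)
    show "rslice W X l s \<in> space W" "rslice W X l t \<in> space W"
      using linear_onD(1)[OF rslice(1)[OF W l]] s t by blast+
    show "\<beta> v (rslice W X l s) = \<beta> v (rslice W X l t)" if "v \<in> E" for v
      using apply_slice_commute[OF W X \<beta>[OF that] l] eq[OF that] s t by metis
  qed
qed (rule s t)+

text \<open>
  Slicing the outer factor of a threefold tensor product leaves the factor at the other end
  alone.  Both lemmas serve to evaluate slices of maps that act in two steps.
\<close>

lemma lslice_assoc:
  assumes X: "vspace X" and W: "vspace W" and Y: "vspace Y" and \<phi>: "linear_on W scalars \<phi>"
    and t: "t \<in> space (W \<otimes> X)" and y: "y \<in> space Y"
  shows "lslice W (X \<otimes> Y) \<phi> (assoc W X Y (tens (W \<otimes> X) Y t y)) = tens X Y (lslice W X \<phi> t) y"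
proof (rule tensor_ext[OF vspace_tensor _ _ _ t])
  show "linear_on (W \<otimes> X) (X \<otimes> Y) (\<lambda>t. lslice W (X \<otimes> Y) \<phi> (assoc W X Y (tens (W \<otimes> X) Y t y)))"
    by (rule linear_on_compose[OF linear_on_compose[OF linear_on_tens(1)[OF y] assoc(1)[OF W Y]]
          lslice(1)[OF vspace_tensor \<phi>]])
  show "linear_on (W \<otimes> X) (X \<otimes> Y) (\<lambda>t. tens X Y (lslice W X \<phi> t) y)"
    by (rule linear_on_compose[OF lslice(1)[OF X \<phi>] linear_on_tens(1)[OF y]])
  show "lslice W (X \<otimes> Y) \<phi> (assoc W X Y (tens (W \<otimes> X) Y (tens W X w x) y)) =
          tens X Y (lslice W X \<phi> (tens W X w x)) y" if "w \<in> space W" "x \<in> space X" for w x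
    using that y linear_onD(3)[OF linear_on_tens(1)[OF y] that(2)]
    by (simp add: assoc(2)[OF W Y] lslice(2)[OF X \<phi>] lslice(2)[OF vspace_tensor \<phi>] tens_in_tensor)
qed

lemma rslice_assoc_inv:
  assumes X: "vspace X" and V: "vspace V" and Y: "vspace Y" and \<phi>: "linear_on V scalars \<phi>"
    and x: "x \<in> space X" and t: "t \<in> space (Y \<otimes> V)"
  shows "rslice (X \<otimes> Y) V \<phi> (assoc_inv X Y V (tens X (Y \<otimes> V) x t)) = tens X Y x (rslice Y V \<phi> t)"
proof (rule tensor_ext[OF vspace_tensor _ _ _ t])
  show "linear_on (Y \<otimes> V) (X \<otimes> Y) (\<lambda>t. rslice (X \<otimes> Y) V \<phi> (assoc_inv X Y V (tens X (Y \<otimes> V) x t)))"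
    by (rule linear_on_compose[OF linear_on_compose[OF linear_on_tens(2)[OF x] assoc_inv(1)[OF X V]]
          rslice(1)[OF vspace_tensor \<phi>]])
  show "linear_on (Y \<otimes> V) (X \<otimes> Y) (\<lambda>t. tens X Y x (rslice Y V \<phi> t))"
    by (rule linear_on_compose[OF rslice(1)[OF Y \<phi>] linear_on_tens(2)[OF x]])
  show "rslice (X \<otimes> Y) V \<phi> (assoc_inv X Y V (tens X (Y \<otimes> V) x (tens Y V y v))) =
          tens X Y x (rslice Y V \<phi> (tens Y V y v))" if "y \<in> space Y" "v \<in> space V" for y v
    using that x linear_onD(3)[OF linear_on_tens(2)[OF x] that(1)]
    by (simp add: assoc_inv(2)[OF X V] rslice(2)[OF Y \<phi>] rslice(2)[OF vspace_tensor \<phi>] tens_in_tensor)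
qed


section \<open>Transposition along a non-degenerate pairing\<close>

definition dual_pairing ::
  "('k::field, 'v::ab_group_add) vs \<Rightarrow> ('k, 'w::ab_group_add) vs \<Rightarrow> ('v \<Rightarrow> 'w \<Rightarrow> 'k) \<Rightarrow> bool" where
  "dual_pairing V W \<beta> \<longleftrightarrow> bilinear_on V W scalars \<beta> \<and>
     (\<forall>x\<in>space V. \<forall>y\<in>space V. (\<forall>e\<in>space W. \<beta> x e = \<beta> y e) \<longrightarrow> x = y) \<and>
     (\<forall>d\<in>space W. \<forall>e\<in>space W. (\<forall>x\<in>space V. \<beta> x d = \<beta> x e) \<longrightarrow> d = e)"

text \<open>
  For all \<open>v\<close> and \<open>e\<close>, the maps \<open>T\<close> and \<open>S\<close> have the same matrix coefficient \<open>X \<rightarrow> X\<close>.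
\<close>

definition transposed ::
  "('k::field, 'v::ab_group_add) vs \<Rightarrow> ('k, 'x::ab_group_add) vs \<Rightarrow> ('k, 'w::ab_group_add) vs
     \<Rightarrow> ('v \<Rightarrow> 'w \<Rightarrow> 'k)
     \<Rightarrow> ((('v \<Rightarrow> 'x \<Rightarrow> 'k) \<Rightarrow> 'k) \<Rightarrow> ('x \<Rightarrow> 'v \<Rightarrow> 'k) \<Rightarrow> 'k)
     \<Rightarrow> ((('x \<Rightarrow> 'w \<Rightarrow> 'k) \<Rightarrow> 'k) \<Rightarrow> ('w \<Rightarrow> 'x \<Rightarrow> 'k) \<Rightarrow> 'k) \<Rightarrow> bool" where
  "transposed V X W \<beta> T S \<longleftrightarrow> (\<forall>v\<in>space V. \<forall>x\<in>space X. \<forall>e\<in>space W.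
     lslice W X (\<beta> v) (S (tens X W x e)) = rslice X V (\<lambda>v. \<beta> v e) (T (tens V X v x)))"

text \<open>
  \<open>T' \<circ> (id \<otimes> f) = (f \<otimes> id) \<circ> T\<close>, where \<open>T\<close> moves \<open>V\<close> from left to right past \<open>X\<close> and \<open>T'\<close> moves it past
  \<open>Y\<close>; then the mirror image of this condition.
\<close>

definition intertwines_right ::
  "('k::field, 'v::ab_group_add) vs \<Rightarrow> ('k, 'x::ab_group_add) vs \<Rightarrow> ('k, 'y::ab_group_add) vs
     \<Rightarrow> ((('v \<Rightarrow> 'x \<Rightarrow> 'k) \<Rightarrow> 'k) \<Rightarrow> ('x \<Rightarrow> 'v \<Rightarrow> 'k) \<Rightarrow> 'k)
     \<Rightarrow> ((('v \<Rightarrow> 'y \<Rightarrow> 'k) \<Rightarrow> 'k) \<Rightarrow> ('y \<Rightarrow> 'v \<Rightarrow> 'k) \<Rightarrow> 'k) \<Rightarrow> ('x \<Rightarrow> 'y) \<Rightarrow> bool" where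
  "intertwines_right V X Y T T' f \<longleftrightarrow>
     (\<forall>t\<in>space (V \<otimes> X). T' (tmap V X V Y id f t) = tmap X V Y V f id (T t))"

definition intertwines_left ::
  "('k::field, 'w::ab_group_add) vs \<Rightarrow> ('k, 'x::ab_group_add) vs \<Rightarrow> ('k, 'y::ab_group_add) vs
     \<Rightarrow> ((('x \<Rightarrow> 'w \<Rightarrow> 'k) \<Rightarrow> 'k) \<Rightarrow> ('w \<Rightarrow> 'x \<Rightarrow> 'k) \<Rightarrow> 'k)
     \<Rightarrow> ((('y \<Rightarrow> 'w \<Rightarrow> 'k) \<Rightarrow> 'k) \<Rightarrow> ('w \<Rightarrow> 'y \<Rightarrow> 'k) \<Rightarrow> 'k) \<Rightarrow> ('x \<Rightarrow> 'y) \<Rightarrow> bool" where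
  "intertwines_left W X Y S S' f \<longleftrightarrow>
     (\<forall>t\<in>space (X \<otimes> W). S' (tmap X W Y W f id t) = tmap W X W Y id f (S t))"

lemma dual_pairing_linear:
  assumes "dual_pairing V W \<beta>"
  shows "e \<in> space W \<Longrightarrow> linear_on V scalars (\<lambda>v. \<beta> v e)"
    and "v \<in> space V \<Longrightarrow> linear_on W scalars (\<beta> v)"
  using assms by (simp_all add: dual_pairing_def bilinear_on_def)

lemma dual_pairing_rslice_ext:
  assumes V: "vspace V" and X: "vspace X" and \<beta>: "dual_pairing V W \<beta>"
    and "s \<in> space (X \<otimes> V)" and "t \<in> space (X \<otimes> V)"
    and "\<And>e. e \<in> space W \<Longrightarrow> rslice X V (\<lambda>v. \<beta> v e) s = rslice X V (\<lambda>v. \<beta> v e) t"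
  shows "s = t"
  by (rule rslices_separate[OF X V dual_pairing_linear(1)[OF \<beta>] _ assms(4,5) assms(6)])
     (use \<beta> in \<open>auto simp: dual_pairing_def\<close>)

lemma dual_pairing_lslice_ext:
  assumes W: "vspace W" and X: "vspace X" and \<beta>: "dual_pairing V W \<beta>"
    and "s \<in> space (W \<otimes> X)" and "t \<in> space (W \<otimes> X)"
    and "\<And>v. v \<in> space V \<Longrightarrow> lslice W X (\<beta> v) s = lslice W X (\<beta> v) t"
  shows "s = t"
  by (rule lslices_separate[OF W X dual_pairing_linear(2)[OF \<beta>] _ assms(4,5) assms(6)])
     (use \<beta> in \<open>auto simp: dual_pairing_def\<close>)

text \<open>
  The intertwining condition says that \<open>f\<close> commutes with matrix coefficients: by naturality,
  slicing \<open>(f \<otimes> id) (T (v \<otimes> x))\<close> yields \<open>f\<close> of a coefficient of \<open>T\<close>, and slices separate points.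
\<close>

lemma intertwines_right_iff_slices:
  assumes V: "vspace V" and X: "vspace X" and Y: "vspace Y" and \<beta>: "dual_pairing V W \<beta>"
    and T: "linear_on (V \<otimes> X) (X \<otimes> V) T" and T': "linear_on (V \<otimes> Y) (Y \<otimes> V) T'"
    and f: "linear_on X Y f"
  shows "intertwines_right V X Y T T' f \<longleftrightarrow> (\<forall>v\<in>space V. \<forall>x\<in>space X. \<forall>e\<in>space W.
     rslice Y V (\<lambda>v. \<beta> v e) (T' (tens V Y v (f x))) = f (rslice X V (\<lambda>v. \<beta> v e) (T (tens V X v x))))"
    (is "?L \<longleftrightarrow> ?R")
proof -
  note lin = linear_on_compose[OF tmap(1)[OF linear_on_id f] T'] linear_on_compose[OF T tmap(1)[OF f linear_on_id]]
  have nat: "rslice Y V (\<lambda>v. \<beta> v e) (tmap X V Y V f id (T t)) = f (rslice X V (\<lambda>v. \<beta> v e) (T t))"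
    if "e \<in> space W" "t \<in> space (V \<otimes> X)" for e t
    by (rule rslice_natural[OF X Y dual_pairing_linear(1)[OF \<beta> that(1)] f linear_onD(1)[OF T that(2)]])
  have tm: "tmap V X V Y id f (tens V X v x) = tens V Y v (f x)"
    if "v \<in> space V" "x \<in> space X" for v x
    using tmap(2)[OF linear_on_id f that] by simp
  show ?thesis
  proof
    assume ?L
    then show ?R using nat tm tens_in_tensor unfolding intertwines_right_def by metis
  next
    assume R: ?R
    show ?L
      unfolding intertwines_right_def
    proof
      fix t assume t: "t \<in> space (V \<otimes> X)"
      show "T' (tmap V X V Y id f t) = tmap X V Y V f id (T t)"
      proof (rule tensor_ext[OF vspace_tensor lin _ t])
        fix v x assume vx: "v \<in> space V" "x \<in> space X"
        note vx' = tens_in_tensor[OF vx]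
        show "T' (tmap V X V Y id f (tens V X v x)) = tmap X V Y V f id (T (tens V X v x))"
          by (rule dual_pairing_rslice_ext[OF V Y \<beta> linear_onD(1)[OF lin(1) vx'] linear_onD(1)[OF lin(2) vx']])
             (simp add: nat vx' tm vx R)
      qed
    qed
  qed
qed

lemma intertwines_left_iff_slices:
  assumes W: "vspace W" and X: "vspace X" and Y: "vspace Y" and \<beta>: "dual_pairing V W \<beta>"
    and S: "linear_on (X \<otimes> W) (W \<otimes> X) S" and S': "linear_on (Y \<otimes> W) (W \<otimes> Y) S'"
    and f: "linear_on X Y f"
  shows "intertwines_left W X Y S S' f \<longleftrightarrow> (\<forall>v\<in>space V. \<forall>x\<in>space X. \<forall>e\<in>space W.
     lslice W Y (\<beta> v) (S' (tens Y W (f x) e)) = f (lslice W X (\<beta> v) (S (tens X W x e))))"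
    (is "?L \<longleftrightarrow> ?R")
proof -
  note lin = linear_on_compose[OF tmap(1)[OF f linear_on_id] S'] linear_on_compose[OF S tmap(1)[OF linear_on_id f]]
  have nat: "lslice W Y (\<beta> v) (tmap W X W Y id f (S t)) = f (lslice W X (\<beta> v) (S t))"
    if "v \<in> space V" "t \<in> space (X \<otimes> W)" for v t
    by (rule lslice_natural[OF X Y dual_pairing_linear(2)[OF \<beta> that(1)] f linear_onD(1)[OF S that(2)]])
  have tm: "tmap X W Y W f id (tens X W x e) = tens Y W (f x) e"
    if "x \<in> space X" "e \<in> space W" for x e
    using tmap(2)[OF f linear_on_id that] by simp
  show ?thesis
  proof
    assume ?L
    then show ?R using nat tm tens_in_tensor unfolding intertwines_left_def by metis
  next
    assume R: ?R
    show ?L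
      unfolding intertwines_left_def
    proof
      fix t assume t: "t \<in> space (X \<otimes> W)"
      show "S' (tmap X W Y W f id t) = tmap W X W Y id f (S t)"
      proof (rule tensor_ext[OF vspace_tensor lin _ t])
        fix x e assume xe: "x \<in> space X" "e \<in> space W"
        note xe' = tens_in_tensor[OF xe]
        show "S' (tmap X W Y W f id (tens X W x e)) = tmap W X W Y id f (S (tens X W x e))"
          by (rule dual_pairing_lslice_ext[OF W Y \<beta> linear_onD(1)[OF lin(1) xe'] linear_onD(1)[OF lin(2) xe']])
             (simp add: nat xe' tm xe R)
      qed
    qed
  qed
qed

lemma intertwines_transposed:
  assumes "vspace V" "vspace W" "vspace X" "vspace Y" "dual_pairing V W \<beta>"
    and "linear_on (V \<otimes> X) (X \<otimes> V) T" "linear_on (V \<otimes> Y) (Y \<otimes> V) T'"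
    and "linear_on (X \<otimes> W) (W \<otimes> X) S" "linear_on (Y \<otimes> W) (W \<otimes> Y) S'"
    and f: "linear_on X Y f"
    and tr: "transposed V X W \<beta> T S" "transposed V Y W \<beta> T' S'"
  shows "intertwines_right V X Y T T' f \<longleftrightarrow> intertwines_left W X Y S S' f"
proof -
  note iff = intertwines_right_iff_slices[OF assms(1,3,4,5,6,7) f]
    intertwines_left_iff_slices[OF assms(2,3,4,5,8,9) f]
  show ?thesis
    unfolding iff using tr linear_onD(1)[OF f] by (simp add: transposed_def)
qed


section \<open>Passing a space through a tensor square\<close>

text \<open>
  \<open>V\<close> moves past the two factors of \<open>H \<otimes> H\<close> one after the other.  The bracketing keeps \<open>H \<otimes> H\<close>
  together as a single space, so that these maps fit the intertwining conditions.
\<close>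

definition pass_right ::
  "('k::field, 'v::ab_group_add) vs \<Rightarrow> ('k, 'h::ab_group_add) vs
     \<Rightarrow> ((('v \<Rightarrow> 'h \<Rightarrow> 'k) \<Rightarrow> 'k) \<Rightarrow> ('h \<Rightarrow> 'v \<Rightarrow> 'k) \<Rightarrow> 'k)
     \<Rightarrow> (('v \<Rightarrow> (('h \<Rightarrow> 'h \<Rightarrow> 'k) \<Rightarrow> 'k) \<Rightarrow> 'k) \<Rightarrow> 'k)
     \<Rightarrow> ((('h \<Rightarrow> 'h \<Rightarrow> 'k) \<Rightarrow> 'k) \<Rightarrow> 'v \<Rightarrow> 'k) \<Rightarrow> 'k" where
  "pass_right V H P t = leg23 H V H P (leg12 V H H P (assoc_inv V H H t))"

definition pass_left ::
  "('k::field, 'h::ab_group_add) vs \<Rightarrow> ('k, 'w::ab_group_add) vs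
     \<Rightarrow> ((('h \<Rightarrow> 'w \<Rightarrow> 'k) \<Rightarrow> 'k) \<Rightarrow> ('w \<Rightarrow> 'h \<Rightarrow> 'k) \<Rightarrow> 'k)
     \<Rightarrow> (((('h \<Rightarrow> 'h \<Rightarrow> 'k) \<Rightarrow> 'k) \<Rightarrow> 'w \<Rightarrow> 'k) \<Rightarrow> 'k)
     \<Rightarrow> ('w \<Rightarrow> (('h \<Rightarrow> 'h \<Rightarrow> 'k) \<Rightarrow> 'k) \<Rightarrow> 'k) \<Rightarrow> 'k" where
  "pass_left H W Q t = assoc W H H (leg12 H W H Q (leg23 H H W Q t))"

lemma linear_on_pass_right:
  assumes V: "vspace V" and H: "vspace H" and P: "linear_on (V \<otimes> H) (H \<otimes> V) P"
  shows "linear_on (V \<otimes> (H \<otimes> H)) (H \<otimes> H \<otimes> V) (pass_right V H P)"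
  unfolding pass_right_def[abs_def]
  by (rule linear_on_compose[OF linear_on_compose[OF assoc_inv(1)[OF V H] linear_on_leg12[OF P]]
        linear_on_leg23[OF H V H P]])

lemma linear_on_pass_left:
  assumes W: "vspace W" and H: "vspace H" and Q: "linear_on (H \<otimes> W) (W \<otimes> H) Q"
  shows "linear_on (H \<otimes> H \<otimes> W) (W \<otimes> (H \<otimes> H)) (pass_left H W Q)"
  unfolding pass_left_def[abs_def]
  by (rule linear_on_compose[OF linear_on_compose[OF linear_on_leg23[OF H H W Q] linear_on_leg12[OF Q]]
        assoc(1)[OF W H]])

lemma bilinear_rslice:
  assumes V: "vspace V" and W: "vspace W" and X: "vspace X" and \<beta>: "bilinear_on V W scalars \<beta>"
  shows "bilinear_on (X \<otimes> V) W X (\<lambda>t e. rslice X V (\<lambda>v. \<beta> v e) t)"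
  unfolding rslice_def
proof (rule bilinear_on_tlift(1)[OF W X, of X V "\<lambda>x v e. scale X (\<beta> v e) x"])
  show "bilinear_on X V X (\<lambda>x v. scale X (\<beta> v e) x)" if "e \<in> space W" for e
    using bilinear_on_comp[OF bilinear_on_scale(2)[OF X] linear_on_id, of V "\<lambda>v. \<beta> v e"] \<beta> that
    by (simp add: bilinear_on_def)
  show "linear_on W X (\<lambda>e. scale X (\<beta> v e) x)" if "x \<in> space X" "v \<in> space V" for x v
    using linear_on_compose[of W scalars "\<beta> v" X "\<lambda>c. scale X c x"] \<beta> that bilinear_on_scale(1)[OF X]
    by (simp add: bilinear_on_def)
qed

text \<open>
  Both coefficients at \<open>a \<otimes> b\<close> equal the contraction of \<open>P (v \<otimes> a) \<in> H \<otimes> V\<close> with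
  \<open>Q (b \<otimes> e) \<in> W \<otimes> H\<close>.  For \<open>W\<close>, the transposition hypothesis turns the second application of \<open>Q\<close>
  into \<open>P (v \<otimes> a)\<close>; for \<open>V\<close>, it turns the second application of \<open>P\<close> into \<open>Q (b \<otimes> e)\<close>.
\<close>

lemma transposed_pass:
  assumes V: "vspace V" and W: "vspace W" and H: "vspace H" and \<beta>: "dual_pairing V W \<beta>"
    and P: "linear_on (V \<otimes> H) (H \<otimes> V) P" and Q: "linear_on (H \<otimes> W) (W \<otimes> H) Q"
    and tr: "transposed V H W \<beta> P Q"
  shows "transposed V (H \<otimes> H) W \<beta> (pass_right V H P) (pass_left H W Q)"
  unfolding transposed_def
proof (intro ballI)
  fix v x e assume v: "v \<in> space V" and x: "x \<in> space (H \<otimes> H)" and e: "e \<in> space W"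
  note \<beta>e = dual_pairing_linear(1)[OF \<beta>] and \<beta>v = dual_pairing_linear(2)[OF \<beta>]
  have bil: "bilinear_on V W scalars \<beta>" using \<beta> by (simp add: dual_pairing_def)
  \<comment> \<open>The contraction \<open>(H \<otimes> V) \<times> (W \<otimes> H) \<rightarrow> H \<otimes> H\<close> that sends \<open>(a \<otimes> v, e \<otimes> b)\<close> to \<open>\<beta> v e (a \<otimes> b)\<close>.\<close>
  define G where "G p s = tlift W H (H \<otimes> H) (\<lambda>e b. tens H H (rslice H V (\<lambda>v. \<beta> v e) p) b) s" for p s
  have rs: "linear_on W H (\<lambda>e. rslice H V (\<lambda>v. \<beta> v e) p)" if "p \<in> space (H \<otimes> V)" for p
    using bilinear_rslice[OF V W H bil] that by (simp add: bilinear_on_def)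
  have G1: "bilinear_on W H (H \<otimes> H) (\<lambda>e b. tens H H (rslice H V (\<lambda>v. \<beta> v e) p) b)"
    if "p \<in> space (H \<otimes> V)" for p
    using bilinear_on_comp[OF bilinear_on_tens rs[OF that] linear_on_id] by simp
  have G2: "linear_on (H \<otimes> V) (H \<otimes> H) (\<lambda>p. tens H H (rslice H V (\<lambda>v. \<beta> v e) p) b)"
    if "e \<in> space W" "b \<in> space H" for e b
    by (rule linear_on_compose[OF rslice(1)[OF H \<beta>e[OF that(1)]] linear_on_tens(1)[OF that(2)]])
  have G_bil: "bilinear_on (W \<otimes> H) (H \<otimes> V) (H \<otimes> H) (\<lambda>s p. G p s)"
    unfolding G_def
    by (rule bilinear_on_tlift(1)[OF vspace_tensor vspace_tensor,
          of "H" "V" W H H H "\<lambda>e b p. tens H H (rslice H V (\<lambda>v. \<beta> v e) p) b", OF G1 G2])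
  have G_right: "G p (tens W H e b) = tens H H (rslice H V (\<lambda>v. \<beta> v e) p) b"
    if "p \<in> space (H \<otimes> V)" "e \<in> space W" "b \<in> space H" for p e b
    unfolding G_def by (rule tlift(2)[OF vspace_tensor G1[OF that(1)] that(2,3)])
  have G_left: "G (tens H V a v) s = tens H H a (lslice W H (\<beta> v) s)"
    if a: "a \<in> space H" and v: "v \<in> space V" and s: "s \<in> space (W \<otimes> H)" for a v s
  proof (rule tensor_ext[OF vspace_tensor _ _ _ s])
    show "linear_on (W \<otimes> H) (H \<otimes> H) (G (tens H V a v))"
      using G_bil tens_in_tensor[OF a v] by (simp add: bilinear_on_def)
    show "linear_on (W \<otimes> H) (H \<otimes> H) (\<lambda>s. tens H H a (lslice W H (\<beta> v) s))"
      by (rule linear_on_compose[OF lslice(1)[OF H \<beta>v[OF v]] linear_on_tens(2)[OF a]])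
    show "G (tens H V a v) (tens W H e b) = tens H H a (lslice W H (\<beta> v) (tens W H e b))"
      if "e \<in> space W" "b \<in> space H" for e b
      using that tens_balanced[OF a that(2)] tens_in_tensor[OF a v]
      by (simp add: G_right rslice(2)[OF H \<beta>e a v] lslice(2)[OF H \<beta>v[OF v]])
  qed
  have left: "lslice W (H \<otimes> H) (\<beta> v) (assoc W H H (leg12 H W H Q (assoc_inv H W H (tens H (W \<otimes> H) a s)))) =
      G (P (tens V H v a)) s"
    if a: "a \<in> space H" and s: "s \<in> space (W \<otimes> H)" for a s
  proof (rule tensor_ext[OF vspace_tensor _ _ _ s])
    have p: "P (tens V H v a) \<in> space (H \<otimes> V)" by (rule linear_onD(1)[OF P tens_in_tensor[OF v a]])
    show "linear_on (W \<otimes> H) (H \<otimes> H) (G (P (tens V H v a)))"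
      using G_bil p by (simp add: bilinear_on_def)
    show "linear_on (W \<otimes> H) (H \<otimes> H) (\<lambda>s. lslice W (H \<otimes> H) (\<beta> v)
        (assoc W H H (leg12 H W H Q (assoc_inv H W H (tens H (W \<otimes> H) a s)))))"
      by (rule linear_on_compose[OF linear_on_compose[OF linear_on_compose[OF
                linear_on_compose[OF linear_on_tens(2)[OF a] assoc_inv(1)[OF H H]]
                linear_on_leg12[OF Q]] assoc(1)[OF W H]] lslice(1)[OF vspace_tensor \<beta>v[OF v]]])
    fix e b assume e: "e \<in> space W" and b: "b \<in> space H"
    note ae = tens_in_tensor[OF a e]
    show "lslice W (H \<otimes> H) (\<beta> v) (assoc W H H (leg12 H W H Q
            (assoc_inv H W H (tens H (W \<otimes> H) a (tens W H e b))))) = G (P (tens V H v a)) (tens W H e b)"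
      using tr v a e
      by (simp add: assoc_inv(2)[OF H H a e b] leg12_tens[OF Q ae b]
          lslice_assoc[OF H W H \<beta>v[OF v] linear_onD(1)[OF Q ae] b] G_right[OF p e b] transposed_def)
  qed
  have right: "rslice (H \<otimes> H) V (\<lambda>v. \<beta> v e) (leg23 H V H P (tens (H \<otimes> V) H p b)) = G p (Q (tens H W b e))"
    if p: "p \<in> space (H \<otimes> V)" and b: "b \<in> space H" for p b
  proof (rule tensor_ext[OF vspace_tensor _ _ _ p])
    have q: "Q (tens H W b e) \<in> space (W \<otimes> H)" by (rule linear_onD(1)[OF Q tens_in_tensor[OF b e]])
    show "linear_on (H \<otimes> V) (H \<otimes> H) (\<lambda>p. G p (Q (tens H W b e)))"
      using G_bil q by (simp add: bilinear_on_def)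
    show "linear_on (H \<otimes> V) (H \<otimes> H) (\<lambda>p. rslice (H \<otimes> H) V (\<lambda>v. \<beta> v e) (leg23 H V H P (tens (H \<otimes> V) H p b)))"
      by (rule linear_on_compose[OF linear_on_compose[OF linear_on_tens(1)[OF b] linear_on_leg23[OF H V H P]]
              rslice(1)[OF vspace_tensor \<beta>e[OF e]]])
    fix a v assume a: "a \<in> space H" and v: "v \<in> space V"
    show "rslice (H \<otimes> H) V (\<lambda>v. \<beta> v e) (leg23 H V H P (tens (H \<otimes> V) H (tens H V a v) b)) =
            G (tens H V a v) (Q (tens H W b e))"
      using tr v b e
      by (simp add: leg23_tens[OF H H P a v b] G_left[OF a v q] transposed_def
          rslice_assoc_inv[OF H V H \<beta>e[OF e] a linear_onD(1)[OF P tens_in_tensor[OF v b]]])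
  qed
  show "lslice W (H \<otimes> H) (\<beta> v) (pass_left H W Q (tens (H \<otimes> H) W x e)) =
        rslice (H \<otimes> H) V (\<lambda>v. \<beta> v e) (pass_right V H P (tens V (H \<otimes> H) v x))"
  proof (rule tensor_ext[OF vspace_tensor _ _ _ x])
    show "linear_on (H \<otimes> H) (H \<otimes> H) (\<lambda>x. lslice W (H \<otimes> H) (\<beta> v) (pass_left H W Q (tens (H \<otimes> H) W x e)))"
      by (rule linear_on_compose[OF linear_on_compose[OF linear_on_tens(1)[OF e] linear_on_pass_left[OF W H Q]]
              lslice(1)[OF vspace_tensor \<beta>v[OF v]]])
    show "linear_on (H \<otimes> H) (H \<otimes> H)
        (\<lambda>x. rslice (H \<otimes> H) V (\<lambda>v. \<beta> v e) (pass_right V H P (tens V (H \<otimes> H) v x)))"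
      by (rule linear_on_compose[OF linear_on_compose[OF linear_on_tens(2)[OF v] linear_on_pass_right[OF V H P]]
              rslice(1)[OF vspace_tensor \<beta>e[OF e]]])
    fix a b assume a: "a \<in> space H" and b: "b \<in> space H"
    note va = tens_in_tensor[OF v a]
    have "pass_left H W Q (tens (H \<otimes> H) W (tens H H a b) e) =
        assoc W H H (leg12 H W H Q (assoc_inv H W H (tens H (W \<otimes> H) a (Q (tens H W b e)))))"
      unfolding pass_left_def by (simp add: leg23_tens[OF H W Q a b e])
    moreover have "pass_right V H P (tens V (H \<otimes> H) v (tens H H a b)) =
        leg23 H V H P (tens (H \<otimes> V) H (P (tens V H v a)) b)"
      unfolding pass_right_def by (simp add: assoc_inv(2)[OF V H v a b] leg12_tens[OF P va b])
    ultimately show "lslice W (H \<otimes> H) (\<beta> v) (pass_left H W Q (tens (H \<otimes> H) W (tens H H a b) e)) =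
        rslice (H \<otimes> H) V (\<lambda>v. \<beta> v e) (pass_right V H P (tens V (H \<otimes> H) v (tens H H a b)))"
      using left[OF a linear_onD(1)[OF Q tens_in_tensor[OF b e]]] right[OF linear_onD(1)[OF P va] b]
      by simp
  qed
qed


section \<open>The structure axioms as intertwining conditions\<close>

lemma ball_assoc_inv_iff:
  assumes A: "vspace A" and C: "vspace C"
  shows "(\<forall>t\<in>space (A \<otimes> B \<otimes> C). R t) \<longleftrightarrow> (\<forall>t\<in>space (A \<otimes> (B \<otimes> C)). R (assoc_inv A B C t))"
  using assoc_inv_assoc[OF A C] linear_onD(1)[OF assoc(1)[OF A C]] linear_onD(1)[OF assoc_inv(1)[OF A C]]
  by metis

text \<open>
  With the first leg kept apart, the braid equation says that \<open>\<Psi>\<close> commutes with moving \<open>V\<close> past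
  \<open>H \<otimes> H\<close>.  What has to be shown is only that rebracketing is harmless.
\<close>

lemma right_braided_iff:
  assumes V: "vspace V" and H: "vspace H" and P: "bij_linear (V \<otimes> H) (H \<otimes> V) P"
  shows "right_braided V H \<Psi> P \<longleftrightarrow>
    intertwines_right V (H \<otimes> H) (H \<otimes> H) (pass_right V H P) (pass_right V H P) \<Psi>"
  unfolding right_braided_def intertwines_right_def ball_assoc_inv_iff[OF V H] pass_right_def
  using P by (simp add: leg23_assoc_inv[OF V H] leg12_def[of H H V])

lemma left_braided_iff:
  assumes W: "vspace W" and H: "vspace H" and Q: "bij_linear (H \<otimes> W) (W \<otimes> H) Q"
    and \<Psi>: "linear_on (H \<otimes> H) (H \<otimes> H) \<Psi>"
  shows "left_braided H \<Psi> W Q \<longleftrightarrow>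
    intertwines_left W (H \<otimes> H) (H \<otimes> H) (pass_left H W Q) (pass_left H W Q) \<Psi>"
proof -
  have Q': "linear_on (H \<otimes> W) (W \<otimes> H) Q" using Q by (simp add: bij_linear_def)
  let ?R = "\<lambda>t. leg12 H W H Q (leg23 H H W Q t)"
  have R: "linear_on (H \<otimes> H \<otimes> W) (W \<otimes> H \<otimes> H) ?R"
    by (rule linear_on_compose[OF linear_on_leg23[OF H H W Q'] linear_on_leg12[OF Q']])
  have "?R (leg12 H H W \<Psi> t) = leg23 W H H \<Psi> (?R t) \<longleftrightarrow>
      assoc W H H (?R (leg12 H H W \<Psi> t)) = tmap W (H \<otimes> H) W (H \<otimes> H) id \<Psi> (assoc W H H (?R t))"
    if t: "t \<in> space (H \<otimes> H \<otimes> W)" for t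
  proof -
    have 1: "?R (leg12 H H W \<Psi> t) \<in> space (W \<otimes> H \<otimes> H)"
      by (rule linear_onD(1)[OF R linear_onD(1)[OF linear_on_leg12[OF \<Psi>] t]])
    have 2: "tmap W (H \<otimes> H) W (H \<otimes> H) id \<Psi> (assoc W H H (?R t)) \<in> space (W \<otimes> (H \<otimes> H))"
      by (rule linear_onD(1)[OF tmap(1)[OF linear_on_id \<Psi>]
            linear_onD(1)[OF assoc(1)[OF W H] linear_onD(1)[OF R t]]])
    show ?thesis
      using assoc_inv_assoc[OF W H 1] assoc_assoc_inv[OF W H 2] by (auto simp: leg23_def[of W H H])
  qed
  then show ?thesis
    unfolding left_braided_def intertwines_left_def pass_left_def
    using Q by (simp add: leg12_def[of H H W])
qed

text \<open>
  The two sides of the counit axiom are slices along \<open>\<epsilon>\<close>, which makes them accessible to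
  \<open>apply_slice_commute\<close>.
\<close>

lemma counit_slices:
  assumes V: "vspace V" and \<epsilon>: "linear_on H scalars \<epsilon>"
  shows "t \<in> space (H \<otimes> V) \<Longrightarrow> lunit V (tmap H V scalars V \<epsilon> id t) = lslice H V \<epsilon> t"
    and "s \<in> space (V \<otimes> H) \<Longrightarrow> runit V (tmap V H V scalars id \<epsilon> s) = rslice V H \<epsilon> s"
proof -
  have "linear_on (scalars \<otimes> V) V (lunit V)" "linear_on (V \<otimes> scalars) V (runit V)"
    unfolding lunit_def runit_def using tlift(1)[OF V] bilinear_on_scale[OF V] by blast+
  note lin = linear_on_compose[OF tmap(1)[OF \<epsilon> linear_on_id] this(1)]
    linear_on_compose[OF tmap(1)[OF linear_on_id \<epsilon>] this(2)]
  show "lunit V (tmap H V scalars V \<epsilon> id t) = lslice H V \<epsilon> t" if "t \<in> space (H \<otimes> V)"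
    by (rule tensor_ext[OF V lin(1) lslice(1)[OF V \<epsilon>] _ that])
       (simp add: tmap(2)[OF \<epsilon> linear_on_id] lunit_runit_tens[OF V] lslice(2)[OF V \<epsilon>])
  show "runit V (tmap V H V scalars id \<epsilon> s) = rslice V H \<epsilon> s" if "s \<in> space (V \<otimes> H)"
    by (rule tensor_ext[OF V lin(2) rslice(1)[OF V \<epsilon>] _ that])
       (simp add: tmap(2)[OF linear_on_id \<epsilon>] lunit_runit_tens[OF V] rslice(2)[OF V \<epsilon>])
qed

lemma comult_compat_right_iff:
  assumes V: "vspace V" and P: "linear_on (V \<otimes> H) (H \<otimes> V) P" and \<epsilon>: "linear_on H scalars \<epsilon>"
  shows "comult_compat_right V H P \<Delta> \<epsilon> \<longleftrightarrow>
    intertwines_right V H (H \<otimes> H) P (pass_right V H P) \<Delta> \<and>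
    (\<forall>t\<in>space (V \<otimes> H). lslice H V \<epsilon> (P t) = rslice V H \<epsilon> t)"
  using counit_slices[OF V \<epsilon>] linear_onD(1)[OF P]
  by (auto simp: comult_compat_right_def intertwines_right_def pass_right_def)

lemma comult_compat_left_iff:
  assumes W: "vspace W" and H: "vspace H" and Q: "linear_on (H \<otimes> W) (W \<otimes> H) Q"
    and \<epsilon>: "linear_on H scalars \<epsilon>" and \<Delta>: "linear_on H (H \<otimes> H) \<Delta>"
  shows "comult_compat_left H W Q \<Delta> \<epsilon> \<longleftrightarrow>
    intertwines_left W H (H \<otimes> H) Q (pass_left H W Q) \<Delta> \<and>
    (\<forall>t\<in>space (H \<otimes> W). rslice W H \<epsilon> (Q t) = lslice H W \<epsilon> t)"
proof -
  let ?L = "\<lambda>t. tmap W H W (H \<otimes> H) id \<Delta> (Q t)"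
  let ?R = "\<lambda>t. leg12 H W H Q (leg23 H H W Q (tmap H W (H \<otimes> H) W \<Delta> id t))"
  have "assoc_inv W H H (?L t) = ?R t \<longleftrightarrow> assoc W H H (?R t) = ?L t" if t: "t \<in> space (H \<otimes> W)" for t
  proof -
    have 1: "?L t \<in> space (W \<otimes> (H \<otimes> H))"
      by (rule linear_onD(1)[OF tmap(1)[OF linear_on_id \<Delta>] linear_onD(1)[OF Q t]])
    have 2: "?R t \<in> space (W \<otimes> H \<otimes> H)"
      by (rule linear_onD(1)[OF linear_on_compose[OF linear_on_leg23[OF H H W Q] linear_on_leg12[OF Q]]
            linear_onD(1)[OF tmap(1)[OF \<Delta> linear_on_id] t]])
    show ?thesis using assoc_inv_assoc[OF W H 2] assoc_assoc_inv[OF W H 1] by auto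
  qed
  then show ?thesis
    using counit_slices[OF W \<epsilon>] linear_onD(1)[OF Q]
    by (auto simp: comult_compat_left_def intertwines_left_def pass_left_def)
qed

lemma mult_compat_right_iff:
  assumes V: "vspace V" and H: "vspace H"
  shows "mult_compat_right V H P m u \<longleftrightarrow>
    intertwines_right V (H \<otimes> H) H (pass_right V H P) P m \<and>
    (\<forall>e. u = Some e \<longrightarrow> (\<forall>v\<in>space V. P (tens V H v e) = tens H V e v))"
  unfolding mult_compat_right_def ball_assoc_inv_iff[OF V H] intertwines_right_def pass_right_def
  by (simp add: assoc_assoc_inv[OF V H])

lemma mult_compat_left_iff:
  "mult_compat_left H W Q m u \<longleftrightarrow>
    intertwines_left W (H \<otimes> H) H (pass_left H W Q) Q m \<and>
    (\<forall>e. u = Some e \<longrightarrow> (\<forall>w\<in>space W. Q (tens H W e w) = tens W H w e))"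
  unfolding mult_compat_left_def intertwines_left_def pass_left_def by simp

section \<open>Transposing the structure axioms\<close>

text \<open>
  Evaluated on the pairing, either condition says that \<open>\<epsilon>\<close> composed with the coefficient at
  \<open>(v, e)\<close> is \<open>\<beta> v e \<cdot> \<epsilon>\<close>.
\<close>

lemma counit_transposed:
  assumes V: "vspace V" and W: "vspace W" and H: "vspace H" and \<beta>: "dual_pairing V W \<beta>"
    and P: "linear_on (V \<otimes> H) (H \<otimes> V) P" and Q: "linear_on (H \<otimes> W) (W \<otimes> H) Q"
    and tr: "transposed V H W \<beta> P Q" and \<epsilon>: "linear_on H scalars \<epsilon>"
  shows "(\<forall>t\<in>space (V \<otimes> H). lslice H V \<epsilon> (P t) = rslice V H \<epsilon> t) \<longleftrightarrow>
         (\<forall>t\<in>space (H \<otimes> W). rslice W H \<epsilon> (Q t) = lslice H W \<epsilon> t)"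
    (is "?R \<longleftrightarrow> ?L")
proof -
  note \<beta>e = dual_pairing_linear(1)[OF \<beta>] and \<beta>v = dual_pairing_linear(2)[OF \<beta>]
  note bil = \<beta>[unfolded dual_pairing_def]
  note linV = linear_on_compose[OF P lslice(1)[OF V \<epsilon>]]
  note linW = linear_on_compose[OF Q rslice(1)[OF W \<epsilon>]]
  have R1: "\<beta> (lslice H V \<epsilon> (P (tens V H v a))) e = \<epsilon> (rslice H V (\<lambda>v. \<beta> v e) (P (tens V H v a)))"
    "\<beta> (rslice V H \<epsilon> (tens V H v a)) e = \<epsilon> a * \<beta> v e"
    if "v \<in> space V" "a \<in> space H" "e \<in> space W" for v a e
    using apply_slice_commute[OF H V \<epsilon> \<beta>e[OF that(3)] linear_onD(1)[OF P tens_in_tensor[OF that(1,2)]]]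
      linear_onD(3)[OF \<beta>e[OF that(3)] that(1)] by (simp_all add: rslice(2)[OF V \<epsilon> that(1,2)] scalars_def)
  have L1: "\<beta> v (rslice W H \<epsilon> (Q (tens H W a e))) = \<epsilon> (lslice W H (\<beta> v) (Q (tens H W a e)))"
    "\<beta> v (lslice H W \<epsilon> (tens H W a e)) = \<epsilon> a * \<beta> v e"
    if "v \<in> space V" "a \<in> space H" "e \<in> space W" for v a e
    using apply_slice_commute[OF W H \<beta>v[OF that(1)] \<epsilon> linear_onD(1)[OF Q tens_in_tensor[OF that(2,3)]]]
      linear_onD(3)[OF \<beta>v[OF that(1)] that(3)] by (simp_all add: lslice(2)[OF W \<epsilon> that(2,3)] scalars_def)
  have R: "?R \<longleftrightarrow> (\<forall>v\<in>space V. \<forall>a\<in>space H. \<forall>e\<in>space W.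
      \<epsilon> (rslice H V (\<lambda>v. \<beta> v e) (P (tens V H v a))) = \<epsilon> a * \<beta> v e)" (is "_ \<longleftrightarrow> ?R'")
  proof
    show ?R' if ?R using that R1 tens_in_tensor by metis
    assume R': ?R'
    show ?R
    proof
      fix t assume t: "t \<in> space (V \<otimes> H)"
      show "lslice H V \<epsilon> (P t) = rslice V H \<epsilon> t"
      proof (rule tensor_ext[OF V linV rslice(1)[OF V \<epsilon>] _ t])
        fix v a assume va: "v \<in> space V" "a \<in> space H"
        note va' = linear_onD(1)[OF linV tens_in_tensor[OF va]]
          linear_onD(1)[OF rslice(1)[OF V \<epsilon>] tens_in_tensor[OF va]]
        show "lslice H V \<epsilon> (P (tens V H v a)) = rslice V H \<epsilon> (tens V H v a)"
          using bil va' R' R1 va by simp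
      qed
    qed
  qed
  have L: "?L \<longleftrightarrow> (\<forall>v\<in>space V. \<forall>a\<in>space H. \<forall>e\<in>space W.
      \<epsilon> (lslice W H (\<beta> v) (Q (tens H W a e))) = \<epsilon> a * \<beta> v e)" (is "_ \<longleftrightarrow> ?L'")
  proof
    show ?L' if ?L using that L1 tens_in_tensor by metis
    assume L': ?L'
    show ?L
    proof
      fix t assume t: "t \<in> space (H \<otimes> W)"
      show "rslice W H \<epsilon> (Q t) = lslice H W \<epsilon> t"
      proof (rule tensor_ext[OF W linW lslice(1)[OF W \<epsilon>] _ t])
        fix a e assume ae: "a \<in> space H" "e \<in> space W"
        note ae' = linear_onD(1)[OF linW tens_in_tensor[OF ae]]
          linear_onD(1)[OF lslice(1)[OF W \<epsilon>] tens_in_tensor[OF ae]]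
        show "rslice W H \<epsilon> (Q (tens H W a e)) = lslice H W \<epsilon> (tens H W a e)"
          using bil ae' L' L1 ae by simp
      qed
    qed
  qed
  show ?thesis unfolding R L using tr by (simp add: transposed_def)
qed

text \<open>
  Either condition says that the coefficient at \<open>(v, e)\<close> maps \<open>a\<close> to \<open>\<beta> v e \<cdot> a\<close>.
\<close>

lemma unit_transposed:
  assumes V: "vspace V" and W: "vspace W" and H: "vspace H" and \<beta>: "dual_pairing V W \<beta>"
    and P: "linear_on (V \<otimes> H) (H \<otimes> V) P" and Q: "linear_on (H \<otimes> W) (W \<otimes> H) Q"
    and tr: "transposed V H W \<beta> P Q" and a: "a \<in> space H"
  shows "(\<forall>v\<in>space V. P (tens V H v a) = tens H V a v) \<longleftrightarrow>
         (\<forall>e\<in>space W. Q (tens H W a e) = tens W H e a)"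
    (is "?R \<longleftrightarrow> ?L")
proof -
  note \<beta>e = dual_pairing_linear(1)[OF \<beta>] and \<beta>v = dual_pairing_linear(2)[OF \<beta>]
  have "?R \<longleftrightarrow> (\<forall>v\<in>space V. \<forall>e\<in>space W.
      rslice H V (\<lambda>v. \<beta> v e) (P (tens V H v a)) = scale H (\<beta> v e) a)" (is "_ \<longleftrightarrow> ?R'")
  proof
    show ?R' if ?R using that a by (simp add: rslice(2)[OF H \<beta>e])
    show ?R if R': ?R'
    proof
      fix v assume v: "v \<in> space V"
      show "P (tens V H v a) = tens H V a v"
        by (rule dual_pairing_rslice_ext[OF V H \<beta> linear_onD(1)[OF P tens_in_tensor[OF v a]]
              tens_in_tensor[OF a v]])
           (simp add: rslice(2)[OF H \<beta>e] R' v a)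
    qed
  qed
  moreover have "?L \<longleftrightarrow> (\<forall>v\<in>space V. \<forall>e\<in>space W.
      lslice W H (\<beta> v) (Q (tens H W a e)) = scale H (\<beta> v e) a)" (is "_ \<longleftrightarrow> ?L'")
  proof
    show ?L' if ?L using that a by (simp add: lslice(2)[OF H \<beta>v])
    show ?L if L': ?L'
    proof
      fix e assume e: "e \<in> space W"
      show "Q (tens H W a e) = tens W H e a"
        by (rule dual_pairing_lslice_ext[OF W H \<beta> linear_onD(1)[OF Q tens_in_tensor[OF a e]]
              tens_in_tensor[OF e a]])
           (simp add: lslice(2)[OF H \<beta>v] L' e a)
    qed
  qed
  ultimately show ?thesis using tr a by (simp add: transposed_def)
qed

text \<open>
  Each axiom splits into an intertwining condition and possibly a unit or counit condition, and
  each of these has the same coefficients on both sides.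
\<close>

proposition structures_transposed:
  assumes V: "vspace V" and W: "vspace W" and H: "vspace H" and \<beta>: "dual_pairing V W \<beta>"
    and P: "bij_linear (V \<otimes> H) (H \<otimes> V) P" and Q: "bij_linear (H \<otimes> W) (W \<otimes> H) Q"
    and tr: "transposed V H W \<beta> P Q"
  shows "linear_on (H \<otimes> H) (H \<otimes> H) \<Psi> \<Longrightarrow> right_braided V H \<Psi> P \<longleftrightarrow> left_braided H \<Psi> W Q"
    and "linear_on H (H \<otimes> H) \<Delta> \<Longrightarrow> linear_on H scalars \<epsilon> \<Longrightarrow>
           comult_compat_right V H P \<Delta> \<epsilon> \<longleftrightarrow> comult_compat_left H W Q \<Delta> \<epsilon>"
    and "linear_on (H \<otimes> H) H m \<Longrightarrow> (\<And>e. u = Some e \<Longrightarrow> e \<in> space H) \<Longrightarrow>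
           mult_compat_right V H P m u \<longleftrightarrow> mult_compat_left H W Q m u"
proof -
  have P': "linear_on (V \<otimes> H) (H \<otimes> V) P" and Q': "linear_on (H \<otimes> W) (W \<otimes> H) Q"
    using P Q by (simp_all add: bij_linear_def)
  note pR = linear_on_pass_right[OF V H P'] and pL = linear_on_pass_left[OF W H Q']
  note pass = transposed_pass[OF V W H \<beta> P' Q' tr]
  show "right_braided V H \<Psi> P \<longleftrightarrow> left_braided H \<Psi> W Q" if \<Psi>: "linear_on (H \<otimes> H) (H \<otimes> H) \<Psi>"
    unfolding right_braided_iff[OF V H P] left_braided_iff[OF W H Q \<Psi>]
    by (rule intertwines_transposed[OF V W vspace_tensor vspace_tensor \<beta> pR pR pL pL \<Psi> pass pass])
  show "comult_compat_right V H P \<Delta> \<epsilon> \<longleftrightarrow> comult_compat_left H W Q \<Delta> \<epsilon>"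
    if \<Delta>: "linear_on H (H \<otimes> H) \<Delta>" and \<epsilon>: "linear_on H scalars \<epsilon>"
    unfolding comult_compat_right_iff[OF V P' \<epsilon>] comult_compat_left_iff[OF W H Q' \<epsilon> \<Delta>]
      intertwines_transposed[OF V W H vspace_tensor \<beta> P' pR Q' pL \<Delta> tr pass]
      counit_transposed[OF V W H \<beta> P' Q' tr \<epsilon>] ..
  show "mult_compat_right V H P m u \<longleftrightarrow> mult_compat_left H W Q m u"
    if m: "linear_on (H \<otimes> H) H m" and u: "\<And>e. u = Some e \<Longrightarrow> e \<in> space H"
    unfolding mult_compat_right_iff[OF V H] mult_compat_left_iff
      intertwines_transposed[OF V W vspace_tensor H \<beta> pR P' pL Q' m pass tr]
    using unit_transposed[OF V W H \<beta> P' Q' tr u] by blast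
qed


section \<open>Inversion\<close>

definition inverse_on ::
  "('k::field, 'a::ab_group_add) vs \<Rightarrow> ('k, 'b::ab_group_add) vs \<Rightarrow> ('a \<Rightarrow> 'b) \<Rightarrow> ('b \<Rightarrow> 'a) \<Rightarrow> bool" where
  "inverse_on A B f g \<longleftrightarrow> linear_on A B f \<and> linear_on B A g \<and>
     (\<forall>x\<in>space A. g (f x) = x) \<and> (\<forall>y\<in>space B. f (g y) = y)"

lemma inverse_onD:
  assumes "inverse_on A B f g"
  shows "linear_on A B f" and "linear_on B A g" and "inverse_on B A g f"
    and "x \<in> space A \<Longrightarrow> g (f x) = x" and "y \<in> space B \<Longrightarrow> f (g y) = y"
  using assms by (auto simp: inverse_on_def)

lemma inverse_on_comp:
  assumes "inverse_on A B f g" and "inverse_on B C h k"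
  shows "inverse_on A C (\<lambda>x. h (f x)) (\<lambda>z. g (k z))"
  using assms by (simp add: inverse_on_def linear_on_def)

lemma inverse_on_tmap:
  assumes f: "inverse_on A C f f'" and g: "inverse_on B D g g'"
  shows "inverse_on (A \<otimes> B) (C \<otimes> D) (tmap A B C D f g) (tmap C D A B f' g')"
proof -
  have "tmap C D A B f' g' (tmap A B C D f g t) = t"
    if f: "inverse_on A C f f'" and g: "inverse_on B D g g'" and t: "t \<in> space (A \<otimes> B)"
    for A B C D f f' g g' t
    by (rule tensor_ext[OF vspace_tensor linear_on_compose[OF tmap(1)[OF inverse_onD(1)[OF f] inverse_onD(1)[OF g]]
            tmap(1)[OF inverse_onD(2)[OF f] inverse_onD(2)[OF g]]] linear_on_id[unfolded id_def] _ t])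
       (simp add: tmap(2)[OF inverse_onD(1)[OF f] inverse_onD(1)[OF g]]
          tmap(2)[OF inverse_onD(2)[OF f] inverse_onD(2)[OF g]]
          linear_onD(1)[OF inverse_onD(1)[OF f]] linear_onD(1)[OF inverse_onD(1)[OF g]]
          inverse_onD(4)[OF f] inverse_onD(4)[OF g])
  from this[OF f g] this[OF inverse_onD(3)[OF f] inverse_onD(3)[OF g]] show ?thesis
    using tmap(1)[OF inverse_onD(1)[OF f] inverse_onD(1)[OF g]]
      tmap(1)[OF inverse_onD(2)[OF f] inverse_onD(2)[OF g]]
    by (simp add: inverse_on_def)
qed

lemma inverse_on_id: "inverse_on A A id id"
  by (simp add: inverse_on_def linear_on_id)

lemma inverse_on_assoc:
  assumes "vspace A" "vspace C"
  shows "inverse_on (A \<otimes> B \<otimes> C) (A \<otimes> (B \<otimes> C)) (assoc A B C) (assoc_inv A B C)"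
  using assms by (simp add: inverse_on_def assoc(1) assoc_inv(1) assoc_assoc_inv assoc_inv_assoc)

lemma inverse_on_pass:
  assumes V: "vspace V" and H: "vspace H" and PQ: "inverse_on (V \<otimes> H) (H \<otimes> V) P Q"
  shows "inverse_on (V \<otimes> (H \<otimes> H)) (H \<otimes> H \<otimes> V) (pass_right V H P) (pass_left H V Q)"
proof -
  have leg12: "inverse_on (V \<otimes> H \<otimes> H) (H \<otimes> V \<otimes> H) (leg12 V H H P) (leg12 H V H Q)"
    unfolding leg12_def by (rule inverse_on_tmap[OF PQ inverse_on_id])
  have leg23: "inverse_on (H \<otimes> V \<otimes> H) (H \<otimes> H \<otimes> V) (leg23 H V H P) (leg23 H H V Q)"
    unfolding leg23_def comp_def
    by (rule inverse_on_comp[OF inverse_on_comp[OF inverse_on_assoc[OF H H]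
            inverse_on_tmap[OF inverse_on_id PQ]] inverse_onD(3)[OF inverse_on_assoc[OF H V]]])
  show ?thesis
    unfolding pass_right_def[abs_def] pass_left_def[abs_def]
    by (rule inverse_on_comp[OF inverse_on_comp[OF inverse_onD(3)[OF inverse_on_assoc[OF V H]] leg12] leg23])
qed

text \<open>
  Compose \<open>T' \<circ> (id \<otimes> f) = (f \<otimes> id) \<circ> T\<close> with \<open>S'\<close> on the left and with \<open>S\<close> on the right.
\<close>

lemma intertwines_inverse:
  assumes T: "inverse_on (V \<otimes> X) (X \<otimes> V) T S" and T': "inverse_on (V \<otimes> Y) (Y \<otimes> V) T' S'"
    and f: "linear_on X Y f"
  shows "intertwines_right V X Y T T' f \<longleftrightarrow> intertwines_left V X Y S S' f"
proof
  assume R: "intertwines_right V X Y T T' f"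
  show "intertwines_left V X Y S S' f"
    unfolding intertwines_left_def
  proof
    fix t assume t: "t \<in> space (X \<otimes> V)"
    then have s: "S t \<in> space (V \<otimes> X)" by (rule linear_onD(1)[OF inverse_onD(2)[OF T]])
    have "tmap X V Y V f id t = T' (tmap V X V Y id f (S t))"
      using R s inverse_onD(5)[OF T t] by (simp add: intertwines_right_def)
    then show "S' (tmap X V Y V f id t) = tmap V X V Y id f (S t)"
      using inverse_onD(4)[OF T' linear_onD(1)[OF tmap(1)[OF linear_on_id f] s]] by simp
  qed
next
  assume L: "intertwines_left V X Y S S' f"
  show "intertwines_right V X Y T T' f"
    unfolding intertwines_right_def
  proof
    fix t assume t: "t \<in> space (V \<otimes> X)"
    then have s: "T t \<in> space (X \<otimes> V)" by (rule linear_onD(1)[OF inverse_onD(1)[OF T]])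
    have "tmap V X V Y id f t = S' (tmap X V Y V f id (T t))"
      using L s inverse_onD(4)[OF T t] by (simp add: intertwines_left_def)
    then show "T' (tmap V X V Y id f t) = tmap X V Y V f id (T t)"
      using inverse_onD(5)[OF T' linear_onD(1)[OF tmap(1)[OF f linear_on_id] s]] by simp
  qed
qed

lemma bij_linear_inverse_on:
  assumes "inverse_on A B f g"
  shows "bij_linear A B f" and "bij_linear B A g"
  using assms unfolding bij_linear_def inverse_on_def linear_on_def
  by (auto intro!: bij_betw_byWitness[where f' = g] bij_betw_byWitness[where f' = f])

text \<open>
  Here the mirrored axioms hold on the same space \<open>V\<close> and for the same \<open>\<Psi>\<close>: inverting
  both sides of an intertwining condition exchanges left and right but does not touch the
  intertwined map.
\<close>

proposition structures_inverse:
  assumes V: "vspace V" and H: "vspace H" and PQ: "inverse_on (V \<otimes> H) (H \<otimes> V) P Q"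
  shows "linear_on (H \<otimes> H) (H \<otimes> H) \<Psi> \<Longrightarrow> right_braided V H \<Psi> P \<longleftrightarrow> left_braided H \<Psi> V Q"
    and "linear_on H (H \<otimes> H) \<Delta> \<Longrightarrow> linear_on H scalars \<epsilon> \<Longrightarrow>
           comult_compat_right V H P \<Delta> \<epsilon> \<longleftrightarrow> comult_compat_left H V Q \<Delta> \<epsilon>"
    and "linear_on (H \<otimes> H) H m \<Longrightarrow> (\<And>e. u = Some e \<Longrightarrow> e \<in> space H) \<Longrightarrow>
           mult_compat_right V H P m u \<longleftrightarrow> mult_compat_left H V Q m u"
proof -
  note bij = bij_linear_inverse_on[OF PQ] and pass = inverse_on_pass[OF V H PQ]
  note P = inverse_onD(1)[OF PQ] and Q = inverse_onD(2)[OF PQ]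
  show "right_braided V H \<Psi> P \<longleftrightarrow> left_braided H \<Psi> V Q" if \<Psi>: "linear_on (H \<otimes> H) (H \<otimes> H) \<Psi>"
    unfolding right_braided_iff[OF V H bij(1)] left_braided_iff[OF V H bij(2) \<Psi>]
    by (rule intertwines_inverse[OF pass pass \<Psi>])
  have "(\<forall>t\<in>space (V \<otimes> H). lslice H V \<epsilon> (P t) = rslice V H \<epsilon> t) \<longleftrightarrow>
      (\<forall>t\<in>space (H \<otimes> V). rslice V H \<epsilon> (Q t) = lslice H V \<epsilon> t)"
    using inverse_onD(4,5)[OF PQ] linear_onD(1)[OF P] linear_onD(1)[OF Q] by metis
  then show "comult_compat_right V H P \<Delta> \<epsilon> \<longleftrightarrow> comult_compat_left H V Q \<Delta> \<epsilon>"
    if \<Delta>: "linear_on H (H \<otimes> H) \<Delta>" and \<epsilon>: "linear_on H scalars \<epsilon>"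
    unfolding comult_compat_right_iff[OF V P \<epsilon>] comult_compat_left_iff[OF V H Q \<epsilon> \<Delta>]
      intertwines_inverse[OF PQ pass \<Delta>] by simp
  have "P (tens V H v e) = tens H V e v \<longleftrightarrow> Q (tens H V e v) = tens V H v e"
    if "v \<in> space V" "e \<in> space H" for v e
    using inverse_onD(4)[OF PQ tens_in_tensor[OF that]]
      inverse_onD(5)[OF PQ tens_in_tensor[OF that(2,1)]] by metis
  then show "mult_compat_right V H P m u \<longleftrightarrow> mult_compat_left H V Q m u"
    if m: "linear_on (H \<otimes> H) H m" and u: "\<And>e. u = Some e \<Longrightarrow> e \<in> space H"
    unfolding mult_compat_right_iff[OF V H] mult_compat_left_iff intertwines_inverse[OF pass PQ m]
    using u by simp
qed

lemma inverse_on_braid_inv: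
  assumes V: "vspace V" and P: "bij_linear (V \<otimes> W) (W \<otimes> V) P"
  shows "inverse_on (V \<otimes> W) (W \<otimes> V) P (braid_inv V W P)"
proof -
  have lin: "linear_on (V \<otimes> W) (W \<otimes> V) P" and bij: "bij_betw P (space (V \<otimes> W)) (space (W \<otimes> V))"
    using P by (simp_all add: bij_linear_def)
  let ?Q = "braid_inv V W P"
  have 1: "?Q (P t) = t" if "t \<in> space (V \<otimes> W)" for t
    unfolding braid_inv_def by (rule bij_betw_inv_into_left[OF bij that])
  have 2: "P (?Q s) = s" if "s \<in> space (W \<otimes> V)" for s
    unfolding braid_inv_def by (rule bij_betw_inv_into_right[OF bij that])
  have 3: "?Q s \<in> space (V \<otimes> W)" if "s \<in> space (W \<otimes> V)" for s
    unfolding braid_inv_def using bij_betw_inv_into[OF bij] that by (rule bij_betwE[rule_format])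
  have "?Q (s + t) = ?Q s + ?Q t" if st: "s \<in> space (W \<otimes> V)" "t \<in> space (W \<otimes> V)" for s t
    using 1[OF vspaceD(2)[OF vspace_tensor 3[OF st(1)] 3[OF st(2)]]]
    by (simp only: linear_onD(2)[OF lin 3[OF st(1)] 3[OF st(2)]] 2 st)
  moreover have "?Q (scale (W \<otimes> V) c s) = scale (V \<otimes> W) c (?Q s)" if s: "s \<in> space (W \<otimes> V)" for c s
    using 1[OF vspaceD(3)[OF vspace_tensor 3[OF s]]]
    by (simp only: linear_onD(3)[OF lin 3[OF s]] 2 s)
  ultimately show ?thesis
    unfolding inverse_on_def linear_on_def[of "W \<otimes> V"] using lin 1 2 3 by blast
qed


section \<open>The dual braidings as transposes\<close>

text \<open>
  \<open>inv_into\<close> is well behaved here because \<open>g\<close> embeds \<open>B\<close> into \<open>D\<close> and \<open>f\<close> has values in its image.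
\<close>

lemma bij_linear_factor:
  assumes B: "vspace B" and D: "vspace D"
    and f: "linear_on A D f" and g: "linear_on B D g" and inj: "inj_on g (space B)"
    and bij: "bij_betw f (space A) (g ` space B)"
  shows "bij_linear A B (inv_into (space B) g \<circ> f)"
    and "x \<in> space A \<Longrightarrow> g ((inv_into (space B) g \<circ> f) x) = f x"
proof -
  let ?h = "inv_into (space B) g \<circ> f"
  have fx: "f x \<in> g ` space B" if "x \<in> space A" for x
    using bij that by (auto simp: bij_betw_def)
  have hB: "?h x \<in> space B" and gh: "g (?h x) = f x" if "x \<in> space A" for x
    using fx[OF that] by (simp_all add: inv_into_into f_inv_into_f)
  show "g (?h x) = f x" if "x \<in> space A" by (rule gh[OF that])
  have h: "?h x = b" if "b \<in> space B" "f x = g b" for x b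
    using inj that by (simp add: inv_into_f_f)
  have "linear_on A B ?h"
    unfolding linear_on_def
  proof (intro conjI ballI allI)
    show "?h x \<in> space B" if "x \<in> space A" for x by (rule hB[OF that])
    show "?h (x + y) = ?h x + ?h y" if x: "x \<in> space A" and y: "y \<in> space A" for x y
    proof (rule h[OF vspaceD(2)[OF B hB[OF x] hB[OF y]]])
      show "f (x + y) = g (?h x + ?h y)"
        by (simp only: linear_onD(2)[OF f x y] linear_onD(2)[OF g hB[OF x] hB[OF y]] gh x y)
    qed
    show "?h (scale A c x) = scale B c (?h x)" if x: "x \<in> space A" for c x
    proof (rule h[OF vspaceD(3)[OF B hB[OF x]]])
      show "f (scale A c x) = g (scale B c (?h x))"
        by (simp only: linear_onD(3)[OF f x] linear_onD(3)[OF g hB[OF x]] gh x)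
    qed
  qed
  moreover have "bij_betw ?h (space A) (space B)"
    by (rule bij_betw_trans[OF bij bij_betw_inv_into[OF bij_betw_imageI[OF inj refl]]])
  ultimately show "bij_linear A B ?h" by (simp add: bij_linear_def)
qed

text \<open>
  \<open>V\<close> separates the points of \<open>W\<close> because functionals vanish outside the carrier of \<open>V\<close>.
\<close>

lemma dual_pairing_eval:
  assumes W: "vsubspace W (dual V)" and nd: "nondegenerate V W"
  shows "dual_pairing V W (\<lambda>v e. e v)" and "dual_pairing W V (\<lambda>e v. e v)"
proof -
  have lin: "linear_on V scalars e" and off: "x \<notin> space V \<Longrightarrow> e x = 0"
    if "e \<in> space W" for e x
    using W that by (auto simp: vsubspace_def dual_def)
  have sc: "scale W = fscale" using W by (simp add: vsubspace_def dual_def)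
  have ext: "d = e" if "d \<in> space W" "e \<in> space W" "\<forall>x\<in>space V. d x = e x" for d e
  proof
    show "d x = e x" for x 
      using that off[OF that(1)] off[OF that(2)] by (cases "x \<in> space V") auto
  qed
  have sep: "x = y" if "x \<in> space V" "y \<in> space V" "\<forall>e\<in>space W. e x = e y" for x y
    using nd that by (auto simp: nondegenerate_def)
  show "dual_pairing V W (\<lambda>v e. e v)" "dual_pairing W V (\<lambda>e v. e v)"
    using lin linear_eval[OF sc] ext sep by (auto simp: dual_pairing_def bilinear_on_def)
qed

lemma dual_ext:
  assumes "vspace A" "x \<in> space A" "y \<in> space A" and "\<And>f. f \<in> space (dual A) \<Longrightarrow> f x = f y"
  shows "x = y"
  using dual_separates[OF assms(1-3)] assms(4) by blast

text \<open>
  The embedding tests \<open>t\<close> against \<open>v\<close> and \<open>f\<close>; once \<open>t\<close> is sliced by \<open>v\<close>, only a functional on \<open>H\<close>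
  remains.  Together with \<open>dpair_slice\<close> this removes \<open>H'\<close> from the definition of the dual braidings.
\<close>

lemma emb_WH_slice:
  assumes H: "vspace H" and V: "vspace V" and W: "vsubspace W (dual V)"
    and v: "v \<in> space V" and f: "f \<in> space (dual H)" and t: "t \<in> space (W \<otimes> H)"
  shows "emb_WH H V W t (tens V (dual H) v f) = f (lslice W H (\<lambda>e. e v) t)"
proof -
  have "scale W = fscale" using W by (simp add: vsubspace_def dual_def)
  note ev = linear_eval[OF this, of v]
  have ev': "linear_on (dual (V \<otimes> dual H)) scalars (\<lambda>F. F z)" for z
    by (rule linear_eval) (simp add: dual_def)
  show ?thesis
    by (rule tensor_ext[OF vspace_scalars linear_on_compose[OF emb_WH_tens(1)[OF H V W] ev']
          linear_on_compose[OF lslice(1)[OF H ev] linear_dual[OF f]] _ t])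
       (simp add: emb_WH_tens(2)[OF H V W _ _ v f] lslice(2)[OF H ev]
          linear_onD(3)[OF linear_dual[OF f]] scalars_def)
qed

lemma emb_HW_slice:
  assumes H: "vspace H" and V: "vspace V" and W: "vsubspace W (dual V)"
    and v: "v \<in> space V" and f: "f \<in> space (dual H)" and t: "t \<in> space (H \<otimes> W)"
  shows "emb_HW H V W t (tens (dual H) V f v) = f (rslice H W (\<lambda>e. e v) t)"
proof -
  have "scale W = fscale" using W by (simp add: vsubspace_def dual_def)
  note ev = linear_eval[OF this, of v]
  have ev': "linear_on (dual (dual H \<otimes> V)) scalars (\<lambda>F. F z)" for z
    by (rule linear_eval) (simp add: dual_def)
  show ?thesis
    by (rule tensor_ext[OF vspace_scalars linear_on_compose[OF emb_HW_tens(1)[OF H V W] ev']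
          linear_on_compose[OF rslice(1)[OF H ev] linear_dual[OF f]] _ t])
       (simp add: emb_HW_tens(2)[OF H V W _ _ f v] rslice(2)[OF H ev]
          linear_onD(3)[OF linear_dual[OF f]] scalars_def)
qed

lemma dpair_slice:
  assumes X: "vspace X" and Y: "vspace Y" and A: "vsubspace A (dual Y)" and B: "vsubspace B (dual X)"
    and \<xi>: "\<xi> \<in> space A" and \<eta>: "\<eta> \<in> space B" and t: "t \<in> space (X \<otimes> Y)"
  shows "dpair A B X Y (tens A B \<xi> \<eta>) t = \<eta> (rslice X Y \<xi> t)"
    and "dpair A B X Y (tens A B \<xi> \<eta>) t = \<xi> (lslice X Y \<eta> t)"
proof -
  have l\<xi>: "linear_on Y scalars \<xi>" and l\<eta>: "linear_on X scalars \<eta>"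
    using A B \<xi> \<eta> by (auto simp: vsubspace_def dual_def)
  show *: "dpair A B X Y (tens A B \<xi> \<eta>) t = \<eta> (rslice X Y \<xi> t)"
    by (rule tensor_ext[OF vspace_scalars dpair(2)[OF X Y A B tens_in_tensor[OF \<xi> \<eta>]]
          linear_on_compose[OF rslice(1)[OF X l\<xi>] l\<eta>] _ t])
       (simp add: dpair(3)[OF X Y A B \<xi> \<eta>] rslice(2)[OF X l\<xi>] linear_onD(3)[OF l\<eta>] scalars_def)
  show "dpair A B X Y (tens A B \<xi> \<eta>) t = \<xi> (lslice X Y \<eta> t)"
    unfolding * apply_slice_commute[OF X Y l\<eta> l\<xi> t] ..
qed

text \<open>
  The defining equation tests the coefficients of \<open>P\<close> and \<open>braid_HW H V W P\<close> against all
  \<open>f \<in> H'\<close>, which separates the points of \<open>H\<close>.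
\<close>

lemma braid_HW_transposed:
  assumes H: "vspace H" and V: "vspace V" and W: "vsubspace W (dual V)" and nd: "nondegenerate V W"
    and P: "linear_on (V \<otimes> H) (H \<otimes> V) P" and bij: "dual_HW_bij H V W P"
  shows "bij_linear (H \<otimes> W) (W \<otimes> H) (braid_HW H V W P)"
    and "transposed V H W (\<lambda>v e. e v) P (braid_HW H V W P)"
proof -
  note \<beta> = dual_pairing_eval(1)[OF W nd]
  have vW: "vspace W" using W by (simp add: vsubspace_def)
  have dH: "vsubspace (dual H) (dual H)" using vspace_dual[OF H] by (simp add: vsubspace_def)
  note \<beta>e = dual_pairing_linear(1)[OF \<beta>] and \<beta>v = dual_pairing_linear(2)[OF \<beta>]
  have inj: "inj_on (emb_WH H V W) (space (W \<otimes> H))"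
  proof (rule inj_onI)
    fix s t assume st: "s \<in> space (W \<otimes> H)" "t \<in> space (W \<otimes> H)" and eq: "emb_WH H V W s = emb_WH H V W t"
    show "s = t"
    proof (rule dual_pairing_lslice_ext[OF vW H \<beta> st])
      fix v assume v: "v \<in> space V"
      show "lslice W H (\<lambda>e. e v) s = lslice W H (\<lambda>e. e v) t"
        by (rule dual_ext[OF H linear_onD(1)[OF lslice(1)[OF H \<beta>v[OF v]] st(1)]
              linear_onD(1)[OF lslice(1)[OF H \<beta>v[OF v]] st(2)]])
           (use emb_WH_slice[OF H V W v _ st(1)] emb_WH_slice[OF H V W v _ st(2)] eq in metis)
    qed
  qed
  note factor = bij_linear_factor[OF vspace_tensor vspace_dual[OF vspace_tensor] dual_HW_tens(1)[OF H V W P]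
      emb_WH_tens(1)[OF H V W] inj bij[unfolded dual_HW_bij_def], folded braid_HW_def]
  show Q: "bij_linear (H \<otimes> W) (W \<otimes> H) (braid_HW H V W P)" by (rule factor(1))
  show "transposed V H W (\<lambda>v e. e v) P (braid_HW H V W P)"
    unfolding transposed_def
  proof (intro ballI)
    fix v a e assume v: "v \<in> space V" and a: "a \<in> space H" and e: "e \<in> space W"
    have q: "braid_HW H V W P (tens H W a e) \<in> space (W \<otimes> H)"
      using Q tens_in_tensor[OF a e] by (simp add: bij_linear_def linear_on_def)
    have p: "P (tens V H v a) \<in> space (H \<otimes> V)"
      by (rule linear_onD(1)[OF P tens_in_tensor[OF v a]])
    show "lslice W H (\<lambda>e. e v) (braid_HW H V W P (tens H W a e)) = rslice H V (\<lambda>v. e v) (P (tens V H v a))"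
    proof (rule dual_ext[OF H linear_onD(1)[OF lslice(1)[OF H \<beta>v[OF v]] q]
          linear_onD(1)[OF rslice(1)[OF H \<beta>e[OF e]] p]])
      fix f assume f: "f \<in> space (dual H)"
      show "f (lslice W H (\<lambda>e. e v) (braid_HW H V W P (tens H W a e))) =
            f (rslice H V (\<lambda>v. e v) (P (tens V H v a)))"
        using emb_WH_slice[OF H V W v f q] factor(2)[OF tens_in_tensor[OF a e]]
          dual_HW_tens(2)[OF H V W P a e v f] dpair_slice(1)[OF H V W dH e f p]
        by simp
    qed
  qed
qed

text \<open>
  The same argument with \<open>W\<close> and \<open>V\<close> exchanged in the pairing: now the new braiding moves its
  space from left to right, and \<open>P\<close> is its transpose.
\<close>

lemma braid_WH_transposed:
  assumes H: "vspace H" and V: "vspace V" and W: "vsubspace W (dual V)" and nd: "nondegenerate V W"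
    and P: "linear_on (H \<otimes> V) (V \<otimes> H) P" and bij: "dual_WH_bij H V W P"
  shows "bij_linear (W \<otimes> H) (H \<otimes> W) (braid_WH H V W P)"
    and "transposed W H V (\<lambda>e v. e v) (braid_WH H V W P) P"
proof -
  note \<beta> = dual_pairing_eval(2)[OF W nd]
  have vW: "vspace W" using W by (simp add: vsubspace_def)
  have dH: "vsubspace (dual H) (dual H)" using vspace_dual[OF H] by (simp add: vsubspace_def)
  note \<beta>v = dual_pairing_linear(1)[OF \<beta>] and \<beta>e = dual_pairing_linear(2)[OF \<beta>]
  have inj: "inj_on (emb_HW H V W) (space (H \<otimes> W))"
  proof (rule inj_onI)
    fix s t assume st: "s \<in> space (H \<otimes> W)" "t \<in> space (H \<otimes> W)" and eq: "emb_HW H V W s = emb_HW H V W t"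
    show "s = t"
    proof (rule dual_pairing_rslice_ext[OF vW H \<beta> st])
      fix v assume v: "v \<in> space V"
      show "rslice H W (\<lambda>e. e v) s = rslice H W (\<lambda>e. e v) t"
        by (rule dual_ext[OF H linear_onD(1)[OF rslice(1)[OF H \<beta>v[OF v]] st(1)]
              linear_onD(1)[OF rslice(1)[OF H \<beta>v[OF v]] st(2)]])
           (use emb_HW_slice[OF H V W v _ st(1)] emb_HW_slice[OF H V W v _ st(2)] eq in metis)
    qed
  qed
  note factor = bij_linear_factor[OF vspace_tensor vspace_dual[OF vspace_tensor] dual_WH_tens(1)[OF H V W P]
      emb_HW_tens(1)[OF H V W] inj bij[unfolded dual_WH_bij_def], folded braid_WH_def]
  show Q: "bij_linear (W \<otimes> H) (H \<otimes> W) (braid_WH H V W P)" by (rule factor(1))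
  show "transposed W H V (\<lambda>e v. e v) (braid_WH H V W P) P"
    unfolding transposed_def
  proof (intro ballI)
    fix e a v assume e: "e \<in> space W" and a: "a \<in> space H" and v: "v \<in> space V"
    have q: "braid_WH H V W P (tens W H e a) \<in> space (H \<otimes> W)"
      using Q tens_in_tensor[OF e a] by (simp add: bij_linear_def linear_on_def)
    have p: "P (tens H V a v) \<in> space (V \<otimes> H)"
      by (rule linear_onD(1)[OF P tens_in_tensor[OF a v]])
    show "lslice V H (\<lambda>v. e v) (P (tens H V a v)) = rslice H W (\<lambda>e. e v) (braid_WH H V W P (tens W H e a))"
    proof (rule dual_ext[OF H linear_onD(1)[OF lslice(1)[OF H \<beta>e[OF e]] p]
          linear_onD(1)[OF rslice(1)[OF H \<beta>v[OF v]] q]])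
      fix f assume f: "f \<in> space (dual H)"
      show "f (lslice V H (\<lambda>v. e v) (P (tens H V a v))) =
            f (rslice H W (\<lambda>e. e v) (braid_WH H V W P (tens W H e a)))"
        using emb_HW_slice[OF H V W v f q] factor(2)[OF tens_in_tensor[OF e a]]
          dual_WH_tens(2)[OF H V W P e a f v] dpair_slice(2)[OF V H dH W f e p]
        by simp
    qed
  qed
qed


section \<open>Braided spaces, their duals and inverses\<close>

lemma braided_structures_linear:
  shows "braiding H \<Psi> \<Longrightarrow> linear_on (H \<otimes> H) (H \<otimes> H) \<Psi>"
    and "braided_coalgebra H \<Psi> \<Delta> \<epsilon> \<Longrightarrow> linear_on H (H \<otimes> H) \<Delta>"
    and "braided_coalgebra H \<Psi> \<Delta> \<epsilon> \<Longrightarrow> linear_on H scalars \<epsilon>"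
    and "braided_algebra H \<Psi> m u \<Longrightarrow> linear_on (H \<otimes> H) H m"
    and "braided_algebra H \<Psi> m u \<Longrightarrow> u = Some e \<Longrightarrow> e \<in> space H"
  by (simp_all add: braiding_def bij_linear_def braided_coalgebra_def coalgebra_def
      braided_algebra_def algebra_def)

lemma right_braided_dual:
  assumes H: "vspace H" and \<Psi>: "braiding H \<Psi>" and V: "vspace V"
    and W: "vsubspace W (dual V)" and nd: "nondegenerate V W"
    and P: "right_braided V H \<Psi> P" and bij: "dual_HW_bij H V W P"
  shows "left_braided H \<Psi> W (braid_HW H V W P)"
    and "braided_coalgebra H \<Psi> \<Delta> \<epsilon> \<Longrightarrow> comult_compat_right V H P \<Delta> \<epsilon> \<Longrightarrow>
           comult_compat_left H W (braid_HW H V W P) \<Delta> \<epsilon>"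
    and "braided_algebra H \<Psi> m u \<Longrightarrow> mult_compat_right V H P m u \<Longrightarrow>
           mult_compat_left H W (braid_HW H V W P) m u"
proof -
  have vW: "vspace W" using W by (simp add: vsubspace_def)
  have bP: "bij_linear (V \<otimes> H) (H \<otimes> V) P" using P by (simp add: right_braided_def)
  then have lP: "linear_on (V \<otimes> H) (H \<otimes> V) P" by (simp add: bij_linear_def)
  note tr = structures_transposed[OF V vW H dual_pairing_eval(1)[OF W nd] bP
      braid_HW_transposed[OF H V W nd lP bij]]
  show "left_braided H \<Psi> W (braid_HW H V W P)"
    using tr(1)[OF braided_structures_linear(1)[OF \<Psi>]] P by simp
  show "comult_compat_left H W (braid_HW H V W P) \<Delta> \<epsilon>"
    if "braided_coalgebra H \<Psi> \<Delta> \<epsilon>" "comult_compat_right V H P \<Delta> \<epsilon>"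
    using tr(2)[OF braided_structures_linear(2,3)[OF that(1)]] that(2) by simp
  show "mult_compat_left H W (braid_HW H V W P) m u"
    if "braided_algebra H \<Psi> m u" "mult_compat_right V H P m u"
    using tr(3)[OF braided_structures_linear(4,5)[OF that(1)]] that(2) by simp
qed

lemma left_braided_dual:
  assumes H: "vspace H" and \<Psi>: "braiding H \<Psi>" and V: "vspace V"
    and W: "vsubspace W (dual V)" and nd: "nondegenerate V W"
    and P: "left_braided H \<Psi> V P" and bij: "dual_WH_bij H V W P"
  shows "right_braided W H \<Psi> (braid_WH H V W P)"
    and "braided_coalgebra H \<Psi> \<Delta> \<epsilon> \<Longrightarrow> comult_compat_left H V P \<Delta> \<epsilon> \<Longrightarrow>
           comult_compat_right W H (braid_WH H V W P) \<Delta> \<epsilon>"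
    and "braided_algebra H \<Psi> m u \<Longrightarrow> mult_compat_left H V P m u \<Longrightarrow>
           mult_compat_right W H (braid_WH H V W P) m u"
proof -
  have vW: "vspace W" using W by (simp add: vsubspace_def)
  have bP: "bij_linear (H \<otimes> V) (V \<otimes> H) P" using P by (simp add: left_braided_def)
  then have lP: "linear_on (H \<otimes> V) (V \<otimes> H) P" by (simp add: bij_linear_def)
  note Q = braid_WH_transposed[OF H V W nd lP bij]
  note tr = structures_transposed[OF vW V H dual_pairing_eval(2)[OF W nd] Q(1) bP Q(2)]
  show "right_braided W H \<Psi> (braid_WH H V W P)"
    using tr(1)[OF braided_structures_linear(1)[OF \<Psi>]] P by simp
  show "comult_compat_right W H (braid_WH H V W P) \<Delta> \<epsilon>"
    if "braided_coalgebra H \<Psi> \<Delta> \<epsilon>" "comult_compat_left H V P \<Delta> \<epsilon>"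
    using tr(2)[OF braided_structures_linear(2,3)[OF that(1)]] that(2) by simp
  show "mult_compat_right W H (braid_WH H V W P) m u"
    if "braided_algebra H \<Psi> m u" "mult_compat_left H V P m u"
    using tr(3)[OF braided_structures_linear(4,5)[OF that(1)]] that(2) by simp
qed

lemma right_braided_inv:
  assumes H: "vspace H" and \<Psi>: "braiding H \<Psi>" and V: "vspace V" and P: "right_braided V H \<Psi> P"
  shows "left_braided H \<Psi> V (braid_inv V H P)"
    and "braided_coalgebra H \<Psi> \<Delta> \<epsilon> \<Longrightarrow> comult_compat_right V H P \<Delta> \<epsilon> \<Longrightarrow>
           comult_compat_left H V (braid_inv V H P) \<Delta> \<epsilon>"
    and "braided_algebra H \<Psi> m u \<Longrightarrow> mult_compat_right V H P m u \<Longrightarrow>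
           mult_compat_left H V (braid_inv V H P) m u"
proof -
  have bP: "bij_linear (V \<otimes> H) (H \<otimes> V) P" using P by (simp add: right_braided_def)
  note iff = structures_inverse[OF V H inverse_on_braid_inv[OF V bP]]
  show "left_braided H \<Psi> V (braid_inv V H P)"
    using iff(1)[OF braided_structures_linear(1)[OF \<Psi>]] P by simp
  show "comult_compat_left H V (braid_inv V H P) \<Delta> \<epsilon>"
    if "braided_coalgebra H \<Psi> \<Delta> \<epsilon>" "comult_compat_right V H P \<Delta> \<epsilon>"
    using iff(2)[OF braided_structures_linear(2,3)[OF that(1)]] that(2) by simp
  show "mult_compat_left H V (braid_inv V H P) m u"
    if "braided_algebra H \<Psi> m u" "mult_compat_right V H P m u"
    using iff(3)[OF braided_structures_linear(4,5)[OF that(1)]] that(2) by simp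
qed

lemma left_braided_inv:
  assumes H: "vspace H" and \<Psi>: "braiding H \<Psi>" and V: "vspace V" and P: "left_braided H \<Psi> V P"
  shows "right_braided V H \<Psi> (braid_inv H V P)"
    and "braided_coalgebra H \<Psi> \<Delta> \<epsilon> \<Longrightarrow> comult_compat_left H V P \<Delta> \<epsilon> \<Longrightarrow>
           comult_compat_right V H (braid_inv H V P) \<Delta> \<epsilon>"
    and "braided_algebra H \<Psi> m u \<Longrightarrow> mult_compat_left H V P m u \<Longrightarrow>
           mult_compat_right V H (braid_inv H V P) m u"
proof -
  have bP: "bij_linear (H \<otimes> V) (V \<otimes> H) P" using P by (simp add: left_braided_def)
  note iff = structures_inverse[OF V H inverse_onD(3)[OF inverse_on_braid_inv[OF H bP]]]
  show "right_braided V H \<Psi> (braid_inv H V P)"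
    using iff(1)[OF braided_structures_linear(1)[OF \<Psi>]] P by simp
  show "comult_compat_right V H (braid_inv H V P) \<Delta> \<epsilon>"
    if "braided_coalgebra H \<Psi> \<Delta> \<epsilon>" "comult_compat_left H V P \<Delta> \<epsilon>"
    using iff(2)[OF braided_structures_linear(2,3)[OF that(1)]] that(2) by simp
  show "mult_compat_right V H (braid_inv H V P) m u"
    if "braided_algebra H \<Psi> m u" "mult_compat_left H V P m u"
    using iff(3)[OF braided_structures_linear(4,5)[OF that(1)]] that(2) by simp
qed

text \<open>
  For the last two statements, the inverse of the given braiding is mirrored
  first, and then one of the first two applies to it.
\<close>

theorem lemma5p1:
  fixes H :: "('k::field, 'h::ab_group_add) vs"
    and V :: "('k, 'v::ab_group_add) vs"
    and W :: "('k, 'v \<Rightarrow> 'k) vs"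
    and \<Psi>HH :: "(('h \<Rightarrow> 'h \<Rightarrow> 'k) \<Rightarrow> 'k) \<Rightarrow> ('h \<Rightarrow> 'h \<Rightarrow> 'k) \<Rightarrow> 'k"
    and \<Psi>VH :: "(('v \<Rightarrow> 'h \<Rightarrow> 'k) \<Rightarrow> 'k) \<Rightarrow> ('h \<Rightarrow> 'v \<Rightarrow> 'k) \<Rightarrow> 'k"
    and \<Psi>HV :: "(('h \<Rightarrow> 'v \<Rightarrow> 'k) \<Rightarrow> 'k) \<Rightarrow> ('v \<Rightarrow> 'h \<Rightarrow> 'k) \<Rightarrow> 'k"
    and \<Delta> :: "'h \<Rightarrow> ('h \<Rightarrow> 'h \<Rightarrow> 'k) \<Rightarrow> 'k" and \<epsilon> :: "'h \<Rightarrow> 'k"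
    and m :: "(('h \<Rightarrow> 'h \<Rightarrow> 'k) \<Rightarrow> 'k) \<Rightarrow> 'h" and u :: "'h option"
  assumes "vspace H" and "braiding H \<Psi>HH"
    and "vspace V"
    and "vsubspace W (dual V)" and "nondegenerate V W"
  shows
    "(right_braided V H \<Psi>HH \<Psi>VH \<and> dual_HW_bij H V W \<Psi>VH \<longrightarrow>
        left_braided H \<Psi>HH W (braid_HW H V W \<Psi>VH) \<and>
        (braided_coalgebra H \<Psi>HH \<Delta> \<epsilon> \<and> comult_compat_right V H \<Psi>VH \<Delta> \<epsilon> \<longrightarrow>
           comult_compat_left H W (braid_HW H V W \<Psi>VH) \<Delta> \<epsilon>) \<and>
        (braided_algebra H \<Psi>HH m u \<and> mult_compat_right V H \<Psi>VH m u \<longrightarrow>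
           mult_compat_left H W (braid_HW H V W \<Psi>VH) m u)) \<and>
     (left_braided H \<Psi>HH V \<Psi>HV \<and> dual_WH_bij H V W \<Psi>HV \<longrightarrow>
        right_braided W H \<Psi>HH (braid_WH H V W \<Psi>HV) \<and>
        (braided_coalgebra H \<Psi>HH \<Delta> \<epsilon> \<and> comult_compat_left H V \<Psi>HV \<Delta> \<epsilon> \<longrightarrow>
           comult_compat_right W H (braid_WH H V W \<Psi>HV) \<Delta> \<epsilon>) \<and>
        (braided_algebra H \<Psi>HH m u \<and> mult_compat_left H V \<Psi>HV m u \<longrightarrow>
           mult_compat_right W H (braid_WH H V W \<Psi>HV) m u)) \<and>
     (right_braided V H \<Psi>HH \<Psi>VH \<and> dual_WH_bij H V W (braid_inv V H \<Psi>VH) \<longrightarrow>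
        right_braided W H \<Psi>HH (braid_WH H V W (braid_inv V H \<Psi>VH)) \<and>
        (braided_coalgebra H \<Psi>HH \<Delta> \<epsilon> \<and> comult_compat_right V H \<Psi>VH \<Delta> \<epsilon> \<longrightarrow>
           comult_compat_right W H (braid_WH H V W (braid_inv V H \<Psi>VH)) \<Delta> \<epsilon>) \<and>
        (braided_algebra H \<Psi>HH m u \<and> mult_compat_right V H \<Psi>VH m u \<longrightarrow>
           mult_compat_right W H (braid_WH H V W (braid_inv V H \<Psi>VH)) m u)) \<and>
     (left_braided H \<Psi>HH V \<Psi>HV \<and> dual_HW_bij H V W (braid_inv H V \<Psi>HV) \<longrightarrow>
        left_braided H \<Psi>HH W (braid_HW H V W (braid_inv H V \<Psi>HV)) \<and>
        (braided_coalgebra H \<Psi>HH \<Delta> \<epsilon> \<and> comult_compat_left H V \<Psi>HV \<Delta> \<epsilon> \<longrightarrow>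
           comult_compat_left H W (braid_HW H V W (braid_inv H V \<Psi>HV)) \<Delta> \<epsilon>) \<and>
        (braided_algebra H \<Psi>HH m u \<and> mult_compat_left H V \<Psi>HV m u \<longrightarrow>
           mult_compat_left H W (braid_HW H V W (braid_inv H V \<Psi>HV)) m u))"
  by (intro conjI impI; elim conjE)
    (assumption | rule right_braided_dual[OF assms] left_braided_dual[OF assms]
      right_braided_inv[OF assms(1-3)] left_braided_inv[OF assms(1-3)])+

end
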